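(* Let $(M,d)$ be a compact metric space, $f:M\to M$ a homeomorphism, $\mu$ an ergodic $f$-invariant Borel probability measure on $M$, and $A:M\to M(d,\mathbb{R})$ a continuous map into the real $d\times d$ matrices. If $(A,f,\mu)$ has the periodic approximation property for the Lyapunov exponents, then $(A,f,\mu)$ has the periodic approximation property for the Oseledets splitting.
   Context: The letter $d$ denotes both the metric on $M$ and the dimension of $\mathbb{R}^d$; $\mathbb{R}^d$ carries the Euclidean norm. Matrices $A(x)$ need not be invertible. For $n\ge 1$ put $A^n(x)=A(f^{n-1}(x))\cdots A(f(x))A(x)$, and $A^0(x)=\mathrm{Id}$. Oseledets splitting (semi-invertible multiplicative ergodic theorem). For an ergodic $f$-invariant probability $\mu$ with $\int\log^+\|A\|\,d\mu<\infty$ there are numbers $\lambda_1>\dots>\lambda_l\ge-\infty$ (the Lyapunov exponents) and, for $\mu$-a.e. $x$ (the regular points), a measurable splitting $\mathbb{R}^d=E^{1,A}_x\oplus\dots\oplus E^{l,A}_x$ into subspaces (Oseledets subspaces) such that $\dim E^{i,A}_x$ is constant, $A(x)E^{i,A}_x\subseteq E^{i,A}_{f(x)}$ with equality if $\lambda_i>-\infty$, and $\lim_{n\to+\infty}\frac1n\log\|A^n(x)v\|=\lambda_i$ for every nonzero $v\in E^{i,A}_x$. Write $\gamma_1(A,\mu)\ge\dots\ge\gamma_d(A,\mu)$ for the Lyapunov exponents counted with multiplicity ($\lambda_i$ repeated $\dim E^{i,A}_x$ times); values and convergence are in $[-\infty,\infty)$. Periodic points. For a periodic point $p$ of period $n$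 let $\mu_p=\frac1n\sum_{j=0}^{n-1}\delta_{f^j(p)}$. The Lyapunov exponents $\gamma_i(A,p)$, $1\le i\le d$, and the Oseledets subspaces at points of $\mathrm{orb}(p)$ are those of $(A,f)$ with respect to the ergodic measure $\mu_p$. Angle. For subspaces $E,F\subseteq\mathbb{R}^d$ let $\mathrm{dist}(w,E)=\inf_{v\in E}\|w-v\|$, $\mathrm{dist}(E,F)=\sup\{\mathrm{dist}(v/\|v\|,F),\mathrm{dist}(w/\|w\|,E): 0\ne v\in E,\ 0\ne w\in F\}$, and $\measuredangle(E,F)=\sin^{-1}(\mathrm{dist}(E,F))$. Periodic approximation property for the Lyapunov exponents: there is a sequence $(p_k)_{k\in\mathbb{N}}$ of periodic points with $\mu_{p_k}\to\mu$ in the weak$^*$ topology and $\gamma_j(A,p_k)\to\gamma_j(A,\mu)$ for every $j=1,\dots,d$. Periodic approximation property for the Oseledets splitting: there is a sequence $(p_k)_{k\in\mathbb{N}}$ of periodic points with $\mu_{p_k}\to\mu$ weak$^*$ and, for each $k$, a set $\mathcal{G}_k\subset M$ with $\mu(\mathcal{G}_k)>1-\frac1k$ such that for every $x\in\mathcal{G}_k$ there is $q\in\mathrm{orb}(p_k)$ with $\measuredangle(E^{j,A}_x,F^{j,A}_q)<\frac1k$ for every $j=1,\dots,l$. Here, if $\gamma_{i_1}(A,\mu)\ge\dots\ge\gamma_{i_t}(A,\mu)$ are the (consecutively indexed) Lyapunov exponents associated to $E^{j,A}_x$, i.e. the indices run from $\sum_{i<j}\dim E^{i,A}_x+1$ to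 $\sum_{i\le j}\dim E^{i,A}_x$, then $F^{j,A}_q$ is the sum of the Oseledets subspaces of $A$ at $q$ associated to the exponents $\gamma_{i_1}(A,p_k)\ge\dots\ge\gamma_{i_t}(A,p_k)$. *)

theory Defs
  imports "HOL-Probability.Probability"
begin

text \<open>
  Throughout, \<open>A :: 'a \<Rightarrow> real^'d^'d\<close> is a matrix-valued map, and the dimension is \<open>CARD('d)\<close>.
\<close>

definition invariant_prob :: "('a::topological_space \<Rightarrow> 'a) \<Rightarrow> 'a measure \<Rightarrow> bool" where
  "invariant_prob f \<mu> \<longleftrightarrow> sets \<mu> = sets borel \<and> prob_space \<mu> \<and> distr \<mu> borel f = \<mu>"

definition ergodic_prob :: "('a::topological_space \<Rightarrow> 'a) \<Rightarrow> 'a measure \<Rightarrow> bool" where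
  "ergodic_prob f \<mu> \<longleftrightarrow> invariant_prob f \<mu> \<and>
     (\<forall>B\<in>sets borel. f -` B = B \<longrightarrow> measure \<mu> B = 0 \<or> measure \<mu> B = 1)"

fun cocycle :: "('a \<Rightarrow> 'a) \<Rightarrow> ('a \<Rightarrow> real^'d^'d) \<Rightarrow> nat \<Rightarrow> 'a \<Rightarrow> real^'d^'d" where
  "cocycle f A 0 x = mat 1"
| "cocycle f A (Suc n) x = A ((f ^^ n) x) ** cocycle f A n x"

text \<open>Logarithm of a nonnegative real with \<open>log 0 = -\<infinity>\<close> (the library has \<open>ln 0 = 0\<close>).\<close>

definition elog :: "real \<Rightarrow> ereal" where
  "elog r = (if r = 0 then -\<infinity> else ereal (ln r))"


section \<open>Oseledets splittings\<close>

text \<open>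
  The data of an Oseledets splitting: the number \<open>l\<close> of distinct exponents, and, for
  \<open>i \<in> {1..l}\<close>, the exponent \<open>\<lambda>\<^sub>i\<close>, its multiplicity and the subspaces \<open>E\<^sup>i\<^sub>x\<close>.
  Values at other indices are irrelevant.
\<close>

record ('a, 'd) oseledets_data =
  num :: nat
  expo :: "nat \<Rightarrow> ereal"
  mult :: "nat \<Rightarrow> nat"
  space_at :: "nat \<Rightarrow> 'a \<Rightarrow> (real^'d::finite) set"

definition direct_sum_decomposition :: "nat \<Rightarrow> (nat \<Rightarrow> (real^'d) set) \<Rightarrow> bool" where
  "direct_sum_decomposition l E \<longleftrightarrow>
     (\<forall>i\<in>{1..l}. subspace (E i)) \<and>
     (\<forall>v. \<exists>!w. w \<in> (\<Pi>\<^sub>E i\<in>{1..l}. E i) \<and> (\<Sum>i=1..l. w i) = v)"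

text \<open>
  Measurability of \<open>x \<mapsto> E\<^sup>i\<^sub>x\<close> (as a map into the Grassmannian) is expressed by measurability
  of all distance functions to \<open>E\<^sup>i\<^sub>x\<close>. The splitting is only determined almost everywhere,
  while \<open>space_at\<close> is total; passing to the completion makes its values on null sets irrelevant.
\<close>

definition oseledets_splitting ::
    "('a::topological_space \<Rightarrow> 'a) \<Rightarrow> ('a \<Rightarrow> real^'d^'d) \<Rightarrow> 'a measure
      \<Rightarrow> ('a, 'd) oseledets_data \<Rightarrow> bool" where
  "oseledets_splitting f A \<mu> D \<longleftrightarrow>
     (\<forall>i\<in>{1..num D}. \<forall>j\<in>{1..num D}. i < j \<longrightarrow> expo D j < expo D i) \<and>
     (\<forall>i\<in>{1..num D}. expo D i < \<infinity> \<and> 1 \<le> mult D i) \<and>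
     (\<forall>i\<in>{1..num D}. \<forall>v.
        (\<lambda>x. infdist v (space_at D i x)) \<in> borel_measurable (completion \<mu>)) \<and>
     (AE x in \<mu>.
        direct_sum_decomposition (num D) (\<lambda>i. space_at D i x) \<and>
        (\<forall>i\<in>{1..num D}.
           dim (space_at D i x) = mult D i \<and>
           (\<lambda>v. A x *v v) ` space_at D i x \<subseteq> space_at D i (f x) \<and>
           (expo D i > -\<infinity> \<longrightarrow> (\<lambda>v. A x *v v) ` space_at D i x = space_at D i (f x)) \<and>
           (\<forall>v\<in>space_at D i x. v \<noteq> 0 \<longrightarrow>
              (\<lambda>n. ereal (1 / real n) * elog (norm (cocycle f A n x *v v)))
                \<longlonglongrightarrow> expo D i)))"

text \<open>
  \<open>lyap D j\<close> is \<open>\<gamma>\<^sub>j\<close>, the \<open>j\<close>-th exponent counted with multiplicity, for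
  \<open>j \<in> {1..CARD('d)}\<close>; \<open>block D i\<close> is the set of indices \<open>j\<close> with \<open>\<gamma>\<^sub>j\<close> coming from \<open>E\<^sup>i\<close>.
\<close>

definition lyap :: "('a, 'd::finite) oseledets_data \<Rightarrow> nat \<Rightarrow> ereal" where
  "lyap D j = expo D (LEAST i. j \<le> (\<Sum>i'=1..i. mult D i'))"

definition block :: "('a, 'd::finite) oseledets_data \<Rightarrow> nat \<Rightarrow> nat set" where
  "block D i = {(\<Sum>i'\<in>{1..<i}. mult D i') + 1 .. (\<Sum>i'=1..i. mult D i')}"


section \<open>Periodic points and weak-star convergence\<close>

definition periodic_point :: "('a \<Rightarrow> 'a) \<Rightarrow> 'a \<Rightarrow> bool" where
  "periodic_point f p \<longleftrightarrow> (\<exists>n>0. (f ^^ n) p = p)"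

definition period :: "('a \<Rightarrow> 'a) \<Rightarrow> 'a \<Rightarrow> nat" where
  "period f p = (LEAST n. n > 0 \<and> (f ^^ n) p = p)"

definition forward_orbit :: "('a \<Rightarrow> 'a) \<Rightarrow> 'a \<Rightarrow> 'a set" where
  "forward_orbit f p = range (\<lambda>j. (f ^^ j) p)"

text \<open>The average \<open>\<mu>\<^sub>p\<close> of the Dirac measures along the orbit of \<open>p\<close>, as a Borel measure.\<close>

definition orbit_measure :: "('a::topological_space \<Rightarrow> 'a) \<Rightarrow> 'a \<Rightarrow> 'a measure" where
  "orbit_measure f p =
     distr (uniform_count_measure {0..<period f p}) borel (\<lambda>j. (f ^^ j) p)"

text \<open>On a compact space every continuous function is bounded, so this is weak-star convergence.\<close>

definition weak_star_conv :: "(nat \<Rightarrow> 'a::topological_space measure) \<Rightarrow> 'a measure \<Rightarrow> bool" where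
  "weak_star_conv \<nu> \<mu> \<longleftrightarrow>
     (\<forall>\<phi>::'a \<Rightarrow> real. continuous_on UNIV \<phi> \<longrightarrow>
        (\<lambda>k. integral\<^sup>L (\<nu> k) \<phi>) \<longlonglongrightarrow> integral\<^sup>L \<mu> \<phi>)"


section \<open>Angles\<close>

definition subspace_dist :: "(real^'d) set \<Rightarrow> (real^'d) set \<Rightarrow> real" where
  "subspace_dist E F =
     Sup ({infdist (v /\<^sub>R norm v) F | v. v \<in> E \<and> v \<noteq> 0} \<union>
          {infdist (w /\<^sub>R norm w) E | w. w \<in> F \<and> w \<noteq> 0})"

definition subspace_angle :: "(real^'d) set \<Rightarrow> (real^'d) set \<Rightarrow> real" where
  "subspace_angle E F = arcsin (subspace_dist E F)"

text \<open>
  The subspace \<open>F\<^sup>j\<^sub>q\<close>: \<open>D\<close> is the splitting of \<open>\<mu>\<close>, \<open>D'\<close> that of \<open>\<mu>\<^sub>p\<close>. The sum of a family of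
  subspaces is the span of their union.
\<close>

definition matched_space ::
    "('a, 'd::finite) oseledets_data \<Rightarrow> ('a, 'd) oseledets_data \<Rightarrow> nat \<Rightarrow> 'a \<Rightarrow> (real^'d) set" where
  "matched_space D D' j q =
     span (\<Union>i\<in>{i\<in>{1..num D'}. \<exists>r\<in>block D j. expo D' i = lyap D' r}. space_at D' i q)"


section \<open>Periodic approximation properties\<close>

text \<open>
  The exponents of \<open>\<mu>\<close> and the exponents and subspaces of \<open>\<mu>\<^sub>p\<close> (on the orbit) do not depend on
  the choice of the Oseledets data \<open>D\<close>, \<open>D'\<close>; the subspaces for \<open>\<mu>\<close> are unique almost everywhere.
  The second property is required of every version of the splitting for \<open>\<mu>\<close>.
\<close>

definition periodic_approx_exponents ::
    "('a::topological_space \<Rightarrow> 'a) \<Rightarrow> ('a \<Rightarrow> real^'d^'d) \<Rightarrow> 'a measure \<Rightarrow> bool" where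
  "periodic_approx_exponents f A \<mu> \<longleftrightarrow>
     (\<exists>D. oseledets_splitting f A \<mu> D \<and>
       (\<exists>p D'.
          (\<forall>k. periodic_point f (p k) \<and>
               oseledets_splitting f A (orbit_measure f (p k)) (D' k)) \<and>
          weak_star_conv (\<lambda>k. orbit_measure f (p k)) \<mu> \<and>
          (\<forall>j\<in>{1..CARD('d)}. (\<lambda>k. lyap (D' k) j) \<longlonglongrightarrow> lyap D j)))"

definition periodic_approx_splitting ::
    "('a::topological_space \<Rightarrow> 'a) \<Rightarrow> ('a \<Rightarrow> real^'d^'d) \<Rightarrow> 'a measure \<Rightarrow> bool" where
  "periodic_approx_splitting f A \<mu> \<longleftrightarrow>
     (\<exists>D. oseledets_splitting f A \<mu> D) \<and>
     (\<forall>D. oseledets_splitting f A \<mu> D \<longrightarrow>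
       (\<exists>p D' G.
          (\<forall>k. periodic_point f (p k) \<and>
               oseledets_splitting f A (orbit_measure f (p k)) (D' k)) \<and>
          weak_star_conv (\<lambda>k. orbit_measure f (p k)) \<mu> \<and>
          (\<forall>k\<ge>1. G k \<in> sets \<mu> \<and> measure \<mu> (G k) > 1 - 1 / real k \<and>
             (\<forall>x\<in>G k. \<exists>q\<in>forward_orbit f (p k). \<forall>j\<in>{1..num D}.
                subspace_angle (space_at D j x) (matched_space D (D' k) j q) < 1 / real k))))"

end

theory Submission
  imports Defs
begin

text \<open>
  Fix a cut of the spectrum of \<open>\<mu>\<close>: let \<open>m\<close> exponents, counted with multiplicity, lie above it,
  and let \<open>U\<^sub>x\<close> and \<open>V\<^sub>x\<close> be the sums of the Oseledets subspaces above and below it. A vector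
  that \<open>A\<^sup>n(y)\<close> does not contract far below the rate \<open>\<gamma>\<^sub>m\<close> is carried close to \<open>U\<close> at
  \<open>f\<^sup>n(y)\<close>, because its component in \<open>V\<close> only grows with the rate \<open>\<gamma>\<^bsub>m+1\<^esub>\<close>. The matter is
  therefore to see that, at most points \<open>q\<close> of a periodic orbit \<open>p\<^sub>k\<close>, no vector of the fast
  space \<open>U'\<^sub>q\<close> of the orbit is contracted below this rate.

  This follows from volumes. Let \<open>q\<close> be close to a point at which the upper bounds
  \<open>\<parallel>A\<^sup>n|E\<^sup>i\<parallel> \<le> exp (n (\<lambda>\<^sub>i + \<epsilon>))\<close> hold. Then \<open>A\<^sup>n(q)\<close> multiplies \<open>m\<close>-dimensional volume by at
  most about \<open>exp (n (\<gamma>\<^sub>1 + \<dots> + \<gamma>\<^sub>m))\<close> (\<open>block_volume_le\<close>). Along the periodic orbit the logarithm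
  of the volume growth on \<open>U'\<close> has the mean \<open>\<gamma>\<^sub>1(p\<^sub>k) + \<dots> + \<gamma>\<^sub>m(p\<^sub>k)\<close> (\<open>periodic_volume_growth\<close>),
  which is almost the same number. So nearly all blocks of length \<open>n\<close> lose almost no volume
  (\<open>card_low_block_sums_le\<close>), and a block that loses no volume contracts no vector of \<open>U'\<close> below
  \<open>exp (n \<gamma>\<^sub>m)\<close> (\<open>large_volume_preimage\<close>). At the \<open>\<mu>\<close>-typical points only
  upper bounds on \<open>A\<^sup>n\<close> enter, so that singular matrices and the exponent \<open>-\<infinity>\<close> do no harm.

  The slow spaces are treated by duality: the transposed matrices carry the annihilators of the
  slow spaces backwards along the orbit, these annihilators are the fast spaces of the transposed
  products, and the same volume argument applies to them (\<open>cut_estimate\<close>). Each \<open>F\<^sup>j\<^sub>q\<close> lies in a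
  fast and in a slow space of the orbit, and a comparison of dimensions then yields that it is close
  to \<open>E\<^sup>j\<^sub>x\<close> (\<open>matched_space_close\<close>).

  It remains to reach almost every \<open>x\<close>. The regular points are divided into finitely many cells on
  which the splitting varies little (\<open>exists_cells\<close>). The proportion of exceptional orbit points can
  be made smaller than the mass of the lightest cell of positive mass. By weak-star convergence the
  orbit visits a neighbourhood of each such cell with a larger frequency, so it does so
  at an orbit point that is not exceptional (\<open>exists_good_orbit_point\<close>).

  Subspaces are represented by projections: \<open>oproj D x i\<close> is the projection onto \<open>E\<^sup>i\<^sub>x\<close> along the
  other subspaces. The bundle maps, their duals and their measurability thus become statements about
  matrices.
\<close>

section \<open>Matrices and their norms\<close>

text \<open>
  These rules turn \<open>transpose A *v x\<close> into \<open>x v* A\<close>; transposes occur here as linear maps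
  in their own right, so this normal form is undesirable.
\<close>

declare transpose_matrix_vector [simp del]
declare vector_transpose_matrix [simp del]

abbreviation rng :: "real^'n^'m \<Rightarrow> (real^'m) set" where
  "rng A \<equiv> range ((*v) A)"

abbreviation small_on :: "real \<Rightarrow> real^'n^'m \<Rightarrow> (real^'n) set \<Rightarrow> bool" where
  "small_on \<eta> R W \<equiv> \<forall>w\<in>W. norm (R *v w) \<le> \<eta> * norm w"

text \<open>
  The norm of \<open>real^'n^'m\<close> is the Frobenius norm. Unlike the operator norm it is visibly invariant
  under transposition, and it is still submultiplicative.
\<close>

lemma norm_matrix_vector_mult_le:
  fixes A :: "real^'n^'m"
  shows "norm (A *v x) \<le> norm A * norm x"
proof -
  have 1: "\<bar>(A *v x) $ i\<bar> \<le> norm (A $ i) * norm x" for i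
    by (simp add: matrix_vector_mul_component Cauchy_Schwarz_ineq2)
  have "norm (A *v x) = L2_set (\<lambda>i. norm ((A *v x) $ i)) UNIV"
    by (simp add: norm_vec_def)
  also have "\<dots> \<le> L2_set (\<lambda>i. norm (A $ i) * norm x) UNIV"
    by (rule L2_set_mono) (use 1 in auto)
  also have "\<dots> = norm A * norm x"
    by (simp add: norm_vec_def [of A] L2_set_left_distrib)
  finally show ?thesis .
qed

lemma norm_transpose_matrix: "norm (transpose A) = norm (A :: real^'n^'m)"
proof -
  have "norm (transpose A) ^ 2 = norm A ^ 2"
    unfolding power2_norm_eq_inner by (simp add: inner_vec_def transpose_def) (rule sum.swap)
  then show ?thesis by (metis norm_ge_zero power2_eq_imp_eq)
qed

lemma norm_matrix_mult_le: "norm (A ** B) \<le> norm A * norm (B :: real^'k^'n)" for A :: "real^'n^'m"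
proof -
  have "(A ** B) $ i = transpose B *v (A $ i)" for i
    by (simp add: vec_eq_iff matrix_matrix_mult_def matrix_vector_mult_def transpose_def mult.commute)
  then have "norm ((A ** B) $ i) \<le> norm (A $ i) * norm B" for i
    by (metis norm_matrix_vector_mult_le norm_transpose_matrix mult.commute)
  then have "L2_set (\<lambda>i. norm ((A ** B) $ i)) UNIV \<le> L2_set (\<lambda>i. norm (A $ i) * norm B) UNIV"
    by (intro L2_set_mono) auto
  then show ?thesis by (simp add: norm_vec_def [of A] norm_vec_def [of "A**B"] L2_set_left_distrib)
qed

text \<open>
  This is Hadamard's inequality with a wasteful constant, read off from the Leibniz formula. The
  constant is independent of the matrix, and so it disappears in exponential growth rates.
\<close>

lemma abs_det_le_prod_columns:
  fixes A :: "real^'n^'n"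
  shows "\<bar>det A\<bar> \<le> fact CARD('n) * (\<Prod>i\<in>UNIV. norm (column i A))"
proof -
  have "\<bar>det A\<bar> = \<bar>det (transpose A)\<bar>" by (simp add: det_transpose)
  also have "\<dots> \<le> (\<Sum>p | p permutes UNIV. \<bar>of_int (sign p) * (\<Prod>i\<in>UNIV. transpose A $ i $ p i)\<bar>)"
    unfolding det_def by (rule sum_abs)
  also have "\<dots> \<le> (\<Sum>p | p permutes (UNIV::'n set). (\<Prod>i\<in>UNIV. norm (column i A)))"
  proof (rule sum_mono)
    fix p :: "'n \<Rightarrow> 'n"
    have "(\<Prod>i\<in>UNIV. \<bar>transpose A $ i $ p i\<bar>) \<le> (\<Prod>i\<in>UNIV. norm (column i A))"
      by (rule prod_mono) (use component_le_norm_cart[of "column i A" for i] in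
          \<open>auto simp: transpose_def column_def\<close>)
    moreover have "\<bar>of_int (sign p) :: real\<bar> = 1" by (simp add: sign_def)
    ultimately show "\<bar>of_int (sign p) * (\<Prod>i\<in>UNIV. transpose A $ i $ p i)\<bar> \<le> (\<Prod>i\<in>UNIV. norm (column i A))"
      by (simp add: abs_mult abs_prod)
  qed
  also have "\<dots> = fact CARD('n) * (\<Prod>i\<in>UNIV. norm (column i A))"
    by (simp add: card_permutations)
  finally show ?thesis .
qed

lemma matrix_sub_rdistrib: "(A - B) ** C = A ** C - B ** (C :: real^'k^'n)" for A :: "real^'n^'m"
  by (simp add: matrix_matrix_mult_def vec_eq_iff left_diff_distrib sum_subtractf)

lemma matrix_sub_ldistrib: "A ** (B - C) = A ** B - A ** (C :: real^'k^'n)" for A :: "real^'n^'m"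
  by (simp add: matrix_matrix_mult_def vec_eq_iff right_diff_distrib sum_subtractf)

lemma matrix_add_rdistrib: "(A + B) ** C = A ** C + B ** (C :: real^'k^'n)" for A :: "real^'n^'m"
  by (simp add: matrix_matrix_mult_def vec_eq_iff distrib_right sum.distrib)

lemma matrix_scaleR_mult: "(c *\<^sub>R A) ** B = c *\<^sub>R (A ** (B :: real^'k^'n))" "A ** (c *\<^sub>R B)
    = c *\<^sub>R (A ** B)"
  for A :: "real^'n^'m"
  by (simp_all add: matrix_matrix_mult_def vec_eq_iff sum_distrib_left mult_ac)

lemma transpose_add: "transpose (A + B) = transpose A + transpose (B :: real^'n^'m)"
  by (simp add: transpose_def vec_eq_iff)

lemma transpose_diff: "transpose (A - B) = transpose A - transpose (B :: real^'n^'m)"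
  by (simp add: transpose_def vec_eq_iff)

lemma inner_transpose: "(transpose A *v x) \<bullet> y = x \<bullet> (A *v (y :: real^'n))" for A :: "real^'n^'m"
  by (simp add: dot_lmul_matrix transpose_matrix_vector)

lemma subspace_range_matrix: "subspace (rng (A :: real^'n^'m))"
  by (intro linear_subspace_image) auto

lemmas matrix_ring_simps = matrix_add_ldistrib matrix_add_rdistrib matrix_sub_rdistrib
  matrix_sub_ldistrib matrix_mul_assoc

section \<open>The volume growth of a matrix on a subspace\<close>

definition coord_proj :: "'n set \<Rightarrow> real^'n^'n" where
  "coord_proj S = (\<chi> i j. if i = j \<and> i \<in> S then 1 else 0)"

lemma coord_proj_mult: "(coord_proj S *v x) $ i = (if i \<in> S then x $ i else 0)"
  by (simp add: coord_proj_def matrix_vector_mult_def if_distrib [where f="\<lambda>a. a * _"] cong: if_cong)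

lemma coord_proj_idem: "coord_proj S ** coord_proj S = coord_proj S"
  by (simp add: matrix_eq matrix_vector_mul_assoc [symmetric]) (simp add: vec_eq_iff coord_proj_mult)

lemma transpose_coord_proj: "transpose (coord_proj S) = coord_proj S"
  by (auto simp: transpose_def coord_proj_def vec_eq_iff)

text \<open>
  A frame identifies \<open>W\<close> isometrically with the coordinate subspace of the indices in \<open>S\<close>. It is
  extended to an orthogonal matrix of the whole space because the dimension of a matrix is part of
  its type, while the dimension of \<open>W\<close> has to vary.
\<close>

definition is_frame :: "'n set \<Rightarrow> real^'n^'n \<Rightarrow> (real^'n) set \<Rightarrow> bool" where
  "is_frame S U W \<longleftrightarrow> orthogonal_matrix U \<and> rng (U ** coord_proj S) = W"

lemma orthonormal_independent:
  fixes B :: "(real^'n) set"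
  assumes "pairwise orthogonal B" "\<And>b. b \<in> B \<Longrightarrow> norm b = 1"
  shows "independent B"
  using assms pairwise_orthogonal_independent by fastforce

lemma frame_of_basis:
  fixes W :: "(real^'n) set"
  assumes W: "subspace W" and B: "B \<subseteq> W" "pairwise orthogonal B" "\<And>b. b \<in> B \<Longrightarrow> norm b = 1"
    and c: "card B = dim W" "card S = dim W"
  shows "\<exists>U. is_frame S U W \<and> bij_betw (\<lambda>i. column i U) S B"
proof -
  define W' where "W' = {y. \<forall>x\<in>W. orthogonal x y}"
  have W': "subspace W'"
    unfolding W'_def by (rule subspace_orthogonal_to_vectors)
  have dW: "dim W' + dim W = CARD('n)"
    using dim_subspace_orthogonal_to_vectors[of W UNIV] W by (simp add: W'_def)
  obtain C where C: "C \<subseteq> W'" "pairwise orthogonal C" "\<And>x. x \<in> C \<Longrightarrow> norm x = 1" "independent C"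
      "card C = dim W'" "span C = W'"
    using orthonormal_basis_subspace[OF W'] by metis
  have indB: "independent B" using orthonormal_independent B by blast
  have fB: "finite B" and fC: "finite C" using indB C(4) by (auto intro: independent_imp_finite)
  have disj: "B \<inter> C = {}"
  proof -
    have "norm x = 0" if "x \<in> B" "x \<in> C" for x
    proof -
      have "orthogonal x x" using that B(1) C(1) W'_def by auto
      then show ?thesis by (simp add: orthogonal_def)
    qed
    then show ?thesis using B(3) by force
  qed
  obtain g where g: "bij_betw g S B"
    using c fB by (metis finite bij_betw_iff_card)
  have "card (- S) = card C" using C(5) c dW by (simp add: Compl_eq_Diff_UNIV card_Diff_subset)
  then obtain h where h: "bij_betw h (- S) C"
    using fC by (metis finite bij_betw_iff_card)
  define b where "b i = (if i \<in> S then g i else h i)" for i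
  have bS: "b i \<in> B" if "i \<in> S" for i using that g by (auto simp: b_def bij_betw_def)
  have bnS: "b i \<in> C" if "i \<notin> S" for i using that h by (auto simp: b_def bij_betw_def)
  have b1: "norm (b i) = 1" for i using bS bnS B(3) C(3) by (cases "i \<in> S") auto
  have binj: "inj b"
  proof (rule injI)
    fix i j assume eq: "b i = b j"
    have "i \<in> S \<longleftrightarrow> j \<in> S" using bS bnS disj eq by (metis disjoint_iff)
    then show "i = j" using eq g h unfolding b_def bij_betw_def inj_on_def
      by (metis ComplI)
  qed
  have orth: "b i \<bullet> b j = 0" if "i \<noteq> j" for i j
  proof -
    have ne: "b i \<noteq> b j" using binj that by (auto dest: injD)
    consider "i \<in> S" "j \<in> S" | "i \<in> S" "j \<notin> S" | "i \<notin> S" "j \<in> S" | "i \<notin> S" "j \<notin> S" by blast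
    then show ?thesis
    proof cases
      case 1 then show ?thesis using ne bS B(2) by (auto simp: pairwise_def orthogonal_def)
    next
      case 2 then have "b i \<in> W" "b j \<in> W'" using bS bnS B(1) C(1) by auto
      then show ?thesis by (auto simp: W'_def orthogonal_def)
    next
      case 3 then have "b j \<in> W" "b i \<in> W'" using bS bnS B(1) C(1) by auto
      then show ?thesis by (auto simp: W'_def orthogonal_def inner_commute)
    next
      case 4 then show ?thesis using ne bnS C(2) by (auto simp: pairwise_def orthogonal_def)
    qed
  qed
  define U :: "real^'n^'n" where "U = (\<chi> i j. b j $ i)"
  have col: "column i U = b i" for i by (simp add: U_def column_def)
  have U: "orthogonal_matrix U"
    unfolding orthogonal_matrix_orthonormal_columns
    using orth b1 by (auto simp: col orthogonal_def)
  have sub: "rng (U ** coord_proj S) \<subseteq> W"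
  proof safe
    fix x :: "real^'n"
    have "(U ** coord_proj S) *v x = (\<Sum>i\<in>UNIV. (coord_proj S *v x) $ i *s column i U)"
      by (simp only: matrix_vector_mul_assoc [symmetric] matrix_mult_sum [of U])
    also have "\<dots> \<in> W"
    proof (rule subspace_sum[OF W])
      fix i
      show "(coord_proj S *v x) $ i *s column i U \<in> W"
        using bS[of i] B(1) W
        by (cases "i \<in> S") (auto simp: coord_proj_mult col scalar_mult_eq_scaleR subspace_0 subspace_scale)
    qed
    finally show "(U ** coord_proj S) *v x \<in> W" .
  qed
  have "W \<subseteq> span B" using indB fB B(1) c card_ge_dim_independent by (metis order_refl)
  moreover have "span B \<subseteq> rng (U ** coord_proj S)"
  proof (rule span_minimal)
    show "subspace (rng (U ** coord_proj S))"
      by (simp add: subspace_range_matrix)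
    show "B \<subseteq> rng (U ** coord_proj S)"
    proof
      fix v assume "v \<in> B"
      then obtain i where i: "i \<in> S" "v = b i" using g by (auto simp: bij_betw_def b_def)
      have e: "coord_proj S *v axis i 1 = axis i 1"
        unfolding vec_eq_iff coord_proj_mult using i by (auto simp: axis_def)
      have "(U ** coord_proj S) *v axis i 1 = U *v (coord_proj S *v axis i 1)"
        by (simp only: matrix_vector_mul_assoc)
      also have "\<dots> = v"
        unfolding e by (simp add: matrix_vector_mult_basis col i)
      finally have "(U ** coord_proj S) *v axis i 1 = v" .
      then show "v \<in> rng (U ** coord_proj S)" by (metis rangeI)
    qed
  qed
  ultimately have "rng (U ** coord_proj S) = W" using sub by blast
  moreover have "bij_betw (\<lambda>i. column i U) S B"
    using g by (simp add: col b_def cong: bij_betw_cong)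
  ultimately show ?thesis using U by (auto simp: is_frame_def)
qed

definition std_index :: "nat \<Rightarrow> 'n::finite set" where
  "std_index m = (SOME S. card S = m)"

definition frame :: "(real^'n) set \<Rightarrow> real^'n^'n" where
  "frame W = (SOME U. is_frame (std_index (dim W)) U W)"

text \<open>
  For \<open>T\<close> mapping \<open>W\<close> into a subspace \<open>W'\<close> of the same dimension, this is the absolute value of the
  determinant of \<open>T : W \<rightarrow> W'\<close> in orthonormal bases: \<open>T\<close> is written in frames of the two spaces,
  restricted to the coordinate subspace, and completed by the identity on the other coordinates.
\<close>

definition vol :: "real^'n^'n \<Rightarrow> (real^'n) set \<Rightarrow> (real^'n) set \<Rightarrow> real" where
  "vol T W W' = \<bar>det (transpose (frame W') ** T ** frame W ** coord_proj (std_index (dim W))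
                     + (mat 1 - coord_proj (std_index (dim W))))\<bar>"

lemma card_std_index: "m \<le> CARD('n) \<Longrightarrow> card (std_index m :: 'n::finite set) = m"
  unfolding std_index_def
  by (rule someI_ex) (metis obtain_subset_with_card_n)

lemma card_std_index_dim: "card (std_index (dim W) :: 'n set) = dim (W :: (real^'n) set)"
  by (metis card_std_index dim_subset_UNIV_cart)

lemma is_frame_frame: "subspace W \<Longrightarrow> is_frame (std_index (dim W)) (frame W) W"
proof -
  assume W: "subspace W"
  obtain B where "B \<subseteq> W" "pairwise orthogonal B" "\<And>x. x \<in> B \<Longrightarrow> norm x = 1" "card B = dim W"
    using orthonormal_basis_subspace[OF W] by metis
  from frame_of_basis[OF W this card_std_index_dim]
  show ?thesis unfolding frame_def by (metis (mono_tags, lifting) someI_ex)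
qed

lemma orthogonal_matrix_inverses: "orthogonal_matrix U \<Longrightarrow> transpose U ** U = mat 1 \<and> U ** transpose U
    = mat 1"
  for U :: "real^'n^'n"
  by (simp add: orthogonal_matrix_def)

text \<open>
  In frames, a matrix that maps \<open>W\<close> into \<open>W'\<close> preserves the coordinate subspace. This is what makes
  the completed matrices multiply correctly.
\<close>

lemma frame_maps:
  fixes T U U' :: "real^'n^'n"
  assumes F: "is_frame S U W" and G: "is_frame S U' W'" and T: "\<And>w. w \<in> W \<Longrightarrow> T *v w \<in> W'"
  shows "coord_proj S ** (transpose U' ** T ** U ** coord_proj S) = transpose U' ** T ** U ** coord_proj S"
    (is "?P ** ?X = ?X")
  unfolding matrix_eq
proof
  fix x :: "real^'n"
  have "(U ** ?P) *v x \<in> W" using F by (auto simp: is_frame_def)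
  from T[OF this] obtain y where y: "T *v ((U ** ?P) *v x) = (U' ** ?P) *v y"
    using G by (auto simp: is_frame_def)
  have "?X *v x = transpose U' *v (T *v ((U ** ?P) *v x))"
    by (simp add: matrix_vector_mul_assoc matrix_mul_assoc)
  also have "\<dots> = ?P *v y"
    unfolding y using G by (simp add: matrix_vector_mul_assoc matrix_mul_assoc is_frame_def
        orthogonal_matrix_inverses)
  finally have e: "?X *v x = ?P *v y" .
  show "(?P ** ?X) *v x = ?X *v x"
    by (simp only: matrix_vector_mul_assoc [of ?P ?X, symmetric] e) (simp add: matrix_vector_mul_assoc
        coord_proj_idem)
qed

lemma vol_mult:
  fixes T1 T2 :: "real^'n^'n"
  assumes W: "subspace W" "subspace W'" "subspace W''" and d: "dim W' = dim W" "dim W'' = dim W"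
    and T: "\<And>w. w \<in> W \<Longrightarrow> T1 *v w \<in> W'"
  shows "vol (T2 ** T1) W W'' = vol T2 W' W'' * vol T1 W W'"
proof -
  define P :: "real^'n^'n" where "P = coord_proj (std_index (dim W))"
  define U U' U'' where U: "U = frame W" "U' = frame W'" "U'' = frame W''"
  define X1 X2 where X: "X1 = transpose U' ** T1 ** U" "X2 = transpose U'' ** T2 ** U'"
  have F: "is_frame (std_index (dim W)) U W" "is_frame (std_index (dim W)) U' W'"
    using W d is_frame_frame unfolding U by metis+
  have PX: "P ** (X1 ** P) = X1 ** P"
    using frame_maps[OF F T] by (simp add: X P_def)
  have PP: "P ** P = P" by (simp add: P_def coord_proj_idem)
  have o: "U' ** transpose U' = mat 1" using F by (simp add: is_frame_def orthogonal_matrix_inverses)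
  have XX: "X2 ** X1 = transpose U'' ** (T2 ** T1) ** U"
    using o unfolding X by (metis matrix_mul_assoc matrix_mul_rid)
  have "(X2 ** P + (mat 1 - P)) ** (X1 ** P + (mat 1 - P))
      = X2 ** (P ** (X1 ** P)) + (X2 ** P - X2 ** (P ** P)) + (X1 ** P - P ** (X1 ** P))
          + (mat 1 - P - P + P ** P)"
    by (simp add: matrix_ring_simps)
  also have "\<dots> = X2 ** X1 ** P + (mat 1 - P)"
    unfolding PX PP by (simp add: matrix_mul_assoc)
  finally have "det (X2 ** X1 ** P + (mat 1 - P)) = det (X2 ** P + (mat 1 - P)) * det (X1 ** P
      + (mat 1 - P))"
    by (metis det_mul)
  then show ?thesis
    unfolding vol_def using XX d by (simp add: U [symmetric] P_def [symmetric] X [symmetric] abs_mult)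
qed

text \<open>
  The frame in the definition of the volume may be replaced by one whose columns are the given
  basis: the change of frame is an orthogonal matrix that preserves the coordinate subspace. The
  columns of the resulting matrix have the norms of the vectors \<open>T b\<close>.
\<close>

lemma vol_le_prod_basis:
  fixes T :: "real^'n^'n"
  assumes W: "subspace W" "subspace W'" and d: "dim W' = dim W"
    and T: "\<And>w. w \<in> W \<Longrightarrow> T *v w \<in> W'"
    and B: "B \<subseteq> W" "pairwise orthogonal B" "\<And>b. b \<in> B \<Longrightarrow> norm b = 1" "card B = dim W"
  shows "vol T W W' \<le> fact CARD('n) * (\<Prod>b\<in>B. norm (T *v b))"
proof -
  define S :: "'n set" where "S = std_index (dim W)"
  define P :: "real^'n^'n" where "P = coord_proj S"
  define U U' where U: "U = frame W" "U' = frame W'"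
  have F: "is_frame S U W" "is_frame S U' W'"
    using W d is_frame_frame unfolding U S_def by metis+
  obtain V where V: "is_frame S V W" and bij: "bij_betw (\<lambda>i. column i V) S B"
    using frame_of_basis[OF W(1) B card_std_index_dim] unfolding S_def by blast
  define R where "R = transpose U ** V"
  have PP: "P ** P = P" and Pt: "transpose P = P"
      by (simp_all add: P_def coord_proj_idem transpose_coord_proj)
  have PR: "P ** (R ** P) = R ** P"
    using frame_maps[OF V F(1), of "mat 1"] by (simp add: R_def P_def)
  then have QR: "(mat 1 - P) ** (R ** P) = 0" by (simp add: matrix_ring_simps)
  have RR: "transpose R ** R = mat 1"
    using F V unfolding R_def is_frame_def orthogonal_matrix_def matrix_transpose_mul
    by (metis matrix_mul_assoc matrix_mul_rid transpose_transpose)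
  have PRt: "(P ** transpose R) ** (mat 1 - P) = 0"
    using arg_cong[OF QR, of transpose]
    by (simp add: matrix_transpose_mul transpose_diff Pt) (simp add: transpose_def vec_eq_iff)
  define Z where "Z = R ** P + (mat 1 - P)"
  have "transpose Z ** Z = (P ** transpose R + (mat 1 - P)) ** (R ** P + (mat 1 - P))"
    by (simp add: Z_def transpose_add transpose_diff matrix_transpose_mul Pt)
  also have "\<dots> = P ** (transpose R ** R) ** P + (P ** transpose R) ** (mat 1 - P)
      + (mat 1 - P) ** (R ** P) + (mat 1 - P) ** (mat 1 - P)"
    by (simp only: matrix_add_ldistrib matrix_add_rdistrib matrix_mul_assoc add_ac)
  also have "\<dots> = mat 1"
    unfolding QR PRt RR by (simp add: matrix_ring_simps PP)
  finally have "orthogonal_matrix Z" by (simp add: orthogonal_matrix)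
  then have dZ: "\<bar>det Z\<bar> = 1" using det_orthogonal_matrix[of Z] by auto
  define X where "X = transpose U' ** T ** U"
  define M where "M = transpose U' ** T ** V ** P + (mat 1 - P)"
  have XR: "X ** R = transpose U' ** T ** V"
    using F unfolding X_def R_def is_frame_def orthogonal_matrix_def
    by (metis matrix_mul_assoc matrix_mul_rid)
  have "(X ** P + (mat 1 - P)) ** Z
      = X ** (P ** (R ** P)) + (X ** P - X ** (P ** P)) + (mat 1 - P) ** (R ** P) + (mat 1 - P - P
          + P ** P)"
    unfolding Z_def by (simp add: matrix_ring_simps)
  also have "\<dots> = M" unfolding QR PR PP M_def XR [symmetric] by (simp add: matrix_mul_assoc)
  finally have "\<bar>det M\<bar> = \<bar>det (X ** P + (mat 1 - P))\<bar>"
    using dZ by (metis abs_mult det_mul mult.right_neutral)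
  also have "\<dots> = vol T W W'" by (simp add: vol_def X_def U P_def S_def)
  finally have vM: "vol T W W' = \<bar>det M\<bar>" by simp
  have col: "norm (column i M) = (if i \<in> S then norm (T *v column i V) else 1)" for i
  proof -
    have c: "column i M = M *v axis i 1" by (simp add: matrix_vector_mult_basis)
    have Pa: "P *v axis i 1 = (if i \<in> S then axis i 1 else 0)"
      by (auto simp: P_def vec_eq_iff coord_proj_mult axis_def)
    have Ma: "M *v axis i 1 = transpose U' *v (T *v (V *v (P *v axis i 1))) + (axis i 1 - P *v axis i 1)"
      unfolding M_def by (simp only: matrix_vector_mult_add_rdistrib matrix_vector_mult_diff_rdistrib
          matrix_vector_mul_assoc matrix_mul_assoc matrix_vector_mul_lid)
    have "norm (transpose U' *v x) = norm x" for x
      using F(2) unfolding norm_eq inner_transpose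
      by (simp add: matrix_vector_mul_assoc is_frame_def orthogonal_matrix_def)
    then show ?thesis
      unfolding c Ma Pa by (simp add: matrix_vector_mult_basis norm_axis_1)
  qed
  have "\<bar>det M\<bar> \<le> fact CARD('n) * (\<Prod>i\<in>UNIV. norm (column i M))"
    by (rule abs_det_le_prod_columns)
  also have "(\<Prod>i\<in>UNIV. norm (column i M)) = (\<Prod>i\<in>S. norm (T *v column i V))"
    unfolding col by (subst prod.If_cases) auto
  also have "\<dots> = (\<Prod>b\<in>B. norm (T *v b))"
    by (rule prod.reindex_bij_betw[OF bij, of "\<lambda>b. norm (T *v b)"])
  finally show ?thesis using vM by simp
qed

lemma vol_nonneg: "vol T W W' \<ge> 0"
  by (simp add: vol_def)

text \<open>
  For an endomorphism of \<open>W\<close> the frames cancel, and the orthogonal projection onto \<open>W\<close> may be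
  replaced by any other projection \<open>Q\<close> onto \<open>W\<close> that commutes with \<open>T\<close>. The two completions
  are conjugate by the unipotent matrix \<open>1 + K - Q\<close>, where \<open>K\<close> is the orthogonal projection.
\<close>

lemma vol_eq_abs_det:
  fixes T :: "real^'n^'n"
  assumes W: "W = rng Q" and Q: "Q ** Q = Q" and C: "T ** Q = Q ** T"
  shows "vol T W W = \<bar>det (T ** Q + (mat 1 - Q))\<bar>"
proof -
  have sW: "subspace W" unfolding W by (simp add: subspace_range_matrix)
  define S :: "'n set" where "S = std_index (dim W)"
  define P :: "real^'n^'n" where "P = coord_proj S"
  define U where U: "U = frame W"
  have F: "is_frame S U W"
    using sW is_frame_frame unfolding U S_def by metis
  have UU: "transpose U ** U = mat 1" "U ** transpose U = mat 1"
    using F by (auto simp: is_frame_def orthogonal_matrix_def)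
  define K where "K = U ** P ** transpose U"
  have PP: "P ** P = P" by (simp add: P_def coord_proj_idem)
  have KU: "K ** (U ** P) = U ** P"
    using UU PP unfolding K_def by (metis matrix_mul_assoc matrix_mul_rid)
  have KK: "K ** K = K"
    using KU unfolding K_def by (metis matrix_mul_assoc)
  have Kw: "K *v w = w" if "w \<in> W" for w
    using that F KU unfolding is_frame_def by (auto simp: matrix_vector_mul_assoc P_def)
  have Qw: "Q *v w = w" if "w \<in> W" for w
    using that W Q by (auto simp: matrix_vector_mul_assoc)
  have KQ: "K ** Q = Q" unfolding matrix_eq using Kw W by (auto simp: matrix_vector_mul_assoc [symmetric])
  have "K *v x \<in> W" for x
    using F unfolding K_def P_def is_frame_def
        by (auto simp: matrix_vector_mul_assoc [symmetric] simp del: matrix_vector_mul_assoc)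
  then have QK: "Q ** K = K" unfolding matrix_eq using Qw
      by (auto simp: matrix_vector_mul_assoc [symmetric])
  have TK: "T ** K = Q ** (T ** K)"
    by (metis C QK matrix_mul_assoc)
  have KTK: "K ** (T ** K) = T ** K"
    by (metis TK KQ matrix_mul_assoc)
  \<comment> \<open>\<open>(K - Q)\<^sup>2 = 0\<close>, so \<open>h\<close> is invertible; it intertwines the two completions\<close>
  define h where "h = mat 1 + (K - Q)"
  define M where "M = T ** Q + (mat 1 - Q)"
  define M' where "M' = T ** K + (mat 1 - K)"
  have "M ** h = T ** Q + T ** (Q ** K) - T ** (Q ** Q) + (mat 1 + K - Q - Q - Q ** K + Q ** Q)"
    unfolding M_def h_def by (simp add: matrix_ring_simps)
  also have "\<dots> = T ** K + mat 1 - Q" unfolding QK Q by simp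
  finally have 1: "M ** h = T ** K + mat 1 - Q" .
  have "h ** M' = T ** K + (mat 1 - K) + K ** (T ** K) + (K - K ** K) - Q ** (T ** K) - (Q - Q ** K)"
    unfolding M'_def h_def by (simp add: matrix_ring_simps)
  also have "\<dots> = T ** K + mat 1 - Q" unfolding QK KK KTK TK [symmetric] by simp
  finally have 2: "M ** h = h ** M'" using 1 by simp
  have "h ** (mat 1 - (K - Q)) = mat 1 - K ** K + K ** Q + Q ** K - Q ** Q"
    unfolding h_def by (simp add: matrix_ring_simps)
  also have "\<dots> = mat 1" unfolding KK KQ QK Q by simp
  finally have "det h * det (mat 1 - (K - Q)) = 1" by (metis det_I det_mul)
  then have "det h \<noteq> 0" by auto
  moreover have "det M * det h = det h * det M'" using arg_cong[OF 2, of det] by (simp add: det_mul)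
  ultimately have dM: "det M = det M'" by simp
  have "transpose U ** M' ** U = transpose U ** T ** U ** P ** (transpose U ** U)
      + (transpose U ** U - (transpose U ** U) ** P ** (transpose U ** U))"
    unfolding M'_def K_def by (simp add: matrix_ring_simps)
  also have "\<dots> = transpose U ** T ** U ** P + (mat 1 - P)" by (simp add: UU)
  finally have "vol T W W = \<bar>det (transpose U ** M' ** U)\<bar>" by (simp add: vol_def U P_def S_def)
  also have "det (transpose U ** M' ** U) = det M' * det (transpose U ** U)" by (simp only: det_mul mult_ac)
  finally have "vol T W W = \<bar>det M'\<bar>" by (simp add: UU)
  then show ?thesis using dM by (simp add: M_def)
qed

lemma det_scaled_proj:
  fixes Q :: "real^'n^'n"
  assumes Q: "Q ** Q = Q" and c: "c \<ge> 0"
  shows "\<bar>det (c *\<^sub>R Q + (mat 1 - Q))\<bar> = c ^ dim (rng Q)"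
proof -
  define W where "W = rng Q"
  have sW: "subspace W" unfolding W_def by (simp add: subspace_range_matrix)
  define S :: "'n set" where "S = std_index (dim W)"
  have F: "is_frame S (frame W) W"
    using sW is_frame_frame unfolding S_def by metis
  have UU: "transpose (frame W) ** frame W = mat 1"
    using F by (auto simp: is_frame_def orthogonal_matrix_def)
  have "\<bar>det (c *\<^sub>R Q + (mat 1 - Q))\<bar> = vol (c *\<^sub>R mat 1) W W"
    using vol_eq_abs_det[OF W_def Q, of "c *\<^sub>R mat 1"] by (simp add: matrix_scaleR_mult)
  also have "\<dots> = \<bar>det (c *\<^sub>R coord_proj S + (mat 1 - coord_proj S))\<bar>"
    unfolding vol_def S_def [symmetric] by (simp add: matrix_scaleR_mult UU)
  also have "det (c *\<^sub>R coord_proj S + (mat 1 - coord_proj S)) = (\<Prod>i\<in>UNIV. if i \<in> S then c else 1)"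
    by (subst det_diagonal) (auto simp: coord_proj_def mat_def intro!: prod.cong)
  also have "\<dots> = c ^ dim W"
    by (subst prod.If_cases) (auto simp: S_def card_std_index_dim)
  finally show ?thesis using c by (simp add: W_def)
qed

lemma subspace_orthogonal_part:
  "subspace W \<Longrightarrow> subspace {y \<in> W. \<forall>x\<in>S. orthogonal x y}"
  unfolding subspace_def orthogonal_def by (auto simp: inner_add_right)

text \<open>
  The dimensions force \<open>W\<close>, of dimension \<open>m\<close>, to meet \<open>H m\<close> in a nonzero vector. This vector becomes
  the last element of the basis, and the construction continues in its orthogonal complement.
\<close>

lemma exists_basis_adapted_to_flag:
  fixes T :: "real^'n^'n"
  assumes W: "subspace W" "dim W = m"
    and H: "\<And>i. i \<in> {1..m} \<Longrightarrow> subspace (H i) \<and> CARD('n) + 1 \<le> dim (H i) + i"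
    and a: "\<And>i w. i \<in> {1..m} \<Longrightarrow> w \<in> H i \<Longrightarrow> norm (T *v w) \<le> a i * norm w"
  shows "\<exists>B\<subseteq>W. finite B \<and> pairwise orthogonal B \<and> (\<forall>b\<in>B. norm b = 1) \<and> card B = m \<and>
           (\<Prod>b\<in>B. norm (T *v b)) \<le> (\<Prod>i=1..m. a i)"
  using assms
proof (induction m arbitrary: W)
  case 0
  then show ?case by (intro exI[of _ "{}"]) auto
next
  case (Suc m)
  have "dim {x + y |x y. x \<in> W \<and> y \<in> H (Suc m)} + dim (W \<inter> H (Suc m)) = dim W + dim (H (Suc m))"
    using Suc.prems by (intro dim_sums_Int) auto
  moreover have "dim {x + y |x y. x \<in> W \<and> y \<in> H (Suc m)} \<le> CARD('n)"
    by (rule dim_subset_UNIV_cart)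
  ultimately have "dim (W \<inter> H (Suc m)) > 0" using Suc.prems(2) Suc.prems(3)[of "Suc m"] by auto
  then have "\<not> W \<inter> H (Suc m) \<subseteq> {0}" by (metis dim_eq_0 less_irrefl)
  then obtain x where x: "x \<in> W" "x \<in> H (Suc m)" "x \<noteq> 0" by blast
  define b where "b = x /\<^sub>R norm x"
  have b: "b \<in> W" "b \<in> H (Suc m)" "norm b = 1"
    using x Suc.prems(1) Suc.prems(3)[of "Suc m"] by (auto simp: b_def subspace_scale)
  define W' where "W' = {y \<in> W. \<forall>x\<in>span {b}. orthogonal x y}"
  have sW': "subspace W'"
    unfolding W'_def by (rule subspace_orthogonal_part) (rule Suc.prems(1))
  have "dim W' + dim (span {b}) = dim W"
    unfolding W'_def using Suc.prems(1) b
    by (intro dim_subspace_orthogonal_to_vectors) (simp_all add: span_minimal)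
  moreover have "dim (span {b}) = 1" using b(3) by (auto simp: dim_insert)
  ultimately have dW': "dim W' = m" using Suc.prems(2) by simp
  obtain B where B: "B \<subseteq> W'" "finite B" "pairwise orthogonal B" "\<forall>b\<in>B. norm b = 1" "card B = m"
     "(\<Prod>b\<in>B. norm (T *v b)) \<le> (\<Prod>i=1..m. a i)"
    using Suc.IH[OF sW' dW'] Suc.prems(3,4) by force
  have ob: "orthogonal b y" if "y \<in> B" for y
    using that B(1) by (auto simp: W'_def span_base)
  have nb: "b \<notin> B" using ob b(3) by (metis norm_zero orthogonal_self zero_neq_one)
  have Tb: "norm (T *v b) \<le> a (Suc m)" using Suc.prems(4)[of "Suc m" b] b by auto
  show ?case
  proof (intro exI conjI)
    show "insert b B \<subseteq> W" using b(1) B(1) by (auto simp: W'_def)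
    show "pairwise orthogonal (insert b B)"
      using B(3) ob by (auto simp: pairwise_insert orthogonal_commute)
    show "\<forall>b\<in>insert b B. norm b = 1" "finite (insert b B)" "card (insert b B) = Suc m"
      using B b(3) nb by auto
    have "norm (T *v b) * (\<Prod>b\<in>B. norm (T *v b)) \<le> a (Suc m) * (\<Prod>i=1..m. a i)"
      using Tb B(6) by (intro mult_mono prod_nonneg) (auto intro: order_trans[OF norm_ge_zero])
    then show "(\<Prod>b\<in>insert b B. norm (T *v b)) \<le> (\<Prod>i=1..Suc m. a i)"
      using B(2) nb by (simp add: mult.commute)
  qed
qed

lemma vol_le_flag:
  fixes T :: "real^'n^'n"
  assumes W: "subspace W" "subspace W'" "dim W = m" "dim W' = m"
    and T: "\<And>w. w \<in> W \<Longrightarrow> T *v w \<in> W'"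
    and H: "\<And>i. i \<in> {1..m} \<Longrightarrow> subspace (H i) \<and> CARD('n) + 1 \<le> dim (H i) + i"
    and a: "\<And>i w. i \<in> {1..m} \<Longrightarrow> w \<in> H i \<Longrightarrow> norm (T *v w) \<le> a i * norm w"
  shows "vol T W W' \<le> fact CARD('n) * (\<Prod>i=1..m. a i)"
proof -
  have "\<exists>B\<subseteq>W. finite B \<and> pairwise orthogonal B \<and> (\<forall>b\<in>B. norm b = 1) \<and> card B = m \<and>
           (\<Prod>b\<in>B. norm (T *v b)) \<le> (\<Prod>i=1..m. a i)"
    by (rule exists_basis_adapted_to_flag[OF W(1,3) H a])
  then obtain B where B: "B\<subseteq>W" "pairwise orthogonal B" "\<And>b. b\<in>B \<Longrightarrow> norm b = 1" "card B = m"
           "(\<Prod>b\<in>B. norm (T *v b)) \<le> (\<Prod>i=1..m. a i)"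
    by blast
  have "vol T W W' \<le> fact CARD('n) * (\<Prod>b\<in>B. norm (T *v b))"
    using vol_le_prod_basis[OF W(1,2) _ T B(1-3)] W B(4) by simp
  also have "\<dots> \<le> fact CARD('n) * (\<Prod>i=1..m. a i)" by (rule mult_left_mono[OF B(5)]) simp
  finally show ?thesis .
qed

text \<open>
  The given vector \<open>w\<close> takes the place of the last element of the adapted basis. Read backwards, a
  large volume on \<open>W\<close> prevents every single vector of \<open>W\<close> from being contracted.
\<close>

lemma vol_le_flag_vector:
  fixes T :: "real^'n^'n"
  assumes W: "subspace W" "subspace W'" "dim W = m" "dim W' = m"
    and T: "\<And>w. w \<in> W \<Longrightarrow> T *v w \<in> W'"
    and H: "\<And>i. i \<in> {1..m} \<Longrightarrow> subspace (H i) \<and> CARD('n) + 1 \<le> dim (H i) + i"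
    and a: "\<And>i w. i \<in> {1..m} \<Longrightarrow> w \<in> H i \<Longrightarrow> norm (T *v w) \<le> a i * norm w"
    and w: "w \<in> W"
  shows "vol T W W' * norm w \<le> fact CARD('n) * norm (T *v w) * (\<Prod>i\<in>{1..<m}. a i)"
proof (cases "w = 0")
  case False
  define b where "b = w /\<^sub>R norm w"
  have b: "b \<in> W" "norm b = 1" using w False W(1) by (auto simp: b_def subspace_scale)
  have m: "m > 0" using W(1,3) w False by (metis dim_eq_0 gr0I singletonD subsetD)
  define W1 where "W1 = {y \<in> W. \<forall>x\<in>span {b}. orthogonal x y}"
  have sW1: "subspace W1"
    unfolding W1_def by (rule subspace_orthogonal_part) (rule W(1))
  have "dim W1 + dim (span {b}) = dim W"
    unfolding W1_def using W(1) b
    by (intro dim_subspace_orthogonal_to_vectors) (simp_all add: span_minimal)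
  moreover have "dim (span {b}) = 1" using b(2) by (auto simp: dim_insert)
  ultimately have dW1: "dim W1 = m - 1" using W(3) by simp
  obtain B where B: "B\<subseteq>W1" "finite B" "pairwise orthogonal B" "\<And>b. b\<in>B \<Longrightarrow> norm b = 1" "card B = m - 1"
           "(\<Prod>b\<in>B. norm (T *v b)) \<le> (\<Prod>i=1..m-1. a i)"
    using exists_basis_adapted_to_flag[OF sW1 dW1, of H T a] H a by force
  have ob: "orthogonal b y" if "y \<in> B" for y
    using that B(1) by (auto simp: W1_def span_base)
  have nb: "b \<notin> B" using ob b(2) by (metis norm_zero orthogonal_self zero_neq_one)
  have iv: "{1..m-1} = {1..<m}" using m by auto
  have "vol T W W' \<le> fact CARD('n) * (\<Prod>b\<in>insert b B. norm (T *v b))"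
  proof (rule vol_le_prod_basis[OF W(1,2) _ T])
    show "insert b B \<subseteq> W" using b(1) B(1) by (auto simp: W1_def)
    show "pairwise orthogonal (insert b B)"
      using B(3) ob by (auto simp: pairwise_insert orthogonal_commute)
    show "card (insert b B) = dim W" using B nb W m by simp
  qed (use B b W in auto)
  also have "\<dots> = fact CARD('n) * (norm (T *v b) * (\<Prod>b\<in>B. norm (T *v b)))" using B(2) nb by simp
  also have "\<dots> \<le> fact CARD('n) * (norm (T *v b) * (\<Prod>i\<in>{1..<m}. a i))"
    using B(6) unfolding iv by (intro mult_left_mono) auto
  finally have v: "vol T W W' \<le> fact CARD('n) * (norm (T *v b) * (\<Prod>i\<in>{1..<m}. a i))" .
  have nT: "norm (T *v b) = norm (T *v w) / norm w"
    by (simp add: b_def matrix_vector_mult_scaleR divide_inverse mult.commute)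
  show ?thesis using v False unfolding nT by (simp add: field_simps)
qed simp

section \<open>Expanding matrices\<close>

primrec mat_pow :: "real^'n^'n \<Rightarrow> nat \<Rightarrow> real^'n^'n" where
  "mat_pow S 0 = mat 1"
| "mat_pow S (Suc n) = S ** mat_pow S n"

lemma mat_pow_add: "mat_pow S (a + b) = mat_pow S a ** mat_pow S b"
  by (induction a) (auto simp: matrix_mul_assoc)

lemma mat_pow_commute: "S ** Q = Q ** S \<Longrightarrow> mat_pow S n ** Q = Q ** mat_pow S n"
  by (induction n) (auto, metis matrix_mul_assoc)

lemma power_at_top: "(1::real) < c \<Longrightarrow> filterlim (\<lambda>n. c ^ n) at_top sequentially"
  unfolding filterlim_at_top_gt[where c=0] eventually_sequentially
  by (meson less_imp_le real_arch_pow order_less_le_trans power_increasing)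

lemma norm_mat_pow_le:
  assumes "norm S \<le> L" shows "norm (mat_pow S n *v x) \<le> L ^ n * norm x"
proof (induction n)
  case (Suc n)
  have "norm (mat_pow S (Suc n) *v x) \<le> norm S * norm (mat_pow S n *v x)"
    using norm_matrix_vector_mult_le[of S "mat_pow S n *v x"] by (simp add: matrix_vector_mul_assoc)
  also have "\<dots> \<le> L * (L ^ n * norm x)"
    using Suc assms by (intro mult_mono) (auto intro: order_trans[OF norm_ge_zero])
  finally show ?case by (simp add: mult_ac)
qed simp

text \<open>
  By compactness of the unit sphere every vector returns, within a bounded time, to at least its
  original length. So the powers of \<open>S\<close> shrink no vector by more than a fixed factor, the powers
  of the inverse are bounded, and the powers of the determinant of the inverse are bounded as well.
\<close>

lemma expanding_abs_det_ge_1: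
  fixes S :: "real^'n^'n"
  assumes "\<And>v. v \<noteq> 0 \<Longrightarrow> filterlim (\<lambda>n. norm (mat_pow S n *v v)) at_top sequentially"
  shows "\<bar>det S\<bar> \<ge> 1"
proof -
  define Ob where "Ob n = {v. norm (mat_pow S n *v v) > 1}" for n
  have op: "open (Ob n)" for n
    unfolding Ob_def by (intro open_Collect_less continuous_intros) 
  have "sphere 0 1 \<subseteq> (\<Union>n\<in>{1..}. Ob n)"
  proof
    fix v :: "real^'n" assume "v \<in> sphere 0 1"
    then have "v \<noteq> 0" by auto
    from assms[OF this] have "eventually (\<lambda>n. norm (mat_pow S n *v v) > 1) sequentially"
      by (auto simp: filterlim_at_top_dense)
    then have "eventually (\<lambda>n. norm (mat_pow S n *v v) > 1 \<and> n \<ge> 1) sequentially"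
      using eventually_ge_at_top by (rule eventually_conj)
    then obtain n where "norm (mat_pow S n *v v) > 1 \<and> n \<ge> 1"
      by (auto simp: eventually_sequentially)
    then show "v \<in> (\<Union>n\<in>{1..}. Ob n)" by (auto simp: Ob_def)
  qed
  then obtain F where F: "F \<subseteq> {1..}" "finite F" "sphere (0::real^'n) 1 \<subseteq> (\<Union>n\<in>F. Ob n)"
    using compactE_image[OF compact_sphere, of "{1..}" Ob] op by metis
  define N where "N = Max (insert 1 F)"
  have FN: "n \<le> N" "n \<ge> 1" if "n \<in> F" for n using F that by (auto simp: N_def)
  have N1: "N \<ge> 1" using F by (simp add: N_def)
  have ret: "\<exists>n\<in>{1..N}. norm v \<le> norm (mat_pow S n *v v)" for v :: "real^'n"
  proof (cases "v = 0")
    case True then show ?thesis using N1 by auto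
  next
    case False
    then have "v /\<^sub>R norm v \<in> sphere 0 1" by simp
    then obtain n where n: "n \<in> F" "norm (mat_pow S n *v (v /\<^sub>R norm v)) > 1"
      using F(3) unfolding Ob_def by blast
    then have "norm v < norm (mat_pow S n *v v)"
      using False by (simp add: matrix_vector_mult_scaleR field_simps)
    then show ?thesis using FN n by force
  qed
  have ret2: "\<exists>t. n \<le> t \<and> t \<le> n + N \<and> norm v \<le> norm (mat_pow S t *v v)" for n and v :: "real^'n"
  proof (induction n)
    case 0
    show ?case using ret[of v] by auto
  next
    case (Suc n)
    then obtain t where t: "n \<le> t" "t \<le> n + N" "norm v \<le> norm (mat_pow S t *v v)" by blast
    show ?case
    proof (cases "t = n")
      case False then show ?thesis using t by (intro exI[of _ t]) auto
    next
      case True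
      obtain j where "j \<in> {1..N}" "norm (mat_pow S n *v v) \<le> norm (mat_pow S j *v (mat_pow S n *v v))"
        using ret by blast
      then show ?thesis using t True
        by (intro exI[of _ "j + n"]) (auto simp: mat_pow_add matrix_vector_mul_assoc)
    qed
  qed
  define L where "L = max 1 (norm S)"
  define C where "C = L ^ N"
  have L: "L \<ge> 1" "norm S \<le> L" by (auto simp: L_def)
  \<comment> \<open>between consecutive returns at most \<open>N\<close> factors of norm \<open>L\<close> can enlarge a vector\<close>
  have lower: "norm v \<le> C * norm (mat_pow S n *v v)" for n v
  proof -
    obtain t where t: "n \<le> t" "t \<le> n + N" "norm v \<le> norm (mat_pow S t *v v)" using ret2 by blast
    have "mat_pow S t *v v = mat_pow S (t - n) *v (mat_pow S n *v v)"
      using t(1) mat_pow_add[of S "t - n" n] by (simp add: matrix_vector_mul_assoc)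
    then have "norm v \<le> L ^ (t - n) * norm (mat_pow S n *v v)"
      using t(3) norm_mat_pow_le[OF L(2), of "t - n" "mat_pow S n *v v"] by simp
    also have "\<dots> \<le> C * norm (mat_pow S n *v v)"
      unfolding C_def using L(1) t(2) by (intro mult_right_mono power_increasing) auto
    finally show ?thesis .
  qed
  have "\<forall>x. S *v x = 0 \<longrightarrow> x = 0"
    using lower[where n=1] by (metis mat_pow.simps matrix_mul_rid mult_zero_right norm_le_zero_iff
        norm_zero One_nat_def)
  then have "invertible S"
    by (simp add: invertible_left_inverse matrix_left_invertible_ker)
  then obtain R where R: "S ** R = mat 1" "R ** S = mat 1" by (auto simp: invertible_def)
  have SR: "mat_pow S n ** mat_pow R n = mat 1" for n
  proof (induction n)
    case (Suc n)
    have "mat_pow S (Suc n) ** mat_pow R (Suc n) = mat_pow S (n + 1) ** (R ** mat_pow R n)" by simp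
    also have "\<dots> = mat_pow S n ** (S ** R) ** mat_pow R n"
      by (simp only: mat_pow_add) (simp add: matrix_mul_assoc)
    finally show ?case using R Suc by simp
  qed simp
  have detpow: "det (mat_pow R n) = det R ^ n" for n by (induction n) (auto simp: det_mul)
  have bd: "\<bar>det R\<bar> ^ n \<le> fact CARD('n) * C ^ CARD('n)" for n
  proof -
    have col: "norm (column i (mat_pow R n)) \<le> C" for i
    proof -
      have c: "column i (mat_pow R n) = mat_pow R n *v axis i 1" by (simp add: matrix_vector_mult_basis)
      have "mat_pow S n *v column i (mat_pow R n) = axis i 1"
        unfolding c by (simp only: matrix_vector_mul_assoc SR matrix_vector_mul_lid)
      then show ?thesis using lower[of "column i (mat_pow R n)" n] by (simp add: norm_axis_1)
    qed
    have "\<bar>det R\<bar> ^ n = \<bar>det (mat_pow R n)\<bar>" by (simp add: detpow power_abs)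
    also have "\<dots> \<le> fact CARD('n) * (\<Prod>i\<in>UNIV. norm (column i (mat_pow R n)))"
        by (rule abs_det_le_prod_columns)
    also have "\<dots> \<le> fact CARD('n) * (\<Prod>i\<in>(UNIV::'n set). C)"
      using col by (intro mult_left_mono prod_mono) auto
    finally show ?thesis by simp
  qed
  have "\<bar>det R\<bar> \<le> 1"
  proof (rule ccontr)
    assume "\<not> \<bar>det R\<bar> \<le> 1"
    then obtain n where "fact CARD('n) * C ^ CARD('n) < \<bar>det R\<bar> ^ n"
      using real_arch_pow by (metis not_le)
    then show False using bd[of n] by simp
  qed
  moreover have "\<bar>det S\<bar> * \<bar>det R\<bar> = 1"
    using arg_cong[OF R(1), of det] by (simp add: det_mul abs_mult [symmetric])
  ultimately show ?thesis
    by (metis abs_ge_zero mult_left_mono mult.right_neutral)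
qed

text \<open>
  If every vector of an invariant subspace grows at least with the rate \<open>L\<close>, then the volume of the
  subspace grows at least as prescribed by \<open>L\<close> and its dimension. The powers of the rescaled matrix
  \<open>exp (e - L) T\<close> on the subspace, and \<open>exp e\<close> on the complement, drive every nonzero vector to
  infinity, so that its determinant is at least 1 in absolute value; finally \<open>e\<close> tends to 0.
  This avoids eigenvalues.
\<close>

lemma abs_det_restriction_ge:
  fixes T Q :: "real^'n^'n"
  assumes Q: "Q ** Q = Q" and C: "T ** Q = Q ** T"
    and rate: "\<And>v b. v \<noteq> 0 \<Longrightarrow> Q *v v = v \<Longrightarrow> b < L \<Longrightarrow>
       eventually (\<lambda>n. exp (real n * b) \<le> norm (mat_pow T n *v v)) sequentially"
  shows "exp (L * real (dim (rng Q))) \<le> \<bar>det (T ** Q + (mat 1 - Q))\<bar>"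
proof -
  define m where "m = dim (rng Q)"
  define Q' where "Q' = mat 1 - Q"
  define m' where "m' = dim (rng Q')"
  define D where "D = \<bar>det (T ** Q + (mat 1 - Q))\<bar>"
  have Q': "Q' ** Q' = Q'" by (simp add: Q'_def matrix_ring_simps Q)
  have main: "1 \<le> D * exp (- (L - e) * real m) * exp (e * real m')" if e: "e > 0" for e
  proof -
    define c where "c = exp (- (L - e))"
    define c2 where "c2 = exp e"
    define S where "S = c *\<^sub>R (T ** Q) + c2 *\<^sub>R (mat 1 - Q)"
    have pow: "mat_pow S n *v v = c ^ n *\<^sub>R (mat_pow T n *v (Q *v v)) + c2 ^ n *\<^sub>R (v - Q *v v)" for n v
    proof (induction n)
      case (Suc n)
      have QT: "Q *v (mat_pow T n *v (Q *v v)) = mat_pow T n *v (Q *v v)"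
        using mat_pow_commute[OF C, of n] Q by (metis matrix_vector_mul_assoc)
      have QQ: "Q *v (Q *v v) = Q *v v" by (simp add: matrix_vector_mul_assoc Q)
      have Sv: "S *v x = c *\<^sub>R (T *v (Q *v x)) + c2 *\<^sub>R (x - Q *v x)" for x
        unfolding S_def by (simp add: matrix_vector_mult_add_rdistrib matrix_vector_mult_diff_rdistrib
            scaleR_matrix_vector_assoc [symmetric] matrix_vector_mul_assoc)
      have "mat_pow S (Suc n) *v v = S *v (mat_pow S n *v v)" by (simp add: matrix_vector_mul_assoc)
      also have "Q *v (mat_pow S n *v v) = c ^ n *\<^sub>R (mat_pow T n *v (Q *v v))"
        unfolding Suc by (simp add: matrix_vector_right_distrib matrix_vector_mult_scaleR QT
            matrix_vector_mult_diff_distrib QQ)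
      then have "S *v (mat_pow S n *v v) = c *\<^sub>R (T *v (c ^ n *\<^sub>R (mat_pow T n *v (Q *v v))))
          + c2 *\<^sub>R (c2 ^ n *\<^sub>R (v - Q *v v))"
        unfolding Sv by (simp add: Suc)
      finally show ?case by (simp add: matrix_vector_mult_scaleR matrix_vector_mul_assoc matrix_mul_assoc)
    qed simp
    have "filterlim (\<lambda>n. norm (mat_pow S n *v v)) at_top sequentially" if v: "v \<noteq> 0" for v
    proof (cases "Q *v v = 0")
      case True
      have "norm (mat_pow S n *v v) = norm v * c2 ^ n" for n
        unfolding pow True by (simp add: c2_def)
      moreover have "filterlim (\<lambda>n. norm v * c2 ^ n) at_top sequentially"
        using v e by (intro filterlim_tendsto_pos_mult_at_top[OF tendsto_const] power_at_top)
          (auto simp: c2_def)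
      ultimately show ?thesis by simp
    next
      case False
      define w where "w = Q *v v"
      have w: "w \<noteq> 0" "Q *v w = w" using False by (auto simp: w_def matrix_vector_mul_assoc Q)
      have Qn: "norm Q > 0" using w by auto
      have ev: "eventually (\<lambda>n. exp (real n * (L - e / 2)) \<le> norm (mat_pow T n *v w)) sequentially"
        using rate[OF w, of "L - e/2"] e by simp
      have "filterlim (\<lambda>n. (1 / norm Q) * exp (e / 2) ^ n) at_top sequentially"
        using Qn e by (intro filterlim_tendsto_pos_mult_at_top[OF tendsto_const] power_at_top) auto
      then show ?thesis
      proof (rule filterlim_at_top_mono)
        show "eventually (\<lambda>n. (1 / norm Q) * exp (e / 2) ^ n \<le> norm (mat_pow S n *v v)) sequentially"
          using ev
        proof eventually_elim
          case (elim n)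
          have QT: "Q *v (mat_pow T n *v w) = mat_pow T n *v w"
            using mat_pow_commute[OF C, of n] w(2) by (metis matrix_vector_mul_assoc)
          have "Q *v (mat_pow S n *v v) = c ^ n *\<^sub>R (mat_pow T n *v w)"
            unfolding pow w_def [symmetric] using QT w(2)
            by (simp add: matrix_vector_right_distrib matrix_vector_mult_scaleR
                matrix_vector_mult_diff_distrib) (simp add: w_def)
          then have "c ^ n * norm (mat_pow T n *v w) \<le> norm Q * norm (mat_pow S n *v v)"
            using norm_matrix_vector_mult_le[of Q "mat_pow S n *v v"] by (simp add: c_def)
          moreover have "exp (e / 2) ^ n = c ^ n * exp (real n * (L - e / 2))"
            unfolding c_def by (simp add: exp_of_nat_mult [symmetric] exp_add [symmetric] algebra_simps)
          moreover have "c ^ n * exp (real n * (L - e / 2)) \<le> c ^ n * norm (mat_pow T n *v w)"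
            using elim by (intro mult_left_mono) (auto simp: c_def)
          ultimately show ?case using Qn by (simp add: field_simps)
        qed
      qed
    qed
    then have "1 \<le> \<bar>det S\<bar>" by (rule expanding_abs_det_ge_1)
    also have "S = (T ** Q + (mat 1 - Q)) ** (c *\<^sub>R Q + (mat 1 - Q)) ** (c2 *\<^sub>R Q' + (mat 1 - Q'))"
    proof -
      have TQQ: "T ** Q ** Q = T ** Q" by (metis Q matrix_mul_assoc)
      have "(T ** Q + (mat 1 - Q)) ** (c *\<^sub>R Q + (mat 1 - Q)) = c *\<^sub>R (T ** Q) + (mat 1 - Q)"
        by (simp add: matrix_ring_simps matrix_scaleR_mult TQQ Q)
      moreover have "(c *\<^sub>R (T ** Q) + (mat 1 - Q)) ** (c2 *\<^sub>R Q' + (mat 1 - Q')) = S"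
        unfolding S_def Q'_def by (simp add: matrix_ring_simps matrix_scaleR_mult TQQ Q algebra_simps)
      ultimately show ?thesis by simp
    qed
    also have "\<bar>det ((T ** Q + (mat 1 - Q)) ** (c *\<^sub>R Q + (mat 1 - Q)) ** (c2 *\<^sub>R Q' + (mat 1 - Q')))\<bar>
       = D * c ^ m * c2 ^ m'"
      using det_scaled_proj[OF Q, of c] det_scaled_proj[OF Q', of c2]
      by (simp add: det_mul abs_mult D_def m_def m'_def c_def c2_def)
    finally show ?thesis
      by (simp add: c_def c2_def exp_of_nat_mult [symmetric] mult.commute)
  qed
  have D0: "D > 0"
    using main[of 1] by (metis D_def abs_ge_zero less_eq_real_def mult_zero_left not_one_le_zero
        zero_less_one)
  have "L * real m \<le> ln D + d" if d: "d > 0" for d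
  proof -
    define e where "e = d / (real m + real m' + 1)"
    have e: "e > 0" using d by (simp add: e_def)
    have "0 \<le> ln (D * exp (- (L - e) * real m) * exp (e * real m'))"
      using main[OF e] by simp
    also have "\<dots> = ln D + (- (L - e) * real m + e * real m')" using D0 by (simp add: ln_mult)
    finally have "L * real m \<le> ln D + e * (real m + real m')" by (simp add: algebra_simps)
    also have "e * (real m + real m') \<le> d" using d unfolding e_def by (simp add: field_simps)
    finally show ?thesis by simp
  qed
  then have "L * real m \<le> ln D" by (rule field_le_epsilon)
  then have "exp (L * real m) \<le> D" using D0 by (simp add: ln_ge_iff)
  then show ?thesis by (simp add: D_def m_def)
qed

text \<open>
  The quantitative form of the principle that a matrix which loses no volume on \<open>W\<close> contracts no
  vector of \<open>W\<close>. In particular \<open>T\<close> maps \<open>W\<close> onto \<open>W'\<close>.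
\<close>

lemma large_volume_preimage:
  fixes T :: "real^'n^'n"
  assumes W: "subspace W" "subspace W'" "dim W = m" "dim W' = m"
    and T: "\<And>w. w \<in> W \<Longrightarrow> T *v w \<in> W'"
    and H: "\<And>i. i \<in> {1..m} \<Longrightarrow> subspace (H i) \<and> CARD('n) + 1 \<le> dim (H i) + i"
    and a: "\<And>i w. i \<in> {1..m} \<Longrightarrow> w \<in> H i \<Longrightarrow> norm (T *v w) \<le> a i * norm w"
    and v: "vol T W W' > 0" and w': "w' \<in> W'"
  shows "\<exists>w\<in>W. T *v w = w' \<and> vol T W W' * norm w \<le> fact CARD('n) * (\<Prod>i\<in>{1..<m}. a i) * norm w'"
proof -
  have key: "vol T W W' * norm w \<le> fact CARD('n) * norm (T *v w) * (\<Prod>i\<in>{1..<m}. a i)" if "w \<in> W" for w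
    by (rule vol_le_flag_vector[OF W, where H = H]) (use T H a that in auto)
  have inj: "inj_on ((*v) T) W"
  proof (rule inj_onI)
    fix x y assume xy: "x \<in> W" "y \<in> W" "T *v x = T *v y"
    have "vol T W W' * norm (x - y) \<le> fact CARD('n) * norm (T *v (x - y)) * (\<Prod>i\<in>{1..<m}. a i)"
      by (rule key) (use xy W(1) in \<open>auto simp: subspace_diff\<close>)
    also have "\<dots> = 0" using xy by (simp add: matrix_vector_mult_diff_distrib)
    finally have "norm (x - y) \<le> 0" using v by (simp add: mult_le_0_iff)
    then show "x = y" by simp
  qed
  have "dim ((*v) T ` W) = dim W"
    using inj W(1) by (intro dim_image_eq) (auto simp: span_eq_iff [THEN iffD2])
  then have "(*v) T ` W = W'"
    using W T by (intro subspace_dim_equal) (auto intro: linear_subspace_image)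
  then obtain w where w: "w \<in> W" "T *v w = w'" using w' by auto
  show ?thesis using key[OF w(1)] w by (intro bexI[of _ w]) (auto simp: mult_ac)
qed

section \<open>Families of complementary projections\<close>

lemma matrix_mult_0_left: "0 ** (A :: real^'k^'n) = (0 :: real^'k^'m)"
  by (simp add: matrix_matrix_mult_def vec_eq_iff)

lemma matrix_mult_0_right: "(A :: real^'n^'m) ** 0 = (0 :: real^'k^'m)"
  by (simp add: matrix_matrix_mult_def vec_eq_iff)

lemma matrix_mult_sum_left: "(\<Sum>i\<in>I. q i) ** (A :: real^'k^'n) = (\<Sum>i\<in>I. q i ** A)"
  for q :: "'i \<Rightarrow> real^'n^'m"
  by (induction I rule: infinite_finite_induct) (simp_all add: matrix_mult_0_left matrix_add_rdistrib)

lemma matrix_mult_sum_right: "(A :: real^'n^'m) ** (\<Sum>i\<in>I. q i) = (\<Sum>i\<in>I. A ** q i)"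
  for q :: "'i \<Rightarrow> real^'k^'n"
  by (induction I rule: infinite_finite_induct) (simp_all add: matrix_mult_0_right matrix_add_ldistrib)

lemma matrix_sum_vector: "(\<Sum>i\<in>I. q i) *v v = (\<Sum>i\<in>I. q i *v v)"
  for q :: "'i \<Rightarrow> real^'n^'m"
  by (induction I rule: infinite_finite_induct) (simp_all add: matrix_vector_mult_add_rdistrib)

definition proj_family :: "nat \<Rightarrow> (nat \<Rightarrow> real^'n^'n) \<Rightarrow> bool" where
  "proj_family l q \<longleftrightarrow> (\<Sum>i=1..l. q i) = mat 1 \<and>
     (\<forall>i\<in>{1..l}. \<forall>j\<in>{1..l}. q i ** q j = (if i = j then q i else 0))"

lemma proj_family_sum_mult:
  assumes q: "proj_family l q" and I: "I \<subseteq> {1..l}" and J: "J \<subseteq> {1..l}"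
  shows "sum q I ** sum q J = sum q (I \<inter> J)"
proof -
  have fin: "finite I" "finite J" using I J by (auto intro: finite_subset)
  have qq: "q i ** q j = (if i = j then q i else 0)" if "i \<in> I" "j \<in> J" for i j
    using q I J that unfolding proj_family_def by blast
  have "sum q I ** sum q J = (\<Sum>i\<in>I. \<Sum>j\<in>J. q i ** q j)"
    by (simp only: matrix_mult_sum_left) (simp only: matrix_mult_sum_right)
  also have "\<dots> = (\<Sum>i\<in>I. \<Sum>j\<in>J. if i = j then q i else 0)"
    by (intro sum.cong refl qq)
  also have "\<dots> = (\<Sum>i\<in>I. if i \<in> J then q i else 0)"
    using fin by (simp add: sum.delta)
  also have "\<dots> = sum q (I \<inter> J)" using fin by (simp add: sum.inter_restrict)
  finally show ?thesis .
qed

lemma proj_family_compl: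
  assumes q: "proj_family l q" and I: "I \<subseteq> {1..l}"
  shows "mat 1 - sum q I = sum q ({1..l} - I)"
  using q I by (simp add: sum_diff proj_family_def)

lemma proj_family_idem:
  assumes q: "proj_family l q" and I: "I \<subseteq> {1..l}"
  shows "sum q I ** sum q I = sum q I"
  using proj_family_sum_mult[OF q I I] by simp

lemma mem_range_idem_iff:
  fixes Q :: "real^'n^'n"
  assumes Q: "Q ** Q = Q"
  shows "v \<in> rng Q \<longleftrightarrow> Q *v v = v"
proof
  assume "v \<in> rng Q"
  then obtain x where "v = Q *v x" by blast
  then show "Q *v v = v" using Q by (simp add: matrix_vector_mul_assoc)
qed (metis rangeI)

lemma proj_family_dim:
  assumes q: "proj_family l q" and I: "I \<subseteq> {1..l}"
  shows "dim (rng (sum q I)) = (\<Sum>i\<in>I. dim (rng (q i)))"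
proof -
  have "finite I" using I finite_subset by blast
  then show ?thesis using I
  proof (induction I)
    case empty
    have "rng (0::real^'a^'a) = {0}" by auto
    then show ?case by simp
  next
    case (insert i I)
    define S where "S = sum q I"
    have qi: "q i = sum q {i}" by simp
    have iS: "q i ** S = 0" "S ** q i = 0"
      unfolding S_def qi using insert.prems insert.hyps
      by (subst proj_family_sum_mult[OF q]; auto)+
    have idem: "q i ** q i = q i" "S ** S = S"
      using insert.prems q proj_family_idem[OF q, of I] by (auto simp: S_def proj_family_def)
    have e: "rng (q i + S) = {x + y |x y. x \<in> rng (q i) \<and> y \<in> rng S}" (is "_ = ?R")
    proof
      show "rng (q i + S) \<subseteq> ?R" by (auto simp: matrix_vector_mult_add_rdistrib)
      show "?R \<subseteq> rng (q i + S)"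
      proof
        fix z assume "z \<in> ?R"
        then obtain x y where z: "z = q i *v x + S *v y" by auto
        have "(q i + S) *v z = z"
          unfolding z by (simp add: matrix_vector_mult_add_rdistrib matrix_vector_right_distrib
              matrix_vector_mul_assoc matrix_add_rdistrib iS idem)
        then show "z \<in> rng (q i + S)" by (metis rangeI)
      qed
    qed
    have "rng (q i) \<inter> rng S = {0}"
    proof -
      have "v = 0" if "v \<in> rng (q i)" "v \<in> rng S" for v
        using that iS idem by (metis mem_range_idem_iff matrix_vector_mul_assoc matrix_vector_mult_0)
      moreover have "0 \<in> rng (q i)" "0 \<in> rng S"
        by (auto simp: subspace_0 subspace_range_matrix)
      ultimately show ?thesis by blast
    qed
    then have "dim (rng (q i + S)) = dim (rng (q i)) + dim (rng S)"
      using dim_sums_Int[OF subspace_range_matrix[of "q i"] subspace_range_matrix[of S]] unfolding e by simp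
    then show ?case using insert by (simp add: S_def)
  qed
qed

text \<open>
  Inserting both decompositions of the identity into \<open>A\<close> leaves only the diagonal terms.
\<close>

lemma proj_family_equivariant:
  assumes q: "proj_family l q" "proj_family l q'"
    and A: "\<And>i v. i \<in> {1..l} \<Longrightarrow> v \<in> rng (q i) \<Longrightarrow> A *v v \<in> rng (q' i)"
    and i: "i \<in> {1..l}"
  shows "A ** q i = q' i ** A"
proof -
  have inv: "q' j ** (A ** q j) = A ** q j" if "j \<in> {1..l}" for j
    unfolding matrix_eq
  proof
    fix x
    have "A *v (q j *v x) \<in> rng (q' j)" using A[OF that] by blast
    moreover have "q' j ** q' j = q' j" using q(2) that by (auto simp: proj_family_def)
    ultimately have "q' j *v (A *v (q j *v x)) = A *v (q j *v x)" by (simp add: mem_range_idem_iff)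
    then show "(q' j ** (A ** q j)) *v x = (A ** q j) *v x"
        by (simp add: matrix_vector_mul_assoc matrix_mul_assoc)
  qed
  have "q' i ** A = (\<Sum>j=1..l. q' i ** (A ** q j))"
    using q(1) by (simp add: matrix_mult_sum_right [symmetric] proj_family_def)
  also have "\<dots> = (\<Sum>j=1..l. if j = i then A ** q i else 0)"
  proof (rule sum.cong)
    fix j assume j: "j \<in> {1..l}"
    have "q' i ** (A ** q j) = (q' i ** q' j) ** (A ** q j)"
      using inv[OF j] by (simp add: matrix_mul_assoc [symmetric])
    also have "\<dots> = (if j = i then A ** q i else 0)"
      using q(2) i j inv[OF i] by (auto simp: proj_family_def matrix_mult_0_left)
    finally show "q' i ** (A ** q j) = (if j = i then A ** q i else 0)" .
  qed simp
  also have "\<dots> = A ** q i" using i by (simp add: sum.delta)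
  finally show ?thesis by simp
qed

text \<open>
  The completed restriction of \<open>T\<close> to a sum of invariant subspaces is the product of the commuting
  completed restrictions to the summands, so that no determinant of a block matrix is needed.
\<close>

lemma proj_family_det_prod:
  assumes q: "proj_family l q" and I: "I \<subseteq> {1..l}"
    and C: "\<And>i. i \<in> I \<Longrightarrow> T ** q i = q i ** T"
  shows "det (T ** sum q I + (mat 1 - sum q I)) = (\<Prod>i\<in>I. det (T ** q i + (mat 1 - q i)))"
proof -
  have "finite I" using I finite_subset by blast
  then show ?thesis using I C
  proof (induction I)
    case empty
    then show ?case by (simp add: matrix_mult_0_right)
  next
    case (insert i I)
    define S where "S = sum q I"
    have qi: "q i = sum q {i}" by simp
    have iS: "q i ** S = 0"
      unfolding S_def qi using insert.prems insert.hyps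
      by (subst proj_family_sum_mult[OF q]; auto)
    have CS: "T ** S = S ** T"
      unfolding S_def using insert.prems by (simp add: matrix_mult_sum_left matrix_mult_sum_right)
    have 1: "q i ** (T ** S) = 0" unfolding CS by (simp add: matrix_mul_assoc iS matrix_mult_0_left)
    have "(T ** q i + (mat 1 - q i)) ** (T ** S + (mat 1 - S))
       = T ** (q i ** (T ** S)) + T ** q i - T ** (q i ** S) + T ** S + mat 1 - S - q i ** (T ** S) - q
           i + q i ** S"
      by (simp add: matrix_ring_simps)
    also have "\<dots> = T ** (q i + S) + (mat 1 - (q i + S))"
      unfolding 1 iS by (simp add: matrix_mult_0_right matrix_add_ldistrib)
    finally have "det (T ** (q i + S) + (mat 1 - (q i + S))) = det (T ** q i + (mat 1 - q i)) * det (T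
        ** S + (mat 1 - S))"
      by (metis det_mul)
    then show ?case using insert by (simp add: S_def)
  qed
qed

lemma proj_family_abs_det_ge:
  assumes q: "proj_family l q" and I: "I \<subseteq> {1..l}"
    and C: "\<And>i. i \<in> I \<Longrightarrow> T ** q i = q i ** T"
    and rate: "\<And>i v b. i \<in> I \<Longrightarrow> v \<noteq> 0 \<Longrightarrow> q i *v v = v \<Longrightarrow> b < L i \<Longrightarrow>
       eventually (\<lambda>n. exp (real n * b) \<le> norm (mat_pow T n *v v)) sequentially"
  shows "exp (\<Sum>i\<in>I. L i * real (dim (rng (q i)))) \<le> \<bar>det (T ** sum q I + (mat 1 - sum q I))\<bar>"
proof -
  have fin: "finite I" using I finite_subset by blast
  have "exp (\<Sum>i\<in>I. L i * real (dim (rng (q i)))) = (\<Prod>i\<in>I. exp (L i * real (dim (rng (q i)))))"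
    using fin by (simp add: exp_sum)
  also have "\<dots> \<le> (\<Prod>i\<in>I. \<bar>det (T ** q i + (mat 1 - q i))\<bar>)"
  proof (rule prod_mono, intro conjI)
    fix i assume i: "i \<in> I"
    show "exp (L i * real (dim (rng (q i)))) \<le> \<bar>det (T ** q i + (mat 1 - q i))\<bar>"
      by (rule abs_det_restriction_ge) (use q I i C rate in \<open>auto simp: proj_family_def\<close>)
  qed simp
  also have "\<dots> = \<bar>det (T ** sum q I + (mat 1 - sum q I))\<bar>"
    by (simp add: proj_family_det_prod[OF q I C] abs_prod)
  finally show ?thesis .
qed

section \<open>The projections of a direct sum\<close>

definition split_proj :: "nat \<Rightarrow> (nat \<Rightarrow> (real^'n) set) \<Rightarrow> nat \<Rightarrow> real^'n^'n" where
  "split_proj l E i = matrix (\<lambda>v. (THE w. w \<in> (\<Pi>\<^sub>E i\<in>{1..l}. E i) \<and> (\<Sum>i=1..l. w i) = v) i)"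

lemma split_proj_sum:
  assumes D: "direct_sum_decomposition l E" and w: "\<And>j. j \<in> {1..l} \<Longrightarrow> w j \<in> E j" and i: "i \<in> {1..l}"
  shows "split_proj l E i *v (\<Sum>j=1..l. w j) = w i"
proof -
  define dec where "dec v = (THE w. w \<in> (\<Pi>\<^sub>E i\<in>{1..l}. E i) \<and> (\<Sum>i=1..l. w i) = v)" for v
  have sub: "subspace (E j)" if "j \<in> {1..l}" for j using D that by (auto simp: direct_sum_decomposition_def)
  have ex: "\<exists>!w. w \<in> (\<Pi>\<^sub>E i\<in>{1..l}. E i) \<and> (\<Sum>i=1..l. w i) = v" for v
    using D by (auto simp: direct_sum_decomposition_def)
  have dec: "dec v \<in> (\<Pi>\<^sub>E i\<in>{1..l}. E i)" "(\<Sum>i=1..l. dec v i) = v" for v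
    using theI'[OF ex[of v]] by (auto simp: dec_def)
  have uniq: "dec (\<Sum>j=1..l. u j) i = u i" if u: "\<And>j. j \<in> {1..l} \<Longrightarrow> u j \<in> E j" and i: "i \<in> {1..l}" for u i
  proof -
    have "restrict u {1..l} \<in> (\<Pi>\<^sub>E i\<in>{1..l}. E i) \<and> (\<Sum>i=1..l. restrict u {1..l} i) = (\<Sum>j=1..l. u j)"
      using u by auto
    then have "dec (\<Sum>j=1..l. u j) = restrict u {1..l}"
      unfolding dec_def using ex by (intro the1_equality) auto
    then show ?thesis using i by simp
  qed
  have decE: "dec v j \<in> E j" if "j \<in> {1..l}" for v j using dec(1)[of v] that by auto
  have "linear (\<lambda>v. dec v i)"
  proof (rule linearI)
    fix u v
    have "dec (\<Sum>j=1..l. dec u j + dec v j) i = dec u i + dec v i"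
      using decE sub by (intro uniq[OF _ i]) (auto intro: subspace_add)
    then show "dec (u + v) i = dec u i + dec v i" by (simp only: sum.distrib dec(2))
  next
    fix c u
    have "dec (\<Sum>j=1..l. c *\<^sub>R dec u j) i = c *\<^sub>R dec u i"
      using decE sub by (intro uniq[OF _ i]) (auto intro: subspace_scale)
    then show "dec (c *\<^sub>R u) i = c *\<^sub>R dec u i" by (simp only: scaleR_right.sum [symmetric] dec(2))
  qed
  then have "split_proj l E i *v v = dec v i" for v
    unfolding split_proj_def dec_def [symmetric] by (simp add: matrix_works)
  then show ?thesis using uniq[OF w i] by simp
qed

lemma direct_sum_decompose:
  assumes D: "direct_sum_decomposition l E"
  shows "\<exists>w. (\<forall>j\<in>{1..l}. w j \<in> E j) \<and> v = (\<Sum>j=1..l. w j)"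
proof -
  obtain w where "w \<in> (\<Pi>\<^sub>E i\<in>{1..l}. E i) \<and> (\<Sum>i=1..l. w i) = v"
    using D unfolding direct_sum_decomposition_def by blast
  then show ?thesis by (intro exI[of _ w]) auto
qed

lemma split_proj_eq:
  assumes D: "direct_sum_decomposition l E" and v: "v \<in> E j" and j: "j \<in> {1..l}" and i: "i \<in> {1..l}"
  shows "split_proj l E i *v v = (if i = j then v else 0)"
proof -
  have sub: "subspace (E j)" if "j \<in> {1..l}" for j using D that by (auto simp: direct_sum_decomposition_def)
  have "split_proj l E i *v (\<Sum>k=1..l. if k = j then v else 0) = (if i = j then v else 0)"
    using v sub i by (intro split_proj_sum[OF D]) (auto simp: subspace_0)
  then show ?thesis using j by (simp add: sum.delta)
qed

lemma range_split_proj: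
  assumes D: "direct_sum_decomposition l E" and i: "i \<in> {1..l}"
  shows "rng (split_proj l E i) = E i"
proof
  show "rng (split_proj l E i) \<subseteq> E i"
  proof safe
    fix v
    obtain w where w: "\<forall>j\<in>{1..l}. w j \<in> E j" "v = (\<Sum>j=1..l. w j)" using direct_sum_decompose[OF D] by blast
    then show "split_proj l E i *v v \<in> E i" using split_proj_sum[OF D _ i, of w] i by auto
  qed
  show "E i \<subseteq> rng (split_proj l E i)"
    using split_proj_eq[OF D _ i i] by (metis rangeI subsetI)
qed

lemma proj_family_split_proj:
  assumes D: "direct_sum_decomposition l E"
  shows "proj_family l (split_proj l E)"
  unfolding proj_family_def
proof (intro conjI ballI)
  show "(\<Sum>i=1..l. split_proj l E i) = mat 1"
    unfolding matrix_eq
  proof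
    fix v
    obtain w where w: "\<forall>j\<in>{1..l}. w j \<in> E j" "v = (\<Sum>j=1..l. w j)" using direct_sum_decompose[OF D] by blast
    then have "(\<Sum>i=1..l. split_proj l E i *v v) = v" using split_proj_sum[OF D, of w] by simp
    then show "(\<Sum>i=1..l. split_proj l E i) *v v = mat 1 *v v" by (simp add: matrix_sum_vector)
  qed
  fix i j assume ij: "i \<in> {1..l}" "j \<in> {1..l}"
  show "split_proj l E i ** split_proj l E j = (if i = j then split_proj l E i else 0)"
    unfolding matrix_eq
  proof
    fix v
    have "split_proj l E j *v v \<in> E j" using range_split_proj[OF D ij(2)] by blast
    then show "(split_proj l E i ** split_proj l E j) *v v = (if i = j then split_proj l E i else 0) *v v"
      using split_proj_eq[OF D _ ij(2,1)] by (auto simp: matrix_vector_mul_assoc [symmetric])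
  qed
qed

section \<open>Close subspaces\<close>

text \<open>
  Closeness of \<open>W\<close> to \<open>E\<close> is one-sided: it says that every vector of \<open>W\<close> is almost in \<open>E\<close>. If the
  dimensions agree, the almost identical map from \<open>W\<close> to \<open>E\<close> is injective, hence onto, and the
  relation becomes symmetric.
\<close>

lemma nearby_subspace_onto:
  fixes P :: "real^'n^'n"
  assumes W: "subspace W" "subspace E" "dim W = dim E"
    and P: "\<And>w. w \<in> W \<Longrightarrow> P *v w \<in> E" "\<And>w. w \<in> W \<Longrightarrow> norm (P *v w - w) \<le> \<eta> * norm w"
    and \<eta>: "0 \<le> \<eta>" "\<eta> < 1" and e: "e \<in> E"
  shows "\<exists>w\<in>W. P *v w = e \<and> norm (e - w) \<le> \<eta> / (1 - \<eta>) * norm e"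
proof -
  have lower: "(1 - \<eta>) * norm w \<le> norm (P *v w)" if "w \<in> W" for w
    using P(2)[OF that] norm_triangle_ineq2[of w "P *v w"]
    by (simp add: norm_minus_commute algebra_simps)
  have inj: "inj_on ((*v) P) W"
  proof (rule inj_onI)
    fix x y assume xy: "x \<in> W" "y \<in> W" "P *v x = P *v y"
    then have "(1 - \<eta>) * norm (x - y) \<le> norm (P *v (x - y))"
      using W by (intro lower) (auto simp: subspace_diff)
    then have "(1 - \<eta>) * norm (x - y) \<le> 0" using xy by (simp add: matrix_vector_mult_diff_distrib)
    then show "x = y" using \<eta> by (simp add: mult_le_0_iff)
  qed
  have "dim ((*v) P ` W) = dim W"
    using inj W(1) by (intro dim_image_eq) (auto simp: span_eq_iff [THEN iffD2])
  then have "(*v) P ` W = E"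
    using W P by (intro subspace_dim_equal) (auto intro: linear_subspace_image)
  then obtain w where w: "w \<in> W" "P *v w = e" using e by auto
  have "norm (e - w) \<le> \<eta> * norm w" using P(2)[OF w(1)] w by simp
  also have "\<dots> \<le> \<eta> / (1 - \<eta>) * norm e"
  proof -
    have "norm w \<le> norm e / (1 - \<eta>)" using lower[OF w(1)] w \<eta> by (simp add: field_simps)
    then have "\<eta> * norm w \<le> \<eta> * (norm e / (1 - \<eta>))" using \<eta> by (rule_tac mult_left_mono)
    then show ?thesis by simp
  qed
  finally show ?thesis using w by blast
qed

lemma subspace_dist_le_of_nearby:
  fixes P :: "real^'n^'n"
  assumes W: "subspace W" "subspace E" "dim W = dim E" "dim E > 0"
    and P: "\<And>w. w \<in> W \<Longrightarrow> P *v w \<in> E" "\<And>w. w \<in> W \<Longrightarrow> norm (P *v w - w) \<le> \<eta> * norm w"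
    and \<eta>: "0 \<le> \<eta>" "\<eta> < 1"
  shows "0 \<le> subspace_dist E W \<and> subspace_dist E W \<le> \<eta> / (1 - \<eta>)"
proof -
  define X where "X = {infdist (v /\<^sub>R norm v) W | v. v \<in> E \<and> v \<noteq> 0} \<union>
          {infdist (w /\<^sub>R norm w) E | w. w \<in> W \<and> w \<noteq> 0}"
  have "\<not> E \<subseteq> {0}" using W(4) by (metis dim_eq_0 less_irrefl)
  then obtain e where e: "e \<in> E" "e \<noteq> 0" by blast
  then have ne: "X \<noteq> {}" by (auto simp: X_def)
  have pos: "x \<ge> 0" if "x \<in> X" for x using that by (auto simp: X_def infdist_nonneg)
  have le: "x \<le> \<eta> / (1 - \<eta>)" if x: "x \<in> X" for x
  proof -
    consider v where "x = infdist (v /\<^sub>R norm v) W" "v \<in> E" "v \<noteq> 0"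
      | w where "x = infdist (w /\<^sub>R norm w) E" "w \<in> W" "w \<noteq> 0"
      using x by (auto simp: X_def)
    then show ?thesis
    proof cases
      case 1
      have "v /\<^sub>R norm v \<in> E" using 1 W(2) by (simp add: subspace_scale)
      from nearby_subspace_onto[OF W(1-3) P \<eta> this] obtain w where
        w: "w \<in> W" "norm (v /\<^sub>R norm v - w) \<le> \<eta> / (1 - \<eta>) * norm (v /\<^sub>R norm v)" by blast
      have "x \<le> dist (v /\<^sub>R norm v) w" using w 1 by (auto intro: infdist_le)
      also have "\<dots> \<le> \<eta> / (1 - \<eta>)" using w(2) 1 by (simp add: dist_norm)
      finally show ?thesis .
    next
      case 2
      define u where "u = w /\<^sub>R norm w"
      have u: "u \<in> W" "norm u = 1" using 2 W(1) by (auto simp: u_def subspace_scale)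
      have "x \<le> dist u (P *v u)" using P(1)[OF u(1)] 2 by (auto intro: infdist_le simp: u_def)
      also have "\<dots> \<le> \<eta>" using P(2)[OF u(1)] u(2) by (simp add: dist_norm norm_minus_commute)
      also have "\<eta> \<le> \<eta> / (1 - \<eta>)" using \<eta> by (simp add: field_simps mult_left_le)
      finally show ?thesis .
    qed
  qed
  obtain x where x: "x \<in> X" using ne by blast
  have "bdd_above X" using le by (auto simp: bdd_above_def)
  then have "0 \<le> Sup X" using x pos by (meson cSup_upper order_trans)
  moreover have "Sup X \<le> \<eta> / (1 - \<eta>)" using ne le by (intro cSup_least)
  ultimately show ?thesis by (simp add: subspace_dist_def X_def)
qed

lemma dim_range_transpose: "dim (rng (transpose Q)) = dim (rng (Q :: real^'n^'n))"
  by (metis rank_dim_range rank_transpose)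

text \<open>
  The range of \<open>transpose Q\<close> is the annihilator of the kernel of \<open>Q\<close>. If the annihilator of the
  kernel of \<open>Q'\<close> is close to it, then the kernel of \<open>Q'\<close> is close to the kernel of \<open>Q\<close>: the vector
  \<open>transpose Q *v (Q *v v)\<close> is almost in the annihilator of the kernel of \<open>Q'\<close>, which contains \<open>v\<close>.
\<close>

lemma slow_space_near_of_dual:
  fixes Q Q' :: "real^'n^'n"
  assumes Q: "Q ** Q = Q" and d: "dim (rng Q') = dim (rng Q)"
    and near: "\<And>u. u \<in> rng (transpose Q') \<Longrightarrow> norm (transpose (mat 1 - Q) *v u) \<le> \<eta> * norm u"
    and \<eta>: "0 \<le> \<eta>" "\<eta> < 1" and v: "Q' *v v = 0"
  shows "norm (Q *v v) \<le> \<eta> / (1 - \<eta>) * norm Q * norm v"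
proof (cases "Q *v v = 0")
  case False
  define e where "e = transpose Q *v (Q *v v)"
  have "\<exists>w\<in>rng (transpose Q'). transpose Q *v w = e \<and> norm (e - w) \<le> \<eta> / (1 - \<eta>) * norm e"
  proof (rule nearby_subspace_onto)
    show "dim (rng (transpose Q')) = dim (rng (transpose Q))"
      using d by (simp add: dim_range_transpose)
    show "norm (transpose Q *v w - w) \<le> \<eta> * norm w" if "w \<in> rng (transpose Q')" for w
      using near[OF that] by (simp add: transpose_diff matrix_vector_mult_diff_rdistrib norm_minus_commute)
  qed (use \<eta> in \<open>auto simp: subspace_range_matrix e_def\<close>)
  then obtain s where s: "norm (e - transpose Q' *v s) \<le> \<eta> / (1 - \<eta>) * norm e" by auto
  have "norm (Q *v v) * norm (Q *v v) = e \<bullet> v"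
    unfolding e_def inner_transpose by (simp add: dot_square_norm power2_eq_square)
  also have "\<dots> = (e - transpose Q' *v s) \<bullet> v"
    by (simp add: inner_diff_left inner_transpose v)
  also have "\<dots> \<le> norm (e - transpose Q' *v s) * norm v" by (rule norm_cauchy_schwarz)
  also have "\<dots> \<le> (\<eta> / (1 - \<eta>) * norm e) * norm v" using s by (intro mult_right_mono) auto
  also have "\<dots> \<le> (\<eta> / (1 - \<eta>) * (norm Q * norm (Q *v v))) * norm v"
    using norm_matrix_vector_mult_le[of "transpose Q" "Q *v v"] \<eta>
    by (intro mult_right_mono mult_left_mono) (auto simp: e_def norm_transpose_matrix)
  finally have "norm (Q *v v) * norm (Q *v v) \<le> (\<eta> / (1 - \<eta>) * norm Q * norm v) * norm (Q *v v)"
    by (simp add: mult_ac)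
  then show ?thesis by (rule mult_right_le_imp_le) (use False in simp)
qed (use \<eta> in auto)

section \<open>Volume growth along a periodic sequence of matrices\<close>

primrec seqprod :: "(nat \<Rightarrow> real^'n^'n) \<Rightarrow> nat \<Rightarrow> nat \<Rightarrow> real^'n^'n" where
  "seqprod a i 0 = mat 1"
| "seqprod a i (Suc n) = a (i + n) ** seqprod a i n"

lemma cocycle_eq_seqprod: "cocycle f A n ((f ^^ i) p) = seqprod (\<lambda>i. A ((f ^^ i) p)) i n"
proof (induction n)
  case (Suc n)
  have "(f ^^ n) ((f ^^ i) p) = (f ^^ (i + n)) p" by (metis add.commute comp_apply funpow_add)
  then show ?case using Suc by simp
qed simp

lemma seqprod_equivariant:
  assumes "\<And>i. a i ** Q i = Q (Suc i) ** a i"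
  shows "seqprod a i n ** Q i = Q (i + n) ** seqprod a i n"
proof (induction n)
  case (Suc n)
  have "seqprod a i (Suc n) ** Q i = a (i + n) ** (Q (i + n) ** seqprod a i n)"
    using Suc by (simp add: matrix_mul_assoc [symmetric])
  also have "\<dots> = Q (i + Suc n) ** seqprod a i (Suc n)"
    using assms[of "i + n"] by (simp add: matrix_mul_assoc)
  finally show ?case .
qed simp

lemma norm_seqprod_le:
  fixes a :: "nat \<Rightarrow> real^'n^'n"
  assumes "\<And>i. norm (a i) \<le> M"
  shows "norm (seqprod a i n *v v) \<le> M ^ n * norm v"
proof (induction n)
  case (Suc n)
  have "norm (seqprod a i (Suc n) *v v) \<le> norm (a (i + n)) * norm (seqprod a i n *v v)"
    using norm_matrix_vector_mult_le[of "a (i+n)" "seqprod a i n *v v"]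
        by (simp add: matrix_vector_mul_assoc)
  also have "\<dots> \<le> M * (M ^ n * norm v)"
    using Suc assms[of "i + n"] by (intro mult_mono) (auto intro: order_trans[OF norm_ge_zero])
  finally show ?case by (simp add: mult_ac)
qed simp

lemma equivariant_maps_range:
  fixes T :: "real^'n^'n"
  assumes "T ** Q = Q' ** T" "w \<in> rng Q" shows "T *v w \<in> rng Q'"
proof -
  obtain x where "w = Q *v x" using assms(2) by blast
  then have "T *v w = Q' *v (T *v x)" using assms(1) by (simp add: matrix_vector_mul_assoc)
  then show ?thesis by blast
qed

lemma vol_id: "Q ** Q = Q \<Longrightarrow> vol (mat 1) (rng Q) (rng (Q :: real^'n^'n)) = 1"
  by (subst vol_eq_abs_det[where Q=Q]) auto

lemma vol_seqprod:
  fixes a :: "nat \<Rightarrow> real^'n^'n"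
  assumes Q: "\<And>i. Q i ** Q i = Q i" and d: "\<And>i. dim (rng (Q i)) = m"
    and eq: "\<And>i. a i ** Q i = Q (Suc i) ** a i"
  shows "vol (seqprod a i n) (rng (Q i)) (rng (Q (i + n))) =
    (\<Prod>t<n. vol (a (i + t)) (rng (Q (i + t))) (rng (Q (Suc (i + t)))))"
proof (induction n)
  case 0 then show ?case by (simp add: vol_id Q)
next
  case (Suc n)
  have "vol (a (i + n) ** seqprod a i n) (rng (Q i)) (rng (Q (Suc (i + n)))) =
      vol (a (i + n)) (rng (Q (i + n))) (rng (Q (Suc (i + n)))) *
      vol (seqprod a i n) (rng (Q i)) (rng (Q (i + n)))"
    by (rule vol_mult) (auto simp: subspace_range_matrix d
        intro: equivariant_maps_range[OF seqprod_equivariant[of a Q, OF eq]])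
  then show ?case using Suc by (simp add: mult.commute)
qed

text \<open>
  The transposed matrices act on the annihilators of the kernels of the projections, in the reverse
  direction.
\<close>

lemma vol_seqprod_transpose:
  fixes a :: "nat \<Rightarrow> real^'n^'n"
  assumes Q: "\<And>i. Q i ** Q i = Q i" and d: "\<And>i. dim (rng (Q i)) = m"
    and eq: "\<And>i. a i ** Q i = Q (Suc i) ** a i"
  shows "vol (transpose (seqprod a i n)) (rng (transpose (Q (i + n)))) (rng (transpose (Q i))) =
    (\<Prod>t<n. vol (transpose (a (i + t))) (rng (transpose (Q (Suc (i + t))))) (rng (transpose (Q (i + t)))))"
proof (induction n)
  case 0
  have "transpose (Q i) ** transpose (Q i) = transpose (Q i)" by (metis Q matrix_transpose_mul)
  then show ?case by (simp add: vol_id)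
next
  case (Suc n)
  have eqt: "transpose (a j) ** transpose (Q (Suc j)) = transpose (Q j) ** transpose (a j)" for j
    using eq[of j] by (metis matrix_transpose_mul)
  have "vol (transpose (seqprod a i n) ** transpose (a (i + n))) (rng (transpose (Q (Suc (i
      + n))))) (rng (transpose (Q i))) =
      vol (transpose (seqprod a i n)) (rng (transpose (Q (i + n)))) (rng (transpose (Q i))) *
      vol (transpose (a (i + n))) (rng (transpose (Q (Suc (i + n))))) (rng (transpose (Q (i + n))))"
    by (rule vol_mult) (auto simp: subspace_range_matrix d dim_range_transpose
        intro: equivariant_maps_range[OF eqt])
  then show ?case using Suc by (simp add: matrix_transpose_mul mult.commute)
qed

lemma log_volumes:
  fixes v :: "nat \<Rightarrow> real"
  assumes P: "P > 0" and per: "\<And>i. v (i + P) = v i" and nn: "\<And>i. v i \<ge> 0"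
    and s: "exp (real P * s) \<le> (\<Prod>t<P. v t)"
  shows "(\<forall>i. v i > 0) \<and> real P * s \<le> (\<Sum>t<P. ln (v t)) \<and>
    (\<forall>i n. (\<Prod>t<n. v (i + t)) = exp (\<Sum>t<n. ln (v (i + t))))"
proof -
  have "(\<Prod>t<P. v t) > 0" using s by (meson exp_gt_zero less_le_trans)
  then have ne: "v i \<noteq> 0" if "i < P" for i using that
      by (metis finite_lessThan lessThan_iff less_irrefl prod_zero_iff)
  have vmod: "v i = v (i mod P)" for i
  proof -
    have "v (j + k * P) = v j" for j k
    proof (induction k)
      case (Suc k)
      then show ?case using per[of "j + k * P"] by (simp add: add_ac)
    qed simp
    then show ?thesis by (metis mod_mult_div_eq mult.commute)
  qed
  have pos: "v i > 0" for i
    using ne[of "i mod P"] nn[of i] P vmod[of i] by (metis less_le mod_less_divisor)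
  have e: "(\<Prod>t<n. v (i + t)) = exp (\<Sum>t<n. ln (v (i + t)))" for i n
    by (simp add: exp_sum pos)
  have "exp (real P * s) \<le> exp (\<Sum>t<P. ln (v t))" using s e[of 0 P] by simp
  then show ?thesis using pos e by simp
qed

text \<open>
  The volume growth over the whole period is a determinant, and so it is the same for the product and
  for its transpose. This gives the dual estimate for the annihilators at no cost.
\<close>

lemma periodic_volume_growth:
  fixes a :: "nat \<Rightarrow> real^'n^'n"
  assumes P: "P > 0" and per: "\<And>i. a (i + P) = a i" "\<And>i. Q (i + P) = Q i"
    and Q: "\<And>i. Q i ** Q i = Q i" and d: "\<And>i. dim (rng (Q i)) = m"
    and eq: "\<And>i. a i ** Q i = Q (Suc i) ** a i"
    and s: "exp (real P * s) \<le> \<bar>det (seqprod a 0 P ** Q 0 + (mat 1 - Q 0))\<bar>"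
  shows "\<exists>h. (\<forall>i. h (i + P) = h i) \<and> real P * s \<le> (\<Sum>i<P. h i) \<and>
      (\<forall>i n. vol (seqprod a i n) (rng (Q i)) (rng (Q (i + n))) = exp (\<Sum>t<n. h (i + t)))"
    and "\<exists>h. (\<forall>i. h (i + P) = h i) \<and> real P * s \<le> (\<Sum>i<P. h i) \<and>
      (\<forall>i n. vol (transpose (seqprod a i n)) (rng (transpose (Q (i + n)))) (rng (transpose (Q i)))
          = exp (\<Sum>t<n. h (i + t)))"
proof -
  have QP: "Q P = Q 0" using per(2)[of 0] by simp
  have per1: "Q (Suc (i + P)) = Q (Suc i)" for i using per(2)[of "Suc i"] by simp
  have com: "seqprod a 0 P ** Q 0 = Q 0 ** seqprod a 0 P"
    using seqprod_equivariant[of a Q 0 P, OF eq] QP by simp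
  define v where "v i = vol (a i) (rng (Q i)) (rng (Q (Suc i)))" for i
  have 1: "(\<Prod>t<P. v t) = \<bar>det (seqprod a 0 P ** Q 0 + (mat 1 - Q 0))\<bar>"
    using vol_seqprod[where a=a and Q=Q, OF Q d eq, of 0 P] vol_eq_abs_det[OF refl Q com] QP
        by (simp add: v_def)
  have "(\<forall>i. v i > 0) \<and> real P * s \<le> (\<Sum>t<P. ln (v t)) \<and>
    (\<forall>i n. (\<Prod>t<n. v (i + t)) = exp (\<Sum>t<n. ln (v (i + t))))"
    by (rule log_volumes[OF P]) (use s 1 in \<open>auto simp: v_def per per1 vol_nonneg\<close>)
  moreover have "ln (v (i + P)) = ln (v i)" for i by (simp add: v_def per per1)
  ultimately show "\<exists>h. (\<forall>i. h (i + P) = h i) \<and> real P * s \<le> (\<Sum>i<P. h i) \<and>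
      (\<forall>i n. vol (seqprod a i n) (rng (Q i)) (rng (Q (i + n))) = exp (\<Sum>t<n. h (i + t)))"
    using vol_seqprod[where a=a and Q=Q, OF Q d eq] by (intro exI[of _ "\<lambda>i. ln (v i)"]) (simp add: v_def)
  define u where "u i = vol (transpose (a i)) (rng (transpose (Q (Suc i)))) (rng (transpose (Q i)))" for i
  have Qt: "transpose (Q 0) ** transpose (Q 0) = transpose (Q 0)" by (metis Q matrix_transpose_mul)
  have comt: "transpose (seqprod a 0 P) ** transpose (Q 0) = transpose (Q 0) ** transpose (seqprod a 0 P)"
    by (metis com matrix_transpose_mul)
  have "transpose (seqprod a 0 P ** Q 0 + (mat 1 - Q 0)) = transpose (seqprod a 0 P) ** transpose (Q 0)
      + (mat 1 - transpose (Q 0))"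
    unfolding com by (simp add: transpose_add transpose_diff matrix_transpose_mul)
  then have "det (transpose (seqprod a 0 P) ** transpose (Q 0) + (mat 1 - transpose (Q 0)))
      = det (seqprod a 0 P ** Q 0 + (mat 1 - Q 0))"
    by (metis det_transpose)
  then have 2: "(\<Prod>t<P. u t) = \<bar>det (seqprod a 0 P ** Q 0 + (mat 1 - Q 0))\<bar>"
    using vol_seqprod_transpose[where a=a and Q=Q, OF Q d eq, of 0 P] vol_eq_abs_det[OF refl Qt comt] QP
        by (simp add: u_def)
  have "(\<forall>i. u i > 0) \<and> real P * s \<le> (\<Sum>t<P. ln (u t)) \<and>
    (\<forall>i n. (\<Prod>t<n. u (i + t)) = exp (\<Sum>t<n. ln (u (i + t))))"
    by (rule log_volumes[OF P]) (use s 2 in \<open>auto simp: u_def per per1 vol_nonneg\<close>)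
  moreover have "ln (u (i + P)) = ln (u i)" for i by (simp add: u_def per per1)
  ultimately show "\<exists>h. (\<forall>i. h (i + P) = h i) \<and> real P * s \<le> (\<Sum>i<P. h i) \<and>
      (\<forall>i n. vol (transpose (seqprod a i n)) (rng (transpose (Q (i + n)))) (rng (transpose (Q i)))
          = exp (\<Sum>t<n. h (i + t)))"
    using vol_seqprod_transpose[where a=a and Q=Q, OF Q d eq]
        by (intro exI[of _ "\<lambda>i. ln (u i)"]) (simp add: u_def)
qed

lemma periodic_sum_shift:
  fixes h :: "nat \<Rightarrow> real"
  assumes "\<And>i. h (i + P) = h i"
  shows "(\<Sum>i<P. h (i + t)) = (\<Sum>i<P. h i)"
proof (induction t)
  case (Suc t)
  have "(\<Sum>i<Suc P. h (i + t)) = h t + (\<Sum>i<P. h (Suc i + t))"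
    by (subst sum.lessThan_Suc_shift) simp
  moreover have "(\<Sum>i<Suc P. h (i + t)) = (\<Sum>i<P. h (i + t)) + h t"
    using assms[of t] by (simp add: add.commute)
  ultimately show ?case using Suc by simp
qed simp

text \<open>
  This is Markov's inequality. The block sums have mean at least \<open>n s\<^sub>0\<close>. They are at most \<open>n s\<^sub>1\<close>
  on \<open>Ok\<close> and at most \<open>n K\<close> on the remaining small proportion \<open>\<kappa>\<close> of indices, so few of them can
  fall below \<open>n (s\<^sub>1 - \<rho>)\<close>.
\<close>

lemma card_low_block_sums_le:
  fixes h :: "nat \<Rightarrow> real"
  assumes n: "n > 0" and per: "\<And>i. h (i + P) = h i"
    and s0: "real P * s0 \<le> (\<Sum>i<P. h i)"
    and up: "\<And>i. i \<in> Ok \<Longrightarrow> (\<Sum>t<n. h (i + t)) \<le> real n * s1"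
    and crude: "\<And>i. (\<Sum>t<n. h (i + t)) \<le> real n * K" and K: "s1 \<le> K"
    and few: "real (card {i. i < P \<and> i \<notin> Ok}) \<le> \<kappa> * real P"
  shows "\<rho> * real (card {i. i < P \<and> i \<in> Ok \<and> (\<Sum>t<n. h (i + t)) < real n * (s1 - \<rho>)}) \<le> real P * (s1 - s0
      + \<kappa> * (K - s1))"
proof -
  define B where "B = {i. i < P \<and> i \<in> Ok \<and> (\<Sum>t<n. h (i + t)) < real n * (s1 - \<rho>)}"
  define N where "N = {i. i < P \<and> i \<notin> Ok}"
  have fin: "finite B" "finite N" by (auto simp: B_def N_def)
  have "real n * (real P * s0) \<le> real n * (\<Sum>i<P. h i)" using s0 by (intro mult_left_mono) auto
  also have "\<dots> = (\<Sum>t<n. \<Sum>i<P. h (i + t))" using periodic_sum_shift[of h P, OF per] by simp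
  also have "\<dots> = (\<Sum>i<P. \<Sum>t<n. h (i + t))" by (rule sum.swap)
  also have "\<dots> \<le> (\<Sum>i<P. real n * (s1 - \<rho> * indicator B i + (K - s1) * indicator N i))"
  proof (rule sum_mono)
    fix i assume i: "i \<in> {..<P}"
    consider "i \<in> N" "i \<notin> B" | "i \<notin> N" "i \<in> B" | "i \<notin> N" "i \<notin> B" "i \<in> Ok"
      using i by (auto simp: N_def B_def)
    then show "(\<Sum>t<n. h (i + t)) \<le> real n * (s1 - \<rho> * indicator B i + (K - s1) * indicator N i)"
    proof cases
      case 1 then show ?thesis using crude[of i] by simp
    next
      case 2 then show ?thesis by (simp add: B_def)
    next
      case 3 then show ?thesis using up[of i] by simp
    qed
  qed
  also have "\<dots> = real n * (real P * s1 - \<rho> * real (card B) + (K - s1) * real (card N))"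
  proof -
    have "(\<Sum>i<P. indicator B i) = real (card B)" "(\<Sum>i<P. indicator N i) = real (card N)"
      by (auto simp: indicator_def B_def N_def sum.If_cases intro!: arg_cong[where f=card])
    then show ?thesis
      by (simp add: sum_distrib_left [symmetric] sum.distrib sum_subtractf del: sum_distrib_left)
  qed
  finally have "real P * s0 \<le> real P * s1 - \<rho> * real (card B) + (K - s1) * real (card N)"
    using n by simp
  also have "(K - s1) * real (card N) \<le> (K - s1) * (\<kappa> * real P)"
    using few K by (intro mult_left_mono) (auto simp: N_def)
  finally show ?thesis by (simp add: B_def algebra_simps)
qed

section \<open>Blocks of large volume\<close>

text \<open>
  In the lemmas of this section, \<open>T\<^sub>0\<close> is a product of length \<open>n\<close> at a good point \<open>y\<close> of \<open>\<mu>\<close> (or its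
  transpose), \<open>T\<close> the nearby product at a point of the periodic orbit, and \<open>K i\<close> are projections
  onto a flag of slow subspaces at \<open>y\<close>.
\<close>

lemma block_flag:
  fixes T T0 :: "real^'n^'n" and K :: "nat \<Rightarrow> real^'n^'n"
  assumes K: "K i ** K i = K i" "norm (T0 ** K i) \<le> exp (real n * b i)"
    and T: "norm (T - T0) \<le> \<theta>" "\<theta> \<le> exp (real n * b i)" and w: "w \<in> rng (K i)"
  shows "norm (T *v w) \<le> 2 * exp (real n * b i) * norm w"
proof -
  have "K i *v w = w" using w K mem_range_idem_iff by blast
  then have "T *v w = (T0 ** K i) *v w + (T - T0) *v w"
    by (simp add: matrix_vector_mul_assoc [symmetric] matrix_vector_mult_diff_rdistrib)
  then have "norm (T *v w) \<le> norm ((T0 ** K i) *v w) + norm ((T - T0) *v w)" by (metis norm_triangle_ineq)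
  also have "\<dots> \<le> norm (T0 ** K i) * norm w + norm (T - T0) * norm w"
    by (intro add_mono norm_matrix_vector_mult_le)
  also have "\<dots> \<le> exp (real n * b i) * norm w + exp (real n * b i) * norm w"
    using K T by (intro add_mono mult_right_mono) auto
  finally show ?thesis by (simp add: mult_ac)
qed

lemma block_volume_le:
  fixes T T0 :: "real^'n^'n" and K :: "nat \<Rightarrow> real^'n^'n"
  assumes W: "subspace W" "subspace W'" "dim W = m" "dim W' = m" and T: "\<And>w. w \<in> W \<Longrightarrow> T *v w \<in> W'"
    and K: "\<And>i. i \<in> {1..m} \<Longrightarrow> K i ** K i = K i \<and> CARD('n) + 1 \<le> dim (rng (K i)) + i
              \<and> norm (T0 ** K i) \<le> exp (real n * b i) \<and> \<theta> \<le> exp (real n * b i)"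
    and th: "norm (T - T0) \<le> \<theta>"
  shows "vol T W W' \<le> fact CARD('n) * 2 ^ m * exp (real n * (\<Sum>i=1..m. b i))"
proof -
  have "vol T W W' \<le> fact CARD('n) * (\<Prod>i=1..m. 2 * exp (real n * b i))"
  proof (rule vol_le_flag[OF W T, where H="\<lambda>i. rng (K i)"])
    show "norm (T *v w) \<le> 2 * exp (real n * b i) * norm w" if "i \<in> {1..m}" "w \<in> rng (K i)" for i w
      using K[OF that(1)] that by (intro block_flag[OF _ _ th]) auto
  qed (use K subspace_range_matrix in auto)
  also have "(\<Prod>i=1..m. 2 * exp (real n * b i)) = 2 ^ m * exp (real n * (\<Sum>i=1..m. b i))"
    by (simp add: prod.distrib exp_sum sum_distrib_left)
  finally show ?thesis by simp
qed

text \<open>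
  \<open>R\<close> stands for the slow projection at the end of the block (or its dual analogue). The vectors of \<open>W\<close> are not
  contracted below the rate \<open>\<sigma> - \<Sum>i<m. b\<^sub>i\<close>, while \<open>R\<close> only sees growth with the smaller rate \<open>c\<close>.
\<close>

lemma block_close:
  fixes T T0 R :: "real^'n^'n" and K :: "nat \<Rightarrow> real^'n^'n"
  assumes W: "subspace W" "subspace W'" "dim W = m" "dim W' = m" and T: "\<And>w. w \<in> W \<Longrightarrow> T *v w \<in> W'"
    and K: "\<And>i. i \<in> {1..m} \<Longrightarrow> K i ** K i = K i \<and> CARD('n) + 1 \<le> dim (rng (K i)) + i
              \<and> norm (T0 ** K i) \<le> exp (real n * b i) \<and> \<theta> \<le> exp (real n * b i)"
    and th: "norm (T - T0) \<le> \<theta>"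
    and v: "exp (real n * \<sigma>) \<le> vol T W W'"
    and R: "norm (R ** T0) \<le> exp (real n * c)" "norm R * \<theta> \<le> exp (real n * c)"
    and w': "w' \<in> W'"
  shows "norm (R *v w') \<le> fact CARD('n) * 2 ^ (m + 1) * exp (real n * (c + (\<Sum>i\<in>{1..<m}. b i) - \<sigma>)) *
      norm w'"
proof -
  have v0: "vol T W W' > 0" using v by (meson exp_gt_zero less_le_trans)
  have "\<exists>w\<in>W. T *v w = w' \<and> vol T W W' * norm w \<le> fact CARD('n) * (\<Prod>i\<in>{1..<m}. 2 * exp (real n * b i)) *
      norm w'"
  proof (rule large_volume_preimage[OF W T _ _ v0 w', where H="\<lambda>i. rng (K i)"])
    show "norm (T *v w) \<le> 2 * exp (real n * b i) * norm w" if "i \<in> {1..m}" "w \<in> rng (K i)" for i w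
      using K[OF that(1)] that by (intro block_flag[OF _ _ th]) auto
  qed (use K subspace_range_matrix in auto)
  then obtain w where w: "w \<in> W" "T *v w = w'"
    "vol T W W' * norm w \<le> fact CARD('n) * (\<Prod>i\<in>{1..<m}. 2 * exp (real n * b i)) * norm w'" by blast
  have "(\<Prod>i\<in>{1..<m}. 2 * exp (real n * b i)) = 2 ^ (m - 1) * exp (real n * (\<Sum>i\<in>{1..<m}. b i))"
    by (simp add: prod.distrib exp_sum sum_distrib_left)
  also have "\<dots> \<le> 2 ^ m * exp (real n * (\<Sum>i\<in>{1..<m}. b i))"
    by (intro mult_right_mono power_increasing) auto
  finally have pr: "(\<Prod>i\<in>{1..<m}. 2 * exp (real n * b i)) \<le> 2 ^ m * exp (real n * (\<Sum>i\<in>{1..<m}. b i))" .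
  have "exp (real n * \<sigma>) * norm w \<le> vol T W W' * norm w" using v by (intro mult_right_mono) auto
  also note w(3)
  also have "fact CARD('n) * (\<Prod>i\<in>{1..<m}. 2 * exp (real n * b i)) * norm w' \<le>
      fact CARD('n) * (2 ^ m * exp (real n * (\<Sum>i\<in>{1..<m}. b i))) * norm w'"
    using pr by (intro mult_right_mono mult_left_mono) auto
  finally have "norm w \<le> fact CARD('n) * (2 ^ m * exp (real n * (\<Sum>i\<in>{1..<m}. b i))) * norm w' * exp (-
      (real n * \<sigma>))"
    by (simp add: exp_minus field_simps)
  also have "\<dots> = fact CARD('n) * 2 ^ m * norm w' * exp (real n * ((\<Sum>i\<in>{1..<m}. b i) - \<sigma>))"
    by (simp add: right_diff_distrib exp_diff exp_minus field_simps)
  finally have nw: "norm w \<le> fact CARD('n) * 2 ^ m * norm w' * exp (real n * ((\<Sum>i\<in>{1..<m}. b i) - \<sigma>))" .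
  have "R *v w' = (R ** T0) *v w + (R ** (T - T0)) *v w"
    using w(2) by (simp add: matrix_sub_ldistrib matrix_vector_mult_diff_rdistrib
        matrix_vector_mul_assoc [symmetric])
  then have "norm (R *v w') \<le> norm ((R ** T0) *v w) + norm ((R ** (T - T0)) *v w)"
      by (metis norm_triangle_ineq)
  also have "\<dots> \<le> norm (R ** T0) * norm w + norm (R ** (T - T0)) * norm w"
    by (intro add_mono norm_matrix_vector_mult_le)
  also have "\<dots> \<le> exp (real n * c) * norm w + exp (real n * c) * norm w"
  proof -
    have "norm (R ** (T - T0)) \<le> norm R * norm (T - T0)" by (rule norm_matrix_mult_le)
    also have "\<dots> \<le> norm R * \<theta>" using th by (intro mult_left_mono) auto
    finally show ?thesis using R by (intro add_mono mult_right_mono) auto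
  qed
  also have "\<dots> = 2 * exp (real n * c) * norm w" by simp
  also have "\<dots> \<le> 2 * exp (real n * c) * (fact CARD('n) * 2 ^ m * norm w' * exp (real n * ((\<Sum>i\<in>{1..<m}. b
      i) - \<sigma>)))"
    using nw by (intro mult_left_mono) auto
  also have "\<dots> = fact CARD('n) * 2 ^ (m + 1) * exp (real n * (c + (\<Sum>i\<in>{1..<m}. b i) - \<sigma>)) * norm w'"
    by (simp add: distrib_left right_diff_distrib exp_add exp_diff)
  finally show ?thesis .
qed

section \<open>Exponential rates\<close>

lemma rate_upper:
  fixes a :: "nat \<Rightarrow> real"
  assumes "(\<lambda>n. ereal (1 / real n) * elog (a n)) \<longlonglongrightarrow> L" "L < ereal b" and a: "\<And>n. a n \<ge> 0"
  shows "eventually (\<lambda>n. a n \<le> exp (real n * b)) sequentially"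
  using order_tendstoD(2)[OF assms(1,2)] eventually_gt_at_top[of 0]
proof eventually_elim
  case (elim n)
  show ?case
  proof (cases "a n = 0")
    case False
    then have "ln (a n) / real n < b" using elim by (simp add: elog_def)
    then have "ln (a n) \<le> real n * b" using elim by (simp add: field_simps)
    then show ?thesis using False a[of n] by (metis exp_le_cancel_iff exp_ln less_le)
  qed simp
qed

lemma rate_lower:
  fixes a :: "nat \<Rightarrow> real"
  assumes "(\<lambda>n. ereal (1 / real n) * elog (a n)) \<longlonglongrightarrow> L" "ereal b < L" and a: "\<And>n. a n \<ge> 0"
  shows "eventually (\<lambda>n. exp (real n * b) \<le> a n) sequentially"
  using order_tendstoD(1)[OF assms(1,2)] eventually_gt_at_top[of 0]
proof eventually_elim
  case (elim n)
  show ?case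
  proof (cases "a n = 0")
    case True
    then show ?thesis using elim by (simp add: elog_def)
  next
    case False
    then have "b < ln (a n) / real n" using elim by (simp add: elog_def)
    then have "real n * b \<le> ln (a n)" using elim by (simp add: field_simps)
    then show ?thesis using False a[of n] by (metis exp_le_cancel_iff exp_ln less_le)
  qed
qed

lemma eventually_mult_exp_le:
  fixes b b' c :: real
  assumes "b' < b" shows "eventually (\<lambda>n. c * exp (real n * b') \<le> exp (real n * b)) sequentially"
proof -
  have "filterlim (\<lambda>n. exp (b - b') ^ n) at_top sequentially"
    using assms by (intro power_at_top) simp
  then have "eventually (\<lambda>n. c \<le> exp (b - b') ^ n) sequentially"
    by (simp add: filterlim_at_top)
  then show ?thesis
  proof eventually_elim
    case (elim n)
    have "c * exp (real n * b') \<le> exp (b - b') ^ n * exp (real n * b')"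
      using elim by (intro mult_right_mono) auto
    also have "\<dots> = exp (real n * b)"
      by (simp add: exp_of_nat_mult [symmetric] exp_add [symmetric] algebra_simps)
    finally show ?case .
  qed
qed

text \<open>
  The vectors of growth rate at most \<open>t\<close>. The definition by upper bounds makes it evident that they
  form a subspace, and it covers \<open>t = -\<infinity>\<close>.
\<close>

definition slow_space :: "('a \<Rightarrow> 'a) \<Rightarrow> ('a \<Rightarrow> real^'d^'d) \<Rightarrow> 'a \<Rightarrow> ereal \<Rightarrow> (real^'d) set" where
  "slow_space f A x t = {v. \<forall>b::real. t < ereal b \<longrightarrow>
      eventually (\<lambda>n. norm (cocycle f A n x *v v) \<le> exp (real n * b)) sequentially}"

lemma subspace_slow_space: "subspace (slow_space f A x t)"
  unfolding subspace_def
proof (intro conjI ballI allI)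
  show "0 \<in> slow_space f A x t" by (simp add: slow_space_def)
next
  fix u v assume uv: "u \<in> slow_space f A x t" "v \<in> slow_space f A x t"
  show "u + v \<in> slow_space f A x t"
    unfolding slow_space_def
  proof (intro CollectI allI impI)
    fix b :: real assume "t < ereal b"
    then obtain b' :: real where b': "t < ereal b'" "b' < b"
      by (metis ereal_dense2 ereal_less(2) less_ereal.simps(1))
    have 1: "eventually (\<lambda>n. norm (cocycle f A n x *v u) \<le> exp (real n * b')) sequentially"
      "eventually (\<lambda>n. norm (cocycle f A n x *v v) \<le> exp (real n * b')) sequentially"
      using uv b' by (auto simp: slow_space_def)
    from 1 eventually_mult_exp_le[OF b'(2), of 2]
    show "eventually (\<lambda>n. norm (cocycle f A n x *v (u + v)) \<le> exp (real n * b)) sequentially"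
    proof eventually_elim
      case (elim n)
      have "norm (cocycle f A n x *v (u + v)) \<le> norm (cocycle f A n x *v u) + norm (cocycle f A n x *v v)"
        by (simp add: matrix_vector_right_distrib norm_triangle_ineq)
      then show ?case using elim by linarith
    qed
  qed
next
  fix c v assume v: "v \<in> slow_space f A x t"
  show "c *\<^sub>R v \<in> slow_space f A x t"
    unfolding slow_space_def
  proof (intro CollectI allI impI)
    fix b :: real assume "t < ereal b"
    then obtain b' :: real where b': "t < ereal b'" "b' < b"
      by (metis ereal_dense2 ereal_less(2) less_ereal.simps(1))
    have "eventually (\<lambda>n. norm (cocycle f A n x *v v) \<le> exp (real n * b')) sequentially"
      using v b' by (auto simp: slow_space_def)
    with eventually_mult_exp_le[OF b'(2), of "\<bar>c\<bar>"]
    show "eventually (\<lambda>n. norm (cocycle f A n x *v (c *\<^sub>R v)) \<le> exp (real n * b)) sequentially"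
    proof eventually_elim
      case (elim n)
      have "norm (cocycle f A n x *v (c *\<^sub>R v)) \<le> \<bar>c\<bar> * exp (real n * b')"
        using elim by (simp add: matrix_vector_mult_scaleR mult_left_mono)
      then show ?case using elim by linarith
    qed
  qed
qed

lemma slow_space_mono: "s \<le> t \<Longrightarrow> slow_space f A x s \<subseteq> slow_space f A x t"
  unfolding slow_space_def by (auto intro: le_less_trans)

section \<open>Regular points and their projections\<close>

text \<open>
  The pointwise part of the definition of an Oseledets splitting. Invariance is an inclusion, as it
  is for the exponent \<open>-\<infinity>\<close>; this is what makes the projections commute with \<open>A\<close>.
\<close>

definition regular_at :: "('a \<Rightarrow> 'a) \<Rightarrow> ('a \<Rightarrow> real^'d^'d) \<Rightarrow> ('a, 'd) oseledets_data \<Rightarrow> 'a \<Rightarrow> bool" where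
  "regular_at f A D x \<longleftrightarrow>
     direct_sum_decomposition (num D) (\<lambda>i. space_at D i x) \<and>
        (\<forall>i\<in>{1..num D}.
           dim (space_at D i x) = mult D i \<and>
           (\<lambda>v. A x *v v) ` space_at D i x \<subseteq> space_at D i (f x) \<and>
           (\<forall>v\<in>space_at D i x. v \<noteq> 0 \<longrightarrow>
              (\<lambda>n. ereal (1 / real n) * elog (norm (cocycle f A n x *v v)))
                \<longlonglongrightarrow> expo D i))"

definition spectrum_data :: "('a, 'd::finite) oseledets_data \<Rightarrow> bool" where
  "spectrum_data D \<longleftrightarrow> (\<forall>i\<in>{1..num D}. \<forall>j\<in>{1..num D}. i < j \<longrightarrow> expo D j < expo D i) \<and>
     (\<forall>i\<in>{1..num D}. expo D i < \<infinity> \<and> 1 \<le> mult D i)"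

text \<open>
  \<open>csum D i\<close> is the dimension of the sum of the first \<open>i\<close> subspaces, and \<open>idx D j\<close> is the index
  of the subspace to which the \<open>j\<close>-th exponent, counted with multiplicity, belongs.
\<close>

definition csum :: "('a, 'd::finite) oseledets_data \<Rightarrow> nat \<Rightarrow> nat" where
  "csum D i = (\<Sum>i'=1..i. mult D i')"

definition idx :: "('a, 'd::finite) oseledets_data \<Rightarrow> nat \<Rightarrow> nat" where
  "idx D j = (LEAST i. j \<le> csum D i)"

definition oproj :: "('a, 'd::finite) oseledets_data \<Rightarrow> 'a \<Rightarrow> nat \<Rightarrow> real^'d^'d" where
  "oproj D x = split_proj (num D) (\<lambda>i. space_at D i x)"

abbreviation fast_proj :: "('a, 'd::finite) oseledets_data \<Rightarrow> 'a \<Rightarrow> nat \<Rightarrow> real^'d^'d" where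
  "fast_proj D x j \<equiv> sum (oproj D x) {1..j}"

abbreviation slow_proj :: "('a, 'd::finite) oseledets_data \<Rightarrow> 'a \<Rightarrow> nat \<Rightarrow> real^'d^'d" where
  "slow_proj D x j \<equiv> sum (oproj D x) {j..num D}"

lemma lyap_idx: "lyap D j = expo D (idx D j)"
  by (simp add: lyap_def idx_def csum_def)

lemma csum_0 [simp]: "csum D 0 = 0" by (simp add: csum_def)

lemma csum_Suc: "csum D (Suc i) = csum D i + mult D (Suc i)"
  by (simp add: csum_def)

lemma csum_mono: "i \<le> j \<Longrightarrow> csum D i \<le> csum D j"
  unfolding csum_def by (intro sum_mono2) auto

lemma idx_eqI: "csum D i < j \<Longrightarrow> j \<le> csum D (Suc i) \<Longrightarrow> idx D j = Suc i"
  unfolding idx_def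
proof (rule Least_equality)
  fix k assume "csum D i < j" "j \<le> csum D k"
  then have "\<not> k \<le> i" using csum_mono[of k i D] by auto
  then show "Suc i \<le> k" by simp
qed auto

lemma idx_props:
  assumes "1 \<le> j" "j \<le> csum D l"
  shows "1 \<le> idx D j" "idx D j \<le> l" "csum D (idx D j - 1) < j" "j \<le> csum D (idx D j)"
proof -
  show 4: "j \<le> csum D (idx D j)" unfolding idx_def by (rule LeastI) (rule assms(2))
  show "idx D j \<le> l" unfolding idx_def by (rule Least_le) (rule assms(2))
  show 1: "1 \<le> idx D j"
  proof (rule ccontr)
    assume "\<not> 1 \<le> idx D j"
    then have i0: "idx D j = 0" by simp
    have "j \<le> 0" using 4 by (simp only: i0 csum_0)
    then show False using assms(1) by simp
  qed
  show "csum D (idx D j - 1) < j"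
  proof (rule ccontr)
    assume "\<not> csum D (idx D j - 1) < j"
    then have "idx D j \<le> idx D j - 1" unfolding idx_def by (intro Least_le) auto
    then show False using 1 by simp
  qed
qed

lemma idx_le_iff: "1 \<le> j \<Longrightarrow> j \<le> csum D l \<Longrightarrow> idx D j \<le> i \<longleftrightarrow> j \<le> csum D i"
  using idx_props(4)[of j D l] csum_mono[of "idx D j" i D] Least_le[of "\<lambda>i. j \<le> csum D i" i]
  by (auto simp: idx_def)

lemma csum_strict: "spectrum_data D \<Longrightarrow> i < j \<Longrightarrow> j \<le> num D \<Longrightarrow> csum D i < csum D j"
proof -
  assume D: "spectrum_data D" "i < j" "j \<le> num D"
  have "csum D i < csum D (Suc i)" using D by (simp add: csum_Suc spectrum_data_def Suc_le_eq)
  also have "\<dots> \<le> csum D j" using D by (intro csum_mono) auto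
  finally show ?thesis .
qed

lemma expo_mono: "spectrum_data D \<Longrightarrow> i \<in> {1..num D} \<Longrightarrow> j \<in> {1..num D} \<Longrightarrow> expo D j < expo D i \<longleftrightarrow> i < j"
  unfolding spectrum_data_def by (metis less_asym linorder_neqE_nat less_irrefl)

lemma expo_inj: "spectrum_data D \<Longrightarrow> i \<in> {1..num D} \<Longrightarrow> j \<in> {1..num D} \<Longrightarrow> expo D i = expo D j \<Longrightarrow> i = j"
  using expo_mono by (metis less_irrefl linorder_neqE_nat)

lemma oproj_family: "regular_at f A D x \<Longrightarrow> proj_family (num D) (oproj D x)"
  unfolding oproj_def regular_at_def by (intro proj_family_split_proj) auto

lemma range_oproj: "regular_at f A D x \<Longrightarrow> i \<in> {1..num D} \<Longrightarrow> rng (oproj D x i) = space_at D i x"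
  unfolding oproj_def regular_at_def by (intro range_split_proj) auto

lemma dim_oproj_sum:
  assumes r: "regular_at f A D x" and I: "I \<subseteq> {1..num D}"
  shows "dim (rng (sum (oproj D x) I)) = (\<Sum>i\<in>I. mult D i)"
proof -
  have "dim (rng (sum (oproj D x) I)) = (\<Sum>i\<in>I. dim (rng (oproj D x i)))"
    by (rule proj_family_dim[OF oproj_family[OF r] I])
  also have "\<dots> = (\<Sum>i\<in>I. mult D i)"
  proof (rule sum.cong)
    fix i assume "i \<in> I"
    then have "i \<in> {1..num D}" using I by auto
    then show "dim (rng (oproj D x i)) = mult D i"
      using range_oproj[OF r] r by (auto simp: regular_at_def)
  qed simp
  finally show ?thesis .
qed

lemma csum_num:
  fixes D :: "('a, 'd::finite) oseledets_data"
  assumes r: "regular_at f A D x" shows "csum D (num D) = CARD('d)"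
proof -
  have "sum (oproj D x) {1..num D} = mat 1" using oproj_family[OF r] by (simp add: proj_family_def)
  then have "rng (sum (oproj D x) {1..num D}) = UNIV" by (auto simp: image_def)
  then show ?thesis using dim_oproj_sum[OF r, of "{1..num D}"] by (simp add: csum_def)
qed

lemma sum_mult_interval: "(\<Sum>i\<in>{a<..b}. mult D i) = csum D b - csum D a"
proof (cases "a \<le> b")
  case True
  have "{1..b} = {1..a} \<union> {a<..b}" using True by auto
  then have "csum D b = csum D a + (\<Sum>i\<in>{a<..b}. mult D i)"
    unfolding csum_def by (simp only:) (rule sum.union_disjoint, auto)
  then show ?thesis by simp
qed (simp add: csum_mono)

lemma oproj_equivariant:
  assumes r: "regular_at f A D x" "regular_at f A D (f x)" and i: "i \<in> {1..num D}"
  shows "A x ** oproj D x i = oproj D (f x) i ** A x"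
proof (rule proj_family_equivariant[OF oproj_family[OF r(1)] oproj_family[OF r(2)] _ i])
  fix i v assume i: "i \<in> {1..num D}" and "v \<in> rng (oproj D x i)"
  then have "v \<in> space_at D i x" using range_oproj[OF r(1)] by auto
  then have "A x *v v \<in> space_at D i (f x)" using r(1) i unfolding regular_at_def by blast
  then show "A x *v v \<in> rng (oproj D (f x) i)" using range_oproj[OF r(2) i] by auto
qed

lemma oproj_sum_equivariant:
  assumes r: "regular_at f A D x" "regular_at f A D (f x)" and I: "I \<subseteq> {1..num D}"
  shows "A x ** sum (oproj D x) I = sum (oproj D (f x)) I ** A x"
  unfolding matrix_mult_sum_left matrix_mult_sum_right
  using oproj_equivariant[OF r] I by (intro sum.cong) auto

lemma oproj_sum_cocycle:
  assumes r: "\<And>n. regular_at f A D ((f ^^ n) x)" and I: "I \<subseteq> {1..num D}"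
  shows "cocycle f A n x ** sum (oproj D x) I = sum (oproj D ((f ^^ n) x)) I ** cocycle f A n x"
proof (induction n)
  case (Suc n)
  have "cocycle f A (Suc n) x ** sum (oproj D x) I = A ((f ^^ n) x) ** (cocycle f A n x ** sum (oproj D
      x) I)"
    by (simp add: matrix_mul_assoc)
  also have "\<dots> = (A ((f ^^ n) x) ** sum (oproj D ((f ^^ n) x)) I) ** cocycle f A n x"
    unfolding Suc by (simp add: matrix_mul_assoc)
  also have "A ((f ^^ n) x) ** sum (oproj D ((f ^^ n) x)) I = sum (oproj D ((f ^^ Suc n) x)) I ** A ((f
      ^^ n) x)"
    using oproj_sum_equivariant[OF r[of n] _ I] r[of "Suc n"] by simp
  finally show ?case by (simp add: matrix_mul_assoc)
qed simp

lemma space_at_slow: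
  assumes r: "regular_at f A D x" and i: "i \<in> {1..num D}" and t: "expo D i \<le> t"
  shows "space_at D i x \<subseteq> slow_space f A x t"
proof
  fix v assume v: "v \<in> space_at D i x"
  show "v \<in> slow_space f A x t"
  proof (cases "v = 0")
    case True then show ?thesis by (simp add: slow_space_def)
  next
    case False
    then have l: "(\<lambda>n. ereal (1 / real n) * elog (norm (cocycle f A n x *v v))) \<longlonglongrightarrow> expo D i"
      using r i v by (auto simp: regular_at_def)
    show ?thesis unfolding slow_space_def
      by (intro CollectI allI impI rate_upper[OF l]) (use t in auto)
  qed
qed

lemma space_at_not_slow:
  assumes r: "regular_at f A D x" and i: "i \<in> {1..num D}" and v: "v \<in> space_at D i x" "v \<in> slow_space f
      A x t"
    and t: "t < expo D i"
  shows "v = 0"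
proof (rule ccontr)
  assume "v \<noteq> 0"
  then have l: "(\<lambda>n. ereal (1 / real n) * elog (norm (cocycle f A n x *v v))) \<longlonglongrightarrow> expo D i"
    using r i v by (auto simp: regular_at_def)
  obtain b :: real where b: "t < ereal b" "ereal b < expo D i" using t ereal_dense2 by blast
  obtain b' :: real where b': "ereal b < ereal b'" "ereal b' < expo D i" using b(2) ereal_dense2 by blast
  have "eventually (\<lambda>n. exp (real n * b') \<le> norm (cocycle f A n x *v v)) sequentially"
    by (rule rate_lower[OF l b'(2)]) simp
  moreover have "eventually (\<lambda>n. norm (cocycle f A n x *v v) \<le> exp (real n * b)) sequentially"
    using v(2) b(1) by (simp add: slow_space_def)
  ultimately have "eventually (\<lambda>n::nat. False) sequentially"
    using eventually_gt_at_top[of 0]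
  proof eventually_elim
    case (elim n)
    then have "exp (real n * b') \<le> exp (real n * b)" by linarith
    then show False using elim b'(1) by simp
  qed
  then show False by simp
qed

text \<open>
  The growth rate of a vector is the largest exponent among its nonzero components. Suppose that the
  first nonzero component \<open>i\<close> has an exponent larger than \<open>t\<close>. It is the difference of the vector
  and of its later components, hence of growth rate less than \<open>expo D i\<close>, which is absurd.
\<close>

lemma slow_space_eq:
  assumes D: "spectrum_data D" and r: "regular_at f A D x"
  shows "slow_space f A x t = rng (sum (oproj D x) {i \<in> {1..num D}. expo D i \<le> t})" (is "_
      = rng (sum _ ?I)")
proof
  note q = oproj_family[OF r]
  have mem: "oproj D x i *v v \<in> space_at D i x" if "i \<in> {1..num D}" for i v
    using range_oproj[OF r that] by blast
  have dec: "v = (\<Sum>i=1..num D. oproj D x i *v v)" for v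
    using q by (simp add: proj_family_def matrix_sum_vector [symmetric])
  show "rng (sum (oproj D x) ?I) \<subseteq> slow_space f A x t"
  proof safe
    fix v
    show "sum (oproj D x) ?I *v v \<in> slow_space f A x t"
      unfolding matrix_sum_vector
      by (rule subspace_sum[OF subspace_slow_space]) (use mem space_at_slow[OF r] in blast)
  qed
  show "slow_space f A x t \<subseteq> rng (sum (oproj D x) ?I)"
  proof
    fix v assume v: "v \<in> slow_space f A x t"
    have zero: "oproj D x i *v v = 0" if "i \<in> {1..num D}" "t < expo D i" for i
      using that
    proof (induction i rule: less_induct)
      case (less i)
      have z: "oproj D x j *v v = 0" if "j \<in> {1..<i}" for j
      proof (rule less.IH)
        show "j < i" "j \<in> {1..num D}" using that less.prems by auto
        show "t < expo D j" using expo_mono[OF D, of j i] that less.prems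
            by (meson \<open>j < i\<close> \<open>j \<in> {1..num D}\<close> less_trans)
      qed
      have split: "{1..num D} = {1..<i} \<union> {i} \<union> {i<..num D}" using less.prems by auto
      have "v = (\<Sum>j\<in>{1..<i}. oproj D x j *v v) + oproj D x i *v v + (\<Sum>j\<in>{i<..num D}. oproj D x j *v v)"
        apply (subst dec[of v])
        unfolding split by (subst sum.union_disjoint; (force | (subst sum.union_disjoint; force)))
      then have e: "oproj D x i *v v = v - (\<Sum>j\<in>{i<..num D}. oproj D x j *v v)"
        using z by (simp add: algebra_simps)
      define s where "s = (if i < num D then max t (expo D (Suc i)) else t)"
      have s: "s < expo D i" using less.prems expo_mono[OF D, of i "Suc i"] by (auto simp: s_def)
      have "(\<Sum>j\<in>{i<..num D}. oproj D x j *v v) \<in> slow_space f A x s"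
      proof (rule subspace_sum[OF subspace_slow_space])
        fix j assume j: "j \<in> {i<..num D}"
        have "expo D j \<le> expo D (Suc i)"
          using expo_mono[OF D, of j "Suc i"] j less.prems by (auto simp: not_less [symmetric])
        then have "expo D j \<le> s" using j by (auto simp: s_def le_max_iff_disj)
        then show "oproj D x j *v v \<in> slow_space f A x s"
          using space_at_slow[OF r, of j s] mem[of j v] j by auto
      qed
      moreover have "v \<in> slow_space f A x s"
        using v slow_space_mono[of t s f A x] by (auto simp: s_def)
      ultimately have "oproj D x i *v v \<in> slow_space f A x s"
        unfolding e by (intro subspace_diff subspace_slow_space)
      then show ?case using space_at_not_slow[OF r _ mem _ s] less.prems by blast
    qed
    have "v = (\<Sum>i=1..num D. oproj D x i *v v)" by (rule dec)
    also have "\<dots> = (\<Sum>i\<in>?I. oproj D x i *v v)"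
    proof (rule sum.mono_neutral_right)
      show "\<forall>i\<in>{1..num D} - ?I. oproj D x i *v v = 0"
      proof
        fix i assume "i \<in> {1..num D} - ?I"
        then have "i \<in> {1..num D}" "t < expo D i" by auto
        then show "oproj D x i *v v = 0" by (rule zero)
      qed
    qed auto
    also have "\<dots> = sum (oproj D x) ?I *v v" by (simp add: matrix_sum_vector)
    finally show "v \<in> rng (sum (oproj D x) ?I)" by blast
  qed
qed

text \<open>
  The right-hand side does not refer to the splitting. Hence the exponents counted with multiplicity
  are the same for any two splittings that share a regular point.
\<close>

lemma lyap_le_iff:
  fixes D :: "('a, 'd::finite) oseledets_data"
  assumes D: "spectrum_data D" and r: "regular_at f A D x" and j: "j \<in> {1..CARD('d)}"
  shows "lyap D j \<le> t \<longleftrightarrow> CARD('d) + 1 \<le> dim (slow_space f A x t) + j"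
proof -
  define i where "i = idx D j"
  have c: "csum D (num D) = CARD('d)" by (rule csum_num[OF r])
  have i: "1 \<le> i" "i \<le> num D" "csum D (i - 1) < j" "j \<le> csum D i"
    using idx_props[of j D "num D"] j c by (auto simp: i_def)
  have dm: "dim (slow_space f A x t) = (\<Sum>i | i \<in> {1..num D} \<and> expo D i \<le> t. mult D i)"
    unfolding slow_space_eq[OF D r] by (rule dim_oproj_sum[OF r]) auto
  show ?thesis
  proof (cases "expo D i \<le> t")
    case True
    have "(\<Sum>i'\<in>{i - 1<..num D}. mult D i') \<le> dim (slow_space f A x t)"
      unfolding dm
    proof (rule sum_mono2)
      show "{i - 1<..num D} \<subseteq> {i' \<in> {1..num D}. expo D i' \<le> t}"
      proof
        fix k assume k: "k \<in> {i - 1<..num D}"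
        then have "expo D k \<le> expo D i" using expo_mono[OF D, of k i] i by (auto simp: not_less [symmetric])
        then show "k \<in> {i' \<in> {1..num D}. expo D i' \<le> t}" using k i True by auto
      qed
    qed auto
    then have "CARD('d) - csum D (i - 1) \<le> dim (slow_space f A x t)"
      by (simp add: sum_mult_interval c)
    then show ?thesis using True i j by (auto simp: lyap_idx i_def [symmetric])
  next
    case False
    have "dim (slow_space f A x t) \<le> (\<Sum>i'\<in>{i<..num D}. mult D i')"
      unfolding dm
    proof (rule sum_mono2)
      show "{i' \<in> {1..num D}. expo D i' \<le> t} \<subseteq> {i<..num D}"
      proof
        fix k assume k: "k \<in> {i' \<in> {1..num D}. expo D i' \<le> t}"
        then have "expo D k < expo D i" using False by auto
        then show "k \<in> {i<..num D}" using expo_mono[OF D, of i k] i k by auto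
      qed
    qed auto
    then have "dim (slow_space f A x t) \<le> CARD('d) - csum D i"
      by (simp add: sum_mult_interval c)
    then show ?thesis using False i j by (auto simp: lyap_idx i_def [symmetric])
  qed
qed

lemma lyap_unique:
  fixes D D' :: "('a, 'd::finite) oseledets_data"
  assumes "spectrum_data D" "regular_at f A D x" "spectrum_data D'" "regular_at f A D' x" "j \<in>
      {1..CARD('d)}"
  shows "lyap D j = lyap D' j"
proof -
  have "lyap D j \<le> t \<longleftrightarrow> lyap D' j \<le> t" for t
    by (simp only: lyap_le_iff[OF assms(1,2,5)] lyap_le_iff[OF assms(3,4,5)])
  from this[of "lyap D j"] this[of "lyap D' j"] show ?thesis by auto
qed

lemma sum_lyap_csum:
  assumes D: "spectrum_data D" and i: "i \<le> num D"
  shows "(\<Sum>r=1..csum D i. real_of_ereal (lyap D r)) = (\<Sum>k=1..i. real_of_ereal (expo D k) * real (mult D k))"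
  using i
proof (induction i)
  case (Suc i)
  have "{1..csum D (Suc i)} = {1..csum D i} \<union> {csum D i<..csum D (Suc i)}"
    using csum_mono[of i "Suc i" D] by auto
  then have "(\<Sum>r=1..csum D (Suc i). real_of_ereal (lyap D r)) = (\<Sum>r=1..csum D i. real_of_ereal (lyap D r))
      + (\<Sum>r\<in>{csum D i<..csum D (Suc i)}. real_of_ereal (lyap D r))"
    by (simp only:) (rule sum.union_disjoint, auto)
  also have "(\<Sum>r\<in>{csum D i<..csum D (Suc i)}. real_of_ereal (lyap D r))
      = (\<Sum>r\<in>{csum D i<..csum D (Suc i)}. real_of_ereal (expo D (Suc i)))"
    by (intro sum.cong) (auto simp: lyap_idx idx_eqI)
  also have "\<dots> = real_of_ereal (expo D (Suc i)) * real (mult D (Suc i))"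
    by (simp add: csum_Suc)
  finally show ?case using Suc by simp
qed simp

text \<open>
  The slow spaces at a regular point, repeated according to the multiplicities, form a flag as it
  is required by the volume estimates.
\<close>

lemma regular_flag:
  fixes D :: "('a, 'd::finite) oseledets_data"
  assumes r: "regular_at f A D y" and i: "i \<in> {1..CARD('d)}"
  shows "slow_proj D y (idx D i) ** slow_proj D y (idx D i) = slow_proj D y (idx D i)"
    and "CARD('d) + 1 \<le> dim (rng (slow_proj D y (idx D i))) + i"
    and "idx D i \<in> {1..num D}"
proof -
  have c: "csum D (num D) = CARD('d)" by (rule csum_num[OF r])
  have ii: "1 \<le> idx D i" "idx D i \<le> num D" "csum D (idx D i - 1) < i" "i \<le> csum D (idx D i)"
    using idx_props[of i D "num D"] i c by auto
  then show "idx D i \<in> {1..num D}" by simp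
  have sub: "{idx D i..num D} \<subseteq> {1..num D}" using ii by auto
  show "slow_proj D y (idx D i) ** slow_proj D y (idx D i) = slow_proj D y (idx D i)"
    by (rule proj_family_idem[OF oproj_family[OF r] sub])
  have iv: "{idx D i..num D} = {idx D i - 1<..num D}" using ii by auto
  have "dim (rng (slow_proj D y (idx D i))) = CARD('d) - csum D (idx D i - 1)"
    using dim_oproj_sum[OF r sub] unfolding iv by (simp add: sum_mult_interval c)
  then show "CARD('d) + 1 \<le> dim (rng (slow_proj D y (idx D i))) + i"
    using ii(3) by linarith
qed

lemma norm_matrix_le_sum_columns: "norm (M :: real^'n^'m) \<le> (\<Sum>s\<in>UNIV. norm (column s M))"
proof -
  have "norm M = norm (transpose M)" by (simp add: norm_transpose_matrix)
  also have "\<dots> \<le> (\<Sum>s\<in>UNIV. norm (transpose M $ s))"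
    unfolding norm_vec_def[of "transpose M"] by (rule L2_set_le_sum) simp
  also have "\<dots> = (\<Sum>s\<in>UNIV. norm (column s M))"
    by (simp add: transpose_def column_def)
  finally show ?thesis .
qed

text \<open>
  This is the only information on the growth of \<open>A\<^sup>n\<close> at \<open>\<mu>\<close>-typical points that enters the proof.
\<close>

lemma eventually_norm_slow_part:
  fixes A :: "'a \<Rightarrow> real^'d^'d"
  assumes D: "spectrum_data D" and r: "regular_at f A D x" and j: "j \<in> {1..num D}" and a: "expo D j
      < ereal a"
  shows "eventually (\<lambda>n. norm (cocycle f A n x ** slow_proj D x j) \<le> exp (real n * a)) sequentially"
proof -
  obtain b :: real where b: "expo D j < ereal b" "b < a"
    using ereal_dense2[OF a] by auto
  define Q where "Q = slow_proj D x j"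
  have Qs: "Q *v v \<in> slow_space f A x (expo D j)" for v
    unfolding Q_def matrix_sum_vector
  proof (rule subspace_sum[OF subspace_slow_space])
    fix i assume i: "i \<in> {j..num D}"
    have i': "i \<in> {1..num D}" using i j by auto
    have "expo D i \<le> expo D j" using expo_mono[OF D, of i j] i j by (auto simp: not_less [symmetric])
    from space_at_slow[OF r i' this] show "oproj D x i *v v \<in> slow_space f A x (expo D j)"
      using range_oproj[OF r i'] by blast
  qed
  have "eventually (\<lambda>n. \<forall>s\<in>UNIV. norm (cocycle f A n x *v (Q *v axis s 1)) \<le> exp (real n * b)) sequentially"
    using Qs b(1) by (intro eventually_ball_finite) (auto simp: slow_space_def)
  with eventually_mult_exp_le[OF b(2), of "real CARD('d)"]
  show ?thesis
  proof eventually_elim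
    case (elim n)
    have "norm (cocycle f A n x ** Q) \<le> (\<Sum>s\<in>UNIV. norm (column s (cocycle f A n x ** Q)))"
      by (rule norm_matrix_le_sum_columns)
    also have "\<dots> \<le> (\<Sum>s\<in>(UNIV::'d set). exp (real n * b))"
    proof (rule sum_mono)
      fix s
      have "column s (cocycle f A n x ** Q) = (cocycle f A n x ** Q) *v axis s 1"
        by (simp add: matrix_vector_mult_basis)
      also have "\<dots> = cocycle f A n x *v (Q *v axis s 1)" by (simp only: matrix_vector_mul_assoc)
      finally show "norm (column s (cocycle f A n x ** Q)) \<le> exp (real n * b)" using elim by simp
    qed
    also have "\<dots> = real CARD('d) * exp (real n * b)" by simp
    finally show ?case using elim by (simp add: Q_def)
  qed
qed

section \<open>Periodic orbits\<close>

lemma period_props: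
  assumes "periodic_point f p"
  shows "period f p > 0" "(f ^^ period f p) p = p"
proof -
  have "period f p > 0 \<and> (f ^^ period f p) p = p"
    unfolding period_def by (rule LeastI_ex) (use assms in \<open>auto simp: periodic_point_def\<close>)
  then show "period f p > 0" "(f ^^ period f p) p = p" by auto
qed

lemma funpow_orbit_mod:
  assumes "periodic_point f p"
  shows "(f ^^ (i mod period f p)) p = (f ^^ i) p"
  using funpow_mod_eq[OF period_props(2)[OF assms]] .

text \<open>
  Every orbit point is an atom of the orbit measure, and so it escapes every null set.
\<close>

lemma AE_orbit_measure:
  fixes p :: "'a::topological_space"
  assumes p: "periodic_point f p" and ae: "AE x in orbit_measure f p. R x"
  shows "R ((f ^^ i) p)"
proof -
  define P where "P = period f p"
  define M where "M = uniform_count_measure {0..<P}"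
  have P: "P > 0" using period_props[OF p] by (simp add: P_def)
  have meas: "(\<lambda>j. (f ^^ j) p) \<in> measurable M borel"
    by (simp add: M_def measurable_def space_uniform_count_measure sets_uniform_count_measure)
  obtain N where N: "N \<in> null_sets (orbit_measure f p)" "{x \<in> space (orbit_measure f p). \<not> R x} \<subseteq> N"
    using ae by (auto simp: eventually_ae_filter)
  have "N \<in> sets borel" using N(1) by (auto simp: null_sets_def orbit_measure_def)
  then have "emeasure M ((\<lambda>j. (f ^^ j) p) -` N \<inter> space M) = 0"
    using N(1) meas unfolding null_sets_def orbit_measure_def P_def [symmetric] M_def [symmetric]
    by (simp add: emeasure_distr)
  moreover have "space M = {0..<P}" by (simp add: M_def space_uniform_count_measure)
  ultimately have "emeasure M ((\<lambda>j. (f ^^ j) p) -` N \<inter> {0..<P}) = 0" by simp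
  then have "card ((\<lambda>j. (f ^^ j) p) -` N \<inter> {0..<P}) = 0"
    unfolding M_def using P by (subst (asm) emeasure_uniform_count_measure) auto
  then have "(\<lambda>j. (f ^^ j) p) -` N \<inter> {0..<P} = {}" by simp
  moreover have "i mod P \<in> {0..<P}" using P by simp
  ultimately have "(f ^^ (i mod P)) p \<notin> N" by blast
  then have "R ((f ^^ (i mod P)) p)" using N(2) by (auto simp: orbit_measure_def)
  then show ?thesis using funpow_orbit_mod[OF p] by (simp add: P_def)
qed

lemma integral_orbit_measure:
  fixes \<phi> :: "'a::topological_space \<Rightarrow> real"
  assumes \<phi>: "continuous_on UNIV \<phi>"
  shows "integral\<^sup>L (orbit_measure f p) \<phi> = (\<Sum>i<period f p. \<phi> ((f ^^ i) p)) / real (period f p)"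
proof -
  have "integral\<^sup>L (orbit_measure f p) \<phi> =
    integral\<^sup>L (uniform_count_measure {0..<period f p}) (\<lambda>i. \<phi> ((f ^^ i) p))"
    unfolding orbit_measure_def
    by (intro integral_distr borel_measurable_continuous_onI[OF \<phi>])
      (simp add: measurable_def space_uniform_count_measure sets_uniform_count_measure)
  then show ?thesis
    by (simp add: integral_uniform_count_measure lessThan_atLeast0)
qed

lemma cocycle_add: "cocycle f A (m + n) x = cocycle f A m ((f ^^ n) x) ** cocycle f A n x"
  by (induction m) (auto simp: matrix_mul_assoc funpow_add)

text \<open>
  The lower bound for the volume growth over one period, obtained from the growth rates of single
  vectors on each Oseledets subspace of the orbit.
\<close>

lemma periodic_det_ge:
  fixes A :: "'a \<Rightarrow> real^'d^'d"
  assumes P: "P > 0" "(f ^^ P) p = p" and D: "spectrum_data D" and r: "\<And>i. regular_at f A D ((f ^^ i) p)"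
    and i0: "i0 \<le> num D" "\<And>i. i \<in> {1..i0} \<Longrightarrow> expo D i \<noteq> -\<infinity>"
  shows "exp (real P * (\<Sum>k=1..i0. real_of_ereal (expo D k) * real (mult D k))) \<le>
     \<bar>det (cocycle f A P p ** fast_proj D p i0 + (mat 1 - fast_proj D p i0))\<bar>"
proof -
  define T where "T = cocycle f A P p"
  have r0: "regular_at f A D p" using r[of 0] by simp
  have sub: "{1..i0} \<subseteq> {1..num D}" using i0 by auto
  have fP: "(f ^^ (n * P)) p = p" for n
    using P(2) by (induction n) (auto simp: funpow_add)
  have pow: "mat_pow T n = cocycle f A (n * P) p" for n
  proof (induction n)
    case (Suc n)
    then show ?case using cocycle_add[of f A P "n * P" p] fP[of n] by (simp add: T_def)
  qed simp
  have e: "expo D i = ereal (real_of_ereal (expo D i))" if "i \<in> {1..i0}" for i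
    using i0(2)[OF that] D sub that unfolding spectrum_data_def
    by (cases "expo D i") auto
  have com: "T ** oproj D p i = oproj D p i ** T" if "i \<in> {1..i0}" for i
  proof -
    have "T ** sum (oproj D p) {i} = sum (oproj D ((f ^^ P) p)) {i} ** T"
      unfolding T_def using that sub by (intro oproj_sum_cocycle[OF r]) auto
    then show ?thesis using P by simp
  qed
  have "exp (\<Sum>k\<in>{1..i0}. (real P * real_of_ereal (expo D k)) * real (dim (rng (oproj D p k)))) \<le>
     \<bar>det (T ** fast_proj D p i0 + (mat 1 - fast_proj D p i0))\<bar>"
  proof (rule proj_family_abs_det_ge[OF oproj_family[OF r0] sub com])
    fix i v b assume i: "i \<in> {1..i0}" and v: "v \<noteq> 0" "oproj D p i *v v = v"
      and b: "b < real P * real_of_ereal (expo D i)"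
    have i': "i \<in> {1..num D}" using i sub by auto
    have "v \<in> space_at D i p" using v range_oproj[OF r0 i'] by (metis rangeI)
    then have l: "(\<lambda>n. ereal (1 / real n) * elog (norm (cocycle f A n p *v v))) \<longlonglongrightarrow> expo D i"
      using r0 i' v by (auto simp: regular_at_def)
    have "ereal (b / real P) < expo D i"
      using b P by (subst e[OF i]) (simp add: field_simps)
    from rate_lower[OF l this]
    have "eventually (\<lambda>n. exp (real n * (b / real P)) \<le> norm (cocycle f A n p *v v)) sequentially" by simp
    moreover have "filterlim (\<lambda>n. n * P) at_top sequentially"
      using P(1) by (intro filterlim_at_top_mono[OF filterlim_ident]) (auto intro: always_eventually)
    ultimately have "eventually (\<lambda>n. exp (real (n * P) * (b / real P)) \<le> norm (cocycle f A (n * P) p *v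
        v)) sequentially"
      by (rule eventually_compose_filterlim)
    then show "eventually (\<lambda>n. exp (real n * b) \<le> norm (mat_pow T n *v v)) sequentially"
      using P(1) by (simp add: pow)
  qed
  also have "(\<Sum>k\<in>{1..i0}. (real P * real_of_ereal (expo D k)) * real (dim (rng (oproj D p k)))) =
      real P * (\<Sum>k=1..i0. real_of_ereal (expo D k) * real (mult D k))"
    unfolding sum_distrib_left
  proof (rule sum.cong)
    fix k assume "k \<in> {1..i0}"
    then have k: "k \<in> {1..num D}" using sub by auto
    have "dim (rng (oproj D p k)) = mult D k"
      using range_oproj[OF r0 k] r0 k unfolding regular_at_def by auto
    then show "(real P * real_of_ereal (expo D k)) * real (dim (rng (oproj D p k))) =
        real P * (real_of_ereal (expo D k) * real (mult D k))" by simp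
  qed simp
  finally show ?thesis by (simp add: T_def)
qed

section \<open>The subspaces of the orbit that are matched with the splitting\<close>

lemma span_Union_spaces:
  assumes r: "regular_at f A D x" and I: "I \<subseteq> {1..num D}"
  shows "span (\<Union>i\<in>I. space_at D i x) = rng (sum (oproj D x) I)"
proof
  note q = oproj_family[OF r]
  have fin: "finite I" using I finite_subset by blast
  show "span (\<Union>i\<in>I. space_at D i x) \<subseteq> rng (sum (oproj D x) I)"
  proof (rule span_minimal[OF _ subspace_range_matrix], safe)
    fix i v assume i: "i \<in> I" "v \<in> space_at D i x"
    have i': "i \<in> {1..num D}" using i I by auto
    have "sum (oproj D x) I ** oproj D x i = oproj D x i"
      using proj_family_sum_mult[OF q I, of "{i}"] i i' by simp
    moreover obtain u where "v = oproj D x i *v u" using i range_oproj[OF r i'] by blast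
    ultimately have "v = sum (oproj D x) I *v v" by (simp add: matrix_vector_mul_assoc)
    then show "v \<in> rng (sum (oproj D x) I)" by (metis rangeI)
  qed
  show "rng (sum (oproj D x) I) \<subseteq> span (\<Union>i\<in>I. space_at D i x)"
  proof safe
    fix v
    show "sum (oproj D x) I *v v \<in> span (\<Union>i\<in>I. space_at D i x)"
      unfolding matrix_sum_vector
    proof (rule span_sum)
      fix i assume i: "i \<in> I"
      then have "oproj D x i *v v \<in> space_at D i x" using range_oproj[OF r] I by blast
      then show "oproj D x i *v v \<in> span (\<Union>i\<in>I. space_at D i x)" using i by (auto intro: span_base)
    qed
  qed
qed

text \<open>
  The number of Oseledets subspaces of the periodic orbit that correspond to the first \<open>j\<close>
  Oseledets subspaces of \<open>\<mu>\<close>.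
\<close>

definition cut_index :: "('a, 'd::finite) oseledets_data \<Rightarrow> ('a, 'd) oseledets_data \<Rightarrow> nat \<Rightarrow> nat" where
  "cut_index D D' j = (if j = 0 then 0 else idx D' (csum D j))"

text \<open>
  If the exponents of the orbit are strictly separated wherever a block of \<open>\<mu>\<close> ends, then none of
  its Oseledets subspaces straddles two blocks, and the dimensions of the cuts agree.
\<close>

lemma cut_index_props:
  fixes D D' :: "('a, 'd::finite) oseledets_data"
  assumes D: "spectrum_data D" "csum D (num D) = CARD('d)" and D': "spectrum_data D'" "csum D' (num D')
      = CARD('d)"
    and gap: "\<And>j. j \<in> {1..<num D} \<Longrightarrow> lyap D' (csum D j + 1) < lyap D' (csum D j)"
    and j: "j \<le> num D"
  shows "cut_index D D' j \<le> num D'" "csum D' (cut_index D D' j) = csum D j"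
proof -
  have "cut_index D D' j \<le> num D' \<and> csum D' (cut_index D D' j) = csum D j"
  proof (cases "j = 0")
    case True then show ?thesis by (simp add: cut_index_def)
  next
    case False
    define c where "c = csum D j"
    have c: "1 \<le> c" "c \<le> CARD('d)"
      using csum_strict[OF D(1), of 0 j] csum_mono[OF j, of D] D False j by (auto simp: c_def)
    note ip = idx_props[of c D' "num D'", unfolded D'(2), OF c]
    have "csum D' (idx D' c) = c"
    proof (cases "j = num D")
      case True
      then show ?thesis using ip(2,4) D(2) csum_mono[OF ip(2), of D'] D'(2) by (simp add: c_def)
    next
      case F2: False
      have jl: "j \<in> {1..<num D}" using F2 False j by auto
      have "idx D' (c + 1) \<noteq> idx D' c"
        using gap[OF jl] by (auto simp: lyap_idx c_def)
      moreover have "idx D' (c + 1) = idx D' c" if "c < csum D' (idx D' c)"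
        using idx_eqI[of D' "idx D' c - 1" "c + 1"] ip that by simp
      ultimately show ?thesis using ip(4) by linarith
    qed
    then show ?thesis using ip False by (simp add: cut_index_def c_def)
  qed
  then show "cut_index D D' j \<le> num D'" "csum D' (cut_index D D' j) = csum D j" by auto
qed

lemma matched_space_eq:
  fixes D D' :: "('a, 'd::finite) oseledets_data"
  assumes D: "spectrum_data D" "csum D (num D) = CARD('d)" and D': "spectrum_data D'"
    and r: "regular_at f A D' q"
    and gap: "\<And>j. j \<in> {1..<num D} \<Longrightarrow> lyap D' (csum D j + 1) < lyap D' (csum D j)"
    and j: "j \<in> {1..num D}"
  shows "matched_space D D' j q = rng (sum (oproj D' q) {cut_index D D' (j - 1)<..cut_index D D' j})"
proof -
  have cd: "csum D' (num D') = CARD('d)" by (rule csum_num[OF r])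
  note cp = cut_index_props[OF D D' cd gap]
  have c1: "cut_index D D' (j - 1) \<le> num D'" "csum D' (cut_index D D' (j - 1)) = csum D (j - 1)"
    and c2: "cut_index D D' j \<le> num D'" "csum D' (cut_index D D' j) = csum D j"
        using cp[of "j - 1"] cp[of j] j by auto
  have blk: "block D j = {csum D (j - 1)<..csum D j}"
  proof -
    have "{1..<j} = {1..j - 1}" using j by auto
    then show ?thesis by (auto simp: block_def csum_def)
  qed
  have seteq: "{i \<in> {1..num D'}. \<exists>r\<in>block D j. expo D' i = lyap D' r}
      = {cut_index D D' (j - 1)<..cut_index D D' j}" (is "?L = ?R")
  proof (intro set_eqI iffI)
    fix i assume "i \<in> ?L"
    then obtain r where i: "i \<in> {1..num D'}" and r: "csum D (j - 1) < r" "r \<le> csum D j" "expo D' i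
        = lyap D' r"
      by (auto simp: blk)
    have "csum D j \<le> CARD('d)" using csum_mono[of j "num D" D] j D by auto
    then have r1: "1 \<le> r" "r \<le> csum D' (num D')" using r cd by auto
    note ip = idx_props[OF r1]
    have "i = idx D' r" using expo_inj[OF D' i, of "idx D' r"] ip r(3) by (simp add: lyap_idx)
    moreover have "idx D' r \<le> cut_index D D' j" using idx_le_iff[OF r1] r c2 by simp
    moreover have "\<not> idx D' r \<le> cut_index D D' (j - 1)" using idx_le_iff[OF r1] r c1 by simp
    ultimately show "i \<in> ?R" by simp
  next
    fix i assume i: "i \<in> ?R"
    define r where "r = csum D' i"
    have i': "1 \<le> i" "i \<le> num D'" using i c2 by auto
    have "csum D' (i - 1) < csum D' i" using csum_strict[OF D', of "i - 1" i] i' by auto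
    then have ir: "idx D' r = i" using idx_eqI[of D' "i - 1" r] i' by (simp add: r_def)
    have "csum D (j - 1) < r"
      using csum_strict[OF D', of "cut_index D D' (j - 1)" i] i i' c1 by (simp add: r_def)
    moreover have "r \<le> csum D j" using csum_mono[of i "cut_index D D' j" D'] i c2 by (simp add: r_def)
    ultimately show "i \<in> ?L" using i' ir by (auto simp: blk lyap_idx intro!: bexI[of _ r])
  qed
  show ?thesis unfolding matched_space_def seteq
    by (rule span_Union_spaces[OF r]) (use c2 in auto)
qed

section \<open>Fast and slow spaces at most orbit points\<close>

text \<open>
  The counting argument in a form that serves the products and their transposes alike: \<open>Y i\<close> are the
  good points whose orbit segment the \<open>i\<close>-th block follows.
\<close>

lemma most_blocks_close:
  fixes T :: "nat \<Rightarrow> real^'n^'n" and T0 R :: "'y \<Rightarrow> real^'n^'n" and Kf :: "'y \<Rightarrow> nat \<Rightarrow> real^'n^'n"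
  assumes n: "n > 0" and per: "\<And>i. h (i + P) = h i" and s0: "real P * s0 \<le> (\<Sum>i<P. h i)"
    and W: "\<And>i. subspace (W i) \<and> subspace (W' i) \<and> dim (W i) = m \<and> dim (W' i) = m"
    and TW: "\<And>i w. w \<in> W i \<Longrightarrow> T i *v w \<in> W' i"
    and v: "\<And>i. vol (T i) (W i) (W' i) = exp (\<Sum>t<n. h (i + t))"
    and M: "\<And>i. norm (T i) \<le> M ^ n" "M \<ge> 1" "fact CARD('n) * M ^ CARD('n) \<le> exp K"
    and Y: "\<And>i y k. y \<in> Y i \<Longrightarrow> k \<in> {1..m} \<Longrightarrow> Kf y k ** Kf y k = Kf y k \<and>
       CARD('n) + 1 \<le> dim (rng (Kf y k)) + k \<and> norm (T0 y ** Kf y k) \<le> exp (real n * b k)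
           \<and> \<theta> \<le> exp (real n * b k)"
    and YT: "\<And>i y. y \<in> Y i \<Longrightarrow> norm (T i - T0 y) \<le> \<theta>"
    and YR: "\<And>i y. y \<in> Y i \<Longrightarrow> norm (R y ** T0 y) \<le> exp (real n * c) \<and> norm (R y) * \<theta> \<le> exp (real n * c)"
    and s1: "s1 = (\<Sum>k=1..m. b k) + E" "fact CARD('n) * 2 ^ CARD('n) \<le> exp (real n * E)" "s1 \<le> K"
    and few: "real (card {i. i < P \<and> Y i = {}}) \<le> \<kappa> * real P"
  shows "\<exists>B\<subseteq>{..<P}. \<rho> * real (card B) \<le> real P * (s1 - s0 + \<kappa> * (K - s1)) \<and>
     (\<forall>i<P. i \<notin> B \<longrightarrow> (\<forall>y\<in>Y i. \<forall>w\<in>W' i. norm (R y *v w) \<le>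
        fact CARD('n) * 2 ^ (CARD('n) + 1) * exp (real n * (c + (\<Sum>k\<in>{1..<m}. b k) - (s1 - \<rho>))) * norm w))"
proof -
  have mn: "m \<le> CARD('n)" using W[of 0] by (metis dim_subset_UNIV_cart)
  define Ok where "Ok = {i. Y i \<noteq> {}}"
  define B where "B = {i. i < P \<and> i \<in> Ok \<and> (\<Sum>t<n. h (i + t)) < real n * (s1 - \<rho>)}"
  have "\<rho> * real (card B) \<le> real P * (s1 - s0 + \<kappa> * (K - s1))"
    unfolding B_def
  proof (rule card_low_block_sums_le[OF n per s0 _ _ s1(3)])
    fix i assume "i \<in> Ok"
    then obtain y where y: "y \<in> Y i" by (auto simp: Ok_def)
    have "vol (T i) (W i) (W' i) \<le> fact CARD('n) * 2 ^ m * exp (real n * (\<Sum>k=1..m. b k))"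
      by (rule block_volume_le[where K="Kf y" and ?T0.0="T0 y" and \<theta>=\<theta>])
        (use W[of i] TW[of _ i] Y[OF y] YT[OF y] in auto)
    also have "\<dots> \<le> (fact CARD('n) * 2 ^ CARD('n)) * exp (real n * (\<Sum>k=1..m. b k))"
      using mn by (intro mult_right_mono mult_left_mono power_increasing) auto
    also have "\<dots> \<le> exp (real n * E) * exp (real n * (\<Sum>k=1..m. b k))"
      using s1(2) by (intro mult_right_mono) auto
    also have "\<dots> = exp (real n * s1)" unfolding s1(1) by (simp add: exp_add [symmetric] algebra_simps)
    finally show "(\<Sum>t<n. h (i + t)) \<le> real n * s1" by (simp add: v)
  next
    fix i
    have "vol (T i) (W i) (W' i) \<le> fact CARD('n) * (\<Prod>k=1..m. M ^ n)"
    proof (rule vol_le_flag[where H="\<lambda>_. UNIV"])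
      show "norm (T i *v w) \<le> M ^ n * norm w" for w
        using norm_matrix_vector_mult_le[of "T i" w] M(1)[of i]
            by (meson mult_right_mono norm_ge_zero order_trans)
      show "subspace (UNIV :: (real^'n) set) \<and> CARD('n) + 1 \<le> dim (UNIV :: (real^'n) set) + k"
          if "k \<in> {1..m}" for k
        using that by auto
    qed (use W[of i] TW[of _ i] in auto)
    also have "(\<Prod>k=1..m. M ^ n) = (M ^ m) ^ n" by (simp add: power_mult [symmetric] mult.commute)
    also have "fact CARD('n) * (M ^ m) ^ n \<le> (fact CARD('n)) ^ n * (M ^ CARD('n)) ^ n"
      using n M(2) mn by (intro mult_mono power_mono power_increasing self_le_power) auto
    also have "\<dots> = (fact CARD('n) * M ^ CARD('n)) ^ n" by (simp add: power_mult_distrib)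
    also have "\<dots> \<le> exp K ^ n" using M by (intro power_mono) auto
    also have "\<dots> = exp (real n * K)" by (simp add: exp_of_nat_mult)
    finally show "(\<Sum>t<n. h (i + t)) \<le> real n * K" by (simp add: v)
  next
    show "real (card {i. i < P \<and> i \<notin> Ok}) \<le> \<kappa> * real P" using few by (simp add: Ok_def)
  qed
  moreover have "norm (R y *v w) \<le> fact CARD('n) * 2 ^ (CARD('n) + 1) * exp (real n * (c
      + (\<Sum>k\<in>{1..<m}. b k) - (s1 - \<rho>))) * norm w"
    if i: "i < P" "i \<notin> B" and y: "y \<in> Y i" and w: "w \<in> W' i" for i y w
  proof -
    have lo: "exp (real n * (s1 - \<rho>)) \<le> vol (T i) (W i) (W' i)"
      using i y by (auto simp: B_def Ok_def v not_less)
    have "norm (R y *v w) \<le> fact CARD('n) * 2 ^ (m + 1) * exp (real n * (c + (\<Sum>k\<in>{1..<m}. b k) - (s1 -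
        \<rho>))) * norm w"
      by (rule block_close[where K="Kf y" and ?T0.0="T0 y" and \<theta>=\<theta> and W="W i" and W'="W' i" and T="T i"])
        (use W[of i] TW[of _ i] Y[OF y] YT[OF y] YR[OF y] lo w in auto)
    also have "\<dots> \<le> fact CARD('n) * 2 ^ (CARD('n) + 1) * exp (real n * (c + (\<Sum>k\<in>{1..<m}. b k) - (s1 -
        \<rho>))) * norm w"
      using mn by (intro mult_right_mono mult_left_mono power_increasing) auto
    finally show ?thesis .
  qed
  ultimately show ?thesis by (intro exI[of _ B]) (auto simp: B_def)
qed

text \<open>
  The points at which the upper bounds hold at time \<open>n\<close>, with the rate \<open>a j\<close> on the \<open>j\<close>-th slow
  space. The norms of the projections are controlled at both ends of the orbit segment, since the
  primal estimate is read off at its end and the dual one at its beginning.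
\<close>

definition good_set :: "('a \<Rightarrow> 'a) \<Rightarrow> ('a \<Rightarrow> real^'d^'d) \<Rightarrow> ('a, 'd::finite) oseledets_data \<Rightarrow> (nat \<Rightarrow> real) \<Rightarrow>
    real \<Rightarrow> nat \<Rightarrow> 'a set" where
  "good_set f A D a C n = {y. (\<forall>i. regular_at f A D ((f ^^ i) y)) \<and>
     (\<forall>j\<in>{1..num D}. norm (cocycle f A n y ** slow_proj D y j) \<le> exp (real n * a j)) \<and>
     (\<forall>j\<le>num D. norm (mat 1 - fast_proj D y j) \<le> C \<and>
        norm (mat 1 - fast_proj D ((f ^^ n) y) j) \<le> C)}"

lemma proj_family_tail:
  assumes "proj_family l q" "j0 < l" shows "mat 1 - sum q {1..j0} = sum q {Suc j0..l}"
proof -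
  have "{1..l} - {1..j0} = {Suc j0..l}" using assms by auto
  then show ?thesis using proj_family_compl[OF assms(1), of "{1..j0}"] assms(2) by auto
qed

text \<open>
  The flag of the primal estimate consists of the slow spaces at \<open>y\<close>, and \<open>R\<close> is the slow projection
  at \<open>f\<^sup>n(y)\<close>. In the dual estimate the flag consists of the annihilators at \<open>f\<^sup>n(y)\<close>
  of the sums of the first Oseledets subspaces, and \<open>R\<close> is the transposed slow projection at \<open>y\<close>.
  In both cases equivariance reduces the norms to those of \<open>A\<^sup>n(y)\<close> on the slow spaces at \<open>y\<close>.
\<close>

lemma cut_estimate:
  fixes f :: "'a::metric_space \<Rightarrow> 'a" and A :: "'a \<Rightarrow> real^'d^'d"
  assumes p: "periodic_point f p" and D: "spectrum_data D" and cD: "csum D (num D) = CARD('d)"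
    and D': "spectrum_data D'" and r': "\<And>i. regular_at f A D' ((f ^^ i) p)"
    and j0: "j0 \<in> {1..<num D}" and i0: "i0 \<le> num D'" "csum D' i0 = csum D j0" "\<And>i. i \<in> {1..i0}
        \<Longrightarrow> expo D' i \<noteq> -\<infinity>"
    and n: "n > 0" and M: "\<And>x. norm (cocycle f A n x) \<le> M ^ n" "M \<ge> 1" "fact CARD('d) * M ^ CARD('d)
        \<le> exp K"
    and Y: "Y \<subseteq> good_set f A D a C n"
    and \<theta>: "\<And>j. j \<in> {1..num D} \<Longrightarrow> \<theta> \<le> exp (real n * a j) \<and> C * \<theta> \<le> exp (real n * a j)" "0 \<le> \<theta>"
    and r: "\<And>y q. y \<in> Y \<Longrightarrow> dist y q < r \<Longrightarrow> norm (cocycle f A n q - cocycle f A n y) \<le> \<theta>"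
    and few: "real (card {i. i < period f p \<and> \<not> (\<exists>y\<in>Y. dist y ((f ^^ i) p) < r)}) \<le> \<kappa> * real (period f p)"
    and s1: "s1 = (\<Sum>i=1..csum D j0. a (idx D i)) + E" "fact CARD('d) * 2 ^ CARD('d)
        \<le> exp (real n * E)" "0 \<le> E" "s1 \<le> K"
    and s0: "s0 = (\<Sum>i=1..csum D j0. real_of_ereal (lyap D' i))"
    and \<eta>: "\<eta> = fact CARD('d) * 2 ^ (CARD('d) + 1) * exp (real n * (a (Suc j0) - a j0 + \<rho>))"
  shows "\<exists>B\<subseteq>{..<period f p}. \<rho> * real (card B) \<le> real (period f p) * (s1 - s0 + \<kappa> * (K - s1)) \<and>
     (\<forall>i<period f p. i \<notin> B \<longrightarrow> (\<forall>y\<in>Y. dist y ((f ^^ i) p) < r \<longrightarrow>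
        (small_on \<eta> (mat 1 - fast_proj D ((f ^^ n) y) j0) (rng (fast_proj D' ((f ^^ (i
            + n)) p) i0)))))" (is ?primal)
    and "\<exists>B\<subseteq>{..<period f p}. \<rho> * real (card B) \<le> real (period f p) * (s1 - s0 + \<kappa> * (K - s1)) \<and>
     (\<forall>i<period f p. i \<notin> B \<longrightarrow> (\<forall>y\<in>Y. dist y ((f ^^ i) p) < r \<longrightarrow>
        (small_on \<eta> (transpose (mat 1 - fast_proj D y j0)) (rng (transpose (fast_proj D' ((f ^^ i) p)
            i0))))))" (is ?dual)
proof -
  define P where "P = period f p"
  have P: "P > 0" "(f ^^ P) p = p" using period_props[OF p] by (auto simp: P_def)
  define m where "m = csum D j0"
  define al where "al i = A ((f ^^ i) p)" for i
  define Q where "Q i = fast_proj D' ((f ^^ i) p) i0" for i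
  define b where "b i = a (idx D i)" for i
  have per: "(f ^^ (i + P)) p = (f ^^ i) p" for i using P by (simp add: funpow_add)
  have sub: "{1..i0} \<subseteq> {1..num D'}" using i0 by auto
  have Q: "Q i ** Q i = Q i" for i
    unfolding Q_def by (rule proj_family_idem[OF oproj_family[OF r'] sub])
  have dQ: "dim (rng (Q i)) = m" for i
    unfolding Q_def using dim_oproj_sum[OF r' sub] i0(2) by (simp add: csum_def m_def)
  have eq: "al i ** Q i = Q (Suc i) ** al i" for i
    unfolding al_def Q_def using oproj_sum_equivariant[OF r'[of i] _ sub] r'[of "Suc i"] by simp
  have cs: "cocycle f A n ((f ^^ i) p) = seqprod al i n" for i n
    unfolding al_def by (rule cocycle_eq_seqprod)
  have s0': "(\<Sum>k=1..i0. real_of_ereal (expo D' k) * real (mult D' k)) = s0"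
    using sum_lyap_csum[OF D' i0(1)] i0(2) by (simp add: s0)
  have det: "exp (real P * s0) \<le> \<bar>det (seqprod al 0 P ** Q 0 + (mat 1 - Q 0))\<bar>"
    using periodic_det_ge[OF P D' r' i0(1,3)] cs[of P 0] unfolding s0' by (simp add: Q_def)
  have perQ: "al (i + P) = al i" "Q (i + P) = Q i" for i by (simp_all add: al_def Q_def per)
  note growth = periodic_volume_growth[of P al Q m, OF P(1) perQ Q dQ eq det]
  have mpos: "m \<ge> 1" using csum_strict[OF D, of 0 j0] j0 by (auto simp: m_def)
  have mle: "m \<le> CARD('d)" using csum_mono[of j0 "num D" D] j0 cD by (auto simp: m_def)
  have bm: "b m = a j0"
  proof -
    have "csum D (j0 - 1) < m" using csum_strict[OF D, of "j0 - 1" j0] j0 by (auto simp: m_def)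
    then have "idx D m = Suc (j0 - 1)" using j0 by (intro idx_eqI) (auto simp: m_def)
    then show ?thesis using j0 by (simp add: b_def)
  qed
  have sb: "(\<Sum>k=1..m. b k) = (\<Sum>k\<in>{1..<m}. b k) + a j0"
  proof -
    have "{1..m} = insert m {1..<m}" using mpos by auto
    then show ?thesis using bm by simp
  qed
  have s1': "s1 = (\<Sum>k=1..m. b k) + E" using s1(1) by (simp add: m_def b_def)
  have etale: "fact CARD('d) * 2 ^ (CARD('d) + 1) * exp (real n * (a (Suc j0) + (\<Sum>k\<in>{1..<m}. b k) - (s1
      - \<rho>))) \<le> \<eta>"
    unfolding \<eta> s1' sb using s1(3) by (intro mult_left_mono) (auto intro: mult_left_mono)
  have fl: "slow_proj D y (idx D k) ** slow_proj D y (idx D k) = slow_proj D y (idx D k)"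
      "CARD('d) + 1 \<le> dim (rng (slow_proj D y (idx D k))) + k"
      "idx D k \<in> {1..num D}" if "regular_at f A D y" "k \<in> {1..m}" for y k
    using regular_flag[OF that(1), of k] that(2) mle by auto
  have reg: "regular_at f A D ((f ^^ i) y)" if "y \<in> Y" for y i using Y that by (auto simp: good_set_def)
  have reg0: "regular_at f A D y" if "y \<in> Y" for y using reg[OF that, of 0] by simp
  have gb: "norm (cocycle f A n y ** slow_proj D y j) \<le> exp (real n * a j)"
    if "y \<in> Y" "j \<in> {1..num D}" for y j using Y that by (auto simp: good_set_def)
  have tail: "mat 1 - fast_proj D y j0 = slow_proj D y (Suc j0)" if "regular_at f A D y" for y
    by (rule proj_family_tail[OF oproj_family[OF that]]) (use j0 in auto)
  have sc: "cocycle f A n y ** slow_proj D y j = slow_proj D ((f ^^ n) y) j ** cocycle f A n y"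
    if "y \<in> Y" "j \<in> {1..num D}" for y j
    by (rule oproj_sum_cocycle[OF reg[OF that(1)]]) (use that in auto)
  have Sj: "Suc j0 \<in> {1..num D}" using j0 by auto
  have CY: "norm (mat 1 - fast_proj D y j0) \<le> C \<and> norm (mat 1 - fast_proj D ((f ^^ n) y) j0) \<le> C"
    if "y \<in> Y" for y using Y that j0 by (auto simp: good_set_def)
  define Yi where "Yi i = {y \<in> Y. dist y ((f ^^ i) p) < r}" for i
  have fewY: "real (card {i. i < P \<and> Yi i = {}}) \<le> \<kappa> * real P"
    using few unfolding Yi_def P_def [symmetric]
        by (simp add: disjoint_iff Collect_conv_if2 empty_iff Bex_def) 
  show ?primal
  proof -
    obtain h where h: "\<And>i. h (i + P) = h i" "real P * s0 \<le> (\<Sum>i<P. h i)"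
      "\<And>i n. vol (seqprod al i n) (rng (Q i)) (rng (Q (i + n))) = exp (\<Sum>t<n. h (i + t))"
      using growth(1) by auto
    have "\<exists>B\<subseteq>{..<P}. \<rho> * real (card B) \<le> real P * (s1 - s0 + \<kappa> * (K - s1)) \<and>
     (\<forall>i<P. i \<notin> B \<longrightarrow> (\<forall>y\<in>Yi i. \<forall>w\<in>rng (Q (i + n)). norm ((mat 1 - fast_proj D ((f ^^ n) y) j0) *v w) \<le>
        fact CARD('d) * 2 ^ (CARD('d) + 1) * exp (real n * (a (Suc j0) + (\<Sum>k\<in>{1..<m}. b k) - (s1 - \<rho>)))
            * norm w))"
    proof (rule most_blocks_close[where T="\<lambda>i. seqprod al i n" and ?T0.0="\<lambda>y. cocycle f A n y"
          and Kf="\<lambda>y k. slow_proj D y (idx D k)" and W="\<lambda>i. rng (Q i)" and M=M and \<theta>=\<theta>, OF n h(1,2)])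
      show "seqprod al i n *v w \<in> rng (Q (i + n))" if "w \<in> rng (Q i)" for i w
        by (rule equivariant_maps_range[OF seqprod_equivariant[of al Q, OF eq] that])
      show "norm (seqprod al i n) \<le> M ^ n" for i using M(1) cs by metis
      fix i y assume y: "y \<in> Yi i"
      then have yY: "y \<in> Y" "dist y ((f ^^ i) p) < r" by (auto simp: Yi_def)
      show "norm (seqprod al i n - cocycle f A n y) \<le> \<theta>" using r[OF yY] cs by simp
      have "(mat 1 - fast_proj D ((f ^^ n) y) j0) ** cocycle f A n y = cocycle f A n y ** slow_proj D y
          (Suc j0)"
        unfolding tail[OF reg[OF yY(1)]] using sc[OF yY(1) Sj] by simp
      moreover have "norm (mat 1 - fast_proj D ((f ^^ n) y) j0) * \<theta> \<le> C * \<theta>"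
        using CY[OF yY(1)] \<theta>(2) by (intro mult_right_mono) auto
      ultimately show "norm ((mat 1 - fast_proj D ((f ^^ n) y) j0) ** cocycle f A n y)
          \<le> exp (real n * a (Suc j0)) \<and>
         norm (mat 1 - fast_proj D ((f ^^ n) y) j0) * \<theta> \<le> exp (real n * a (Suc j0))"
        using gb[OF yY(1) Sj] \<theta>(1)[OF Sj] by simp
      fix k assume k: "k \<in> {1..m}"
      show "slow_proj D y (idx D k) ** slow_proj D y (idx D k) = slow_proj D y (idx D k) \<and>
       CARD('d) + 1 \<le> dim (rng (slow_proj D y (idx D k))) + k \<and>
       norm (cocycle f A n y ** slow_proj D y (idx D k)) \<le> exp (real n * b k) \<and> \<theta> \<le> exp (real n * b k)"
        using fl[OF reg0[OF yY(1)] k] gb[OF yY(1)] \<theta>(1) by (auto simp: b_def)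
    qed (use h(3) M s1 s1' fewY in \<open>auto simp: subspace_range_matrix dQ\<close>)
    then obtain B where B: "B\<subseteq>{..<P}" "\<rho> * real (card B) \<le> real P * (s1 - s0 + \<kappa> * (K - s1))"
     "\<And>i y w. i < P \<Longrightarrow> i \<notin> B \<Longrightarrow> y\<in>Yi i \<Longrightarrow> w\<in>rng (Q (i + n)) \<Longrightarrow> norm ((mat 1 - fast_proj D ((f ^^ n) y) j0)
         *v w) \<le>
        fact CARD('d) * 2 ^ (CARD('d) + 1) * exp (real n * (a (Suc j0) + (\<Sum>k\<in>{1..<m}. b k) - (s1 - \<rho>)))
            * norm w"
      by blast
    show ?thesis
    proof (intro exI[of _ B] conjI allI impI ballI)
      fix i y w assume i: "i < period f p" "i \<notin> B" "y \<in> Y" "dist y ((f ^^ i) p) < r"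
        "w \<in> rng (fast_proj D' ((f ^^ (i + n)) p) i0)"
      have "norm ((mat 1 - fast_proj D ((f ^^ n) y) j0) *v w) \<le>
        fact CARD('d) * 2 ^ (CARD('d) + 1) * exp (real n * (a (Suc j0) + (\<Sum>k\<in>{1..<m}. b k) - (s1 - \<rho>)))
            * norm w"
        by (rule B(3)[of i]) (use i in \<open>auto simp: P_def Yi_def Q_def\<close>)
      also have "\<dots> \<le> \<eta> * norm w" using etale by (rule mult_right_mono) simp
      finally show "norm ((mat 1 - fast_proj D ((f ^^ n) y) j0) *v w) \<le> \<eta> * norm w" .
    qed (use B in \<open>auto simp: P_def\<close>)
  qed
  show ?dual
  proof -
    obtain h where h: "\<And>i. h (i + P) = h i" "real P * s0 \<le> (\<Sum>i<P. h i)"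
      "\<And>i n. vol (transpose (seqprod al i n)) (rng (transpose (Q (i + n)))) (rng (transpose (Q i)))
          = exp (\<Sum>t<n. h (i + t))"
      using growth(2) by auto
    have "\<exists>B\<subseteq>{..<P}. \<rho> * real (card B) \<le> real P * (s1 - s0 + \<kappa> * (K - s1)) \<and>
     (\<forall>i<P. i \<notin> B \<longrightarrow> (\<forall>y\<in>Yi i. \<forall>w\<in>rng (transpose (Q i)). norm (transpose (mat 1 - fast_proj D y j0) *v w) \<le>
        fact CARD('d) * 2 ^ (CARD('d) + 1) * exp (real n * (a (Suc j0) + (\<Sum>k\<in>{1..<m}. b k) - (s1 - \<rho>)))
            * norm w))"
    proof (rule most_blocks_close[where T="\<lambda>i. transpose (seqprod al i n)" and ?T0.0="\<lambda>y. transpose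
        (cocycle f A n y)"
          and Kf="\<lambda>y k. transpose (slow_proj D ((f ^^ n) y) (idx D k))" and W="\<lambda>i. rng (transpose (Q (i
              + n)))" and M=M and \<theta>=\<theta>, OF n h(1,2)])
      show "transpose (seqprod al i n) *v w \<in> rng (transpose (Q i))"
          if "w \<in> rng (transpose (Q (i + n)))" for i w
        by (rule equivariant_maps_range[OF _ that])
          (metis seqprod_equivariant[of al Q, OF eq] matrix_transpose_mul)
      show "norm (transpose (seqprod al i n)) \<le> M ^ n" for i using M(1) cs by (metis norm_transpose_matrix)
      fix i y assume y: "y \<in> Yi i"
      then have yY: "y \<in> Y" "dist y ((f ^^ i) p) < r" by (auto simp: Yi_def)
      show "norm (transpose (seqprod al i n) - transpose (cocycle f A n y)) \<le> \<theta>" using r[OF yY] cs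
        by (simp add: transpose_diff [symmetric] norm_transpose_matrix)
      have "transpose (mat 1 - fast_proj D y j0) ** transpose (cocycle f A n y)
          = transpose (cocycle f A n y ** slow_proj D y (Suc j0))"
        unfolding tail[OF reg0[OF yY(1)]] by (simp add: matrix_transpose_mul)
      moreover have "norm (mat 1 - fast_proj D y j0) * \<theta> \<le> C * \<theta>"
        using CY[OF yY(1)] \<theta>(2) by (intro mult_right_mono) auto
      ultimately show "norm (transpose (mat 1 - fast_proj D y j0) ** transpose (cocycle f A n y))
          \<le> exp (real n * a (Suc j0)) \<and>
         norm (transpose (mat 1 - fast_proj D y j0)) * \<theta> \<le> exp (real n * a (Suc j0))"
        using gb[OF yY(1) Sj] \<theta>(1)[OF Sj] by (simp add: norm_transpose_matrix)
      fix k assume k: "k \<in> {1..m}"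
      define Z where "Z = slow_proj D ((f ^^ n) y) (idx D k)"
      note fk = fl[OF reg[OF yY(1), of n] k, folded Z_def]
      have "transpose (cocycle f A n y) ** transpose Z = transpose (cocycle f A n y ** slow_proj D y
          (idx D k))"
        unfolding sc[OF yY(1) fk(3)] Z_def by (simp add: matrix_transpose_mul)
      then have "norm (transpose (cocycle f A n y) ** transpose Z) \<le> exp (real n * b k)"
        using gb[OF yY(1) fk(3)] by (simp add: norm_transpose_matrix b_def)
      moreover have "transpose Z ** transpose Z = transpose Z" by (metis fk(1) matrix_transpose_mul)
      ultimately show "transpose Z ** transpose Z = transpose Z \<and>
       CARD('d) + 1 \<le> dim (rng (transpose Z)) + k \<and>
       norm (transpose (cocycle f A n y) ** transpose Z) \<le> exp (real n * b k) \<and> \<theta> \<le> exp (real n * b k)"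
        using fk(2) \<theta>(1)[OF fk(3)] by (simp add: b_def dim_range_transpose)
    qed (use h(3) M s1 s1' fewY in \<open>auto simp: subspace_range_matrix dQ dim_range_transpose\<close>)
    then obtain B where B: "B\<subseteq>{..<P}" "\<rho> * real (card B) \<le> real P * (s1 - s0 + \<kappa> * (K - s1))"
     "\<And>i y w. i < P \<Longrightarrow> i \<notin> B \<Longrightarrow> y\<in>Yi i \<Longrightarrow> w\<in>rng (transpose (Q i))
         \<Longrightarrow> norm (transpose (mat 1 - fast_proj D y j0) *v w) \<le>
        fact CARD('d) * 2 ^ (CARD('d) + 1) * exp (real n * (a (Suc j0) + (\<Sum>k\<in>{1..<m}. b k) - (s1 - \<rho>)))
            * norm w"
      by blast
    show ?thesis
    proof (intro exI[of _ B] conjI allI impI ballI)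
      fix i y w assume i: "i < period f p" "i \<notin> B" "y \<in> Y" "dist y ((f ^^ i) p) < r"
        "w \<in> rng (transpose (fast_proj D' ((f ^^ i) p) i0))"
      have "norm (transpose (mat 1 - fast_proj D y j0) *v w) \<le>
        fact CARD('d) * 2 ^ (CARD('d) + 1) * exp (real n * (a (Suc j0) + (\<Sum>k\<in>{1..<m}. b k) - (s1 - \<rho>)))
            * norm w"
        by (rule B(3)[of i]) (use i in \<open>auto simp: P_def Yi_def Q_def\<close>)
      also have "\<dots> \<le> \<eta> * norm w" using etale by (rule mult_right_mono) simp
      finally show "norm (transpose (mat 1 - fast_proj D y j0) *v w) \<le> \<eta> * norm w" .
    qed (use B in \<open>auto simp: P_def\<close>)
  qed
qed

text \<open>
  A vector of the matched space is almost in the fast space of \<open>x'\<close> at the upper cut by the primal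
  estimate, and almost in the slow space at the lower cut by the dual one; so \<open>oproj D x' j\<close>
  almost fixes it. The point \<open>x\<close> is another point of the cell of \<open>x'\<close>.
\<close>

lemma matched_space_close:
  fixes D D' :: "('a, 'd::finite) oseledets_data"
  assumes D: "spectrum_data D" and D': "spectrum_data D'"
    and rx: "regular_at f A D x" and rx': "regular_at f A D x'" and rq: "regular_at f A D' q"
    and gap: "\<And>j. j \<in> {1..<num D} \<Longrightarrow> lyap D' (csum D j + 1) < lyap D' (csum D j)"
    and primal: "\<And>j w. j \<in> {1..<num D} \<Longrightarrow> w \<in> rng (fast_proj D' q (cut_index D D' j)) \<Longrightarrow>
        norm ((mat 1 - fast_proj D x' j) *v w) \<le> \<eta> * norm w"
    and dual: "\<And>j w. j \<in> {1..<num D} \<Longrightarrow> w \<in> rng (transpose (fast_proj D' q (cut_index D D' j))) \<Longrightarrow>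
        norm (transpose (mat 1 - fast_proj D x' j) *v w) \<le> \<eta> * norm w"
    and C: "\<And>j. j \<le> num D \<Longrightarrow> norm (fast_proj D x' j) \<le> C"
    and xx: "\<And>j. j \<in> {1..num D} \<Longrightarrow> norm (oproj D x j - oproj D x' j) \<le> 2 * \<zeta>"
    and \<eta>: "0 \<le> \<eta>" "\<eta> \<le> 1/2" "\<eta> + 2 * \<eta> * C \<le> \<zeta>" and \<zeta>: "0 \<le> \<zeta>" "3 * \<zeta> < 1"
    and j: "j \<in> {1..num D}"
  shows "0 \<le> subspace_dist (space_at D j x) (matched_space D D' j q) \<and>
     subspace_dist (space_at D j x) (matched_space D D' j q) \<le> 3 * \<zeta> / (1 - 3 * \<zeta>)"
proof -
  have cD: "csum D (num D) = CARD('d)" "csum D' (num D') = CARD('d)"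
      using csum_num[OF rx] csum_num[OF rq] by auto
  note cp = cut_index_props[OF D cD(1) D' cD(2) gap]
  note q = oproj_family[OF rx'] and q' = oproj_family[OF rq]
  define c where "c = cut_index D D'"
  have c1: "c (j - 1) \<le> num D'" "csum D' (c (j - 1)) = csum D (j - 1)"
    and c2: "c j \<le> num D'" "csum D' (c j) = csum D j" using cp[of "j - 1"] cp[of j] j by (auto simp: c_def)
  have cle: "c (j - 1) \<le> c j"
  proof (rule ccontr)
    assume "\<not> c (j - 1) \<le> c j"
    then have "csum D (j - 1) > csum D j" using csum_strict[OF D', of "c j" "c (j - 1)"] c1 c2 by simp
    then show False using csum_mono[of "j - 1" j D] by simp
  qed
  define F where "F = sum (oproj D' q) {c (j - 1)<..c j}"
  have W: "matched_space D D' j q = rng F"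
    unfolding F_def c_def by (rule matched_space_eq[OF D cD(1) D' rq gap j])
  have sub: "{c (j - 1)<..c j} \<subseteq> {1..num D'}" using c2 by auto
  have multj: "csum D j - csum D (j - 1) = mult D j"
    using j csum_Suc[of D "j - 1"] by auto
  have dW: "dim (rng F) = mult D j"
    unfolding F_def using dim_oproj_sum[OF rq sub] by (simp only: sum_mult_interval c1 c2 multj)
  have dE: "dim (space_at D j x) = mult D j" using rx j by (auto simp: regular_at_def)
  have "1 \<le> mult D j" using D j unfolding spectrum_data_def by blast
  then have mj: "mult D j > 0" by simp
  have C0: "C \<ge> 0" using order_trans[OF norm_ge_zero C[of 0]] by simp
  have near: "norm (oproj D x j *v w - w) \<le> 3 * \<zeta> * norm w" if w: "w \<in> rng F" for w
  proof -
    have FF: "F ** F = F" unfolding F_def by (rule proj_family_idem[OF q' sub])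
    have Fw: "F *v w = w" using w mem_range_idem_iff[OF FF] by blast
    have A1: "norm ((mat 1 - fast_proj D x' j) *v w) \<le> \<eta> * norm w"
    proof (cases "j = num D")
      case True
      then have "mat 1 - fast_proj D x' j = 0" using q by (simp add: proj_family_def)
      then show ?thesis using \<eta> by simp
    next
      case False
      have "fast_proj D' q (c j) ** F = F"
        unfolding F_def using c2 proj_family_sum_mult[OF q', of "{1..c j}" "{c (j - 1)<..c j}"] sub
        by (simp add: Int_absorb1 subset_eq)
      then have "w = fast_proj D' q (c j) *v w" using Fw by (metis matrix_vector_mul_assoc)
      then have "w \<in> rng (fast_proj D' q (c j))" by (metis rangeI)
      then show ?thesis using primal[of j w] False j by (simp add: c_def)
    qed
    have A2: "norm (fast_proj D x' (j - 1) *v w) \<le> 2 * \<eta> * C * norm w"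
    proof (cases "j = 1")
      case True then show ?thesis using \<eta> C0 by simp
    next
      case False
      have j1: "j - 1 \<in> {1..<num D}" using False j by auto
      have "fast_proj D' q (c (j - 1)) ** F = 0"
        unfolding F_def using c1 sub by (subst proj_family_sum_mult[OF q']) (auto intro: sum.neutral)
      then have z: "fast_proj D' q (c (j - 1)) *v w = 0" using Fw
          by (metis matrix_vector_mul_assoc matrix_vector_mult_0)
      have "norm (fast_proj D x' (j - 1) *v w) \<le> \<eta> / (1 - \<eta>) * norm (fast_proj D x' (j - 1)) * norm w"
      proof (rule slow_space_near_of_dual[OF _ _ _ \<eta>(1) _ z])
        show "fast_proj D x' (j - 1) ** fast_proj D x' (j - 1) = fast_proj D x' (j - 1)"
          by (rule proj_family_idem[OF q]) (use j in auto)
        have "dim (rng (fast_proj D' q (c (j - 1)))) = csum D' (c (j - 1))"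
          using dim_oproj_sum[OF rq, of "{1..c (j - 1)}"] c1 by (simp add: csum_def)
        moreover have "{1..j - 1} \<subseteq> {1..num D}" using j by auto
        then have "dim (rng (fast_proj D x' (j - 1))) = csum D (j - 1)"
          using dim_oproj_sum[OF rx', of "{1..j - 1}"] by (simp add: csum_def)
        ultimately show "dim (rng (fast_proj D' q (c (j - 1)))) = dim (rng (fast_proj D x' (j - 1)))"
          using c1 by (simp only:)
        show "norm (transpose (mat 1 - fast_proj D x' (j - 1)) *v u) \<le> \<eta> * norm u"
          if "u \<in> rng (transpose (fast_proj D' q (c (j - 1))))" for u
          using dual[OF j1] that by (simp add: c_def)
      qed (use \<eta> in auto)
      also have "\<dots> \<le> (2 * \<eta>) * C * norm w"
      proof -
        have "\<eta> / (1 - \<eta>) \<le> 2 * \<eta>"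
        proof -
          have "\<eta> * 1 \<le> \<eta> * (2 * (1 - \<eta>))" using \<eta> by (intro mult_left_mono) auto
          then show ?thesis using \<eta> by (simp add: pos_divide_le_eq algebra_simps)
        qed
        then show ?thesis using \<eta> C0 C[of "j - 1"] j by (intro mult_right_mono mult_mono) auto
      qed
      finally show ?thesis .
    qed
    have "{1..j} = insert j {1..j - 1}" "j \<notin> {1..j - 1}" using j by auto
    then have "fast_proj D x' j = fast_proj D x' (j - 1) + oproj D x' j"
      by (simp only: sum.insert finite_atLeastAtMost not_False_eq_True add.commute)
    then have e: "oproj D x j *v w - w = (oproj D x j - oproj D x' j) *v w
        - (mat 1 - fast_proj D x' j) *v w - fast_proj D x' (j - 1) *v w"
      by (simp add: matrix_vector_mult_diff_rdistrib matrix_vector_mult_add_rdistrib)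
    have "norm (oproj D x j *v w - w) \<le> norm ((oproj D x j - oproj D x' j) *v w)
        + norm ((mat 1 - fast_proj D x' j) *v w) + norm (fast_proj D x' (j - 1) *v w)"
      unfolding e by (intro order_trans [OF norm_triangle_ineq4] add_right_mono norm_triangle_ineq4)
    also have "norm ((oproj D x j - oproj D x' j) *v w) \<le> 2 * \<zeta> * norm w"
      using norm_matrix_vector_mult_le[of "oproj D x j - oproj D x' j" w] mult_right_mono[OF xx[OF j],
          of "norm w"] by simp
    finally have "norm (oproj D x j *v w - w) \<le> 2 * \<zeta> * norm w + \<eta> * norm w + 2 * \<eta> * C * norm w"
      using A1 A2 by linarith
    also have "\<dots> = (2 * \<zeta> + (\<eta> + 2 * \<eta> * C)) * norm w" by (simp add: algebra_simps)
    also have "\<dots> \<le> (3 * \<zeta>) * norm w" using \<eta> by (intro mult_right_mono) auto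
    finally show ?thesis .
  qed
  show ?thesis unfolding W
  proof (rule subspace_dist_le_of_nearby[where P="oproj D x j"])
    show "subspace (space_at D j x)" using rx j by (auto simp: regular_at_def direct_sum_decomposition_def)
    show "oproj D x j *v w \<in> space_at D j x" for w using range_oproj[OF rx j] by blast
  qed (use near dW dE mj \<zeta> in \<open>auto simp: subspace_range_matrix\<close>)
qed

section \<open>Measurability of the projections\<close>

lemma bounded_bilinear_matrix_mult: "bounded_bilinear (\<lambda>(A :: real^'n^'m) (B :: real^'k^'n). A ** B)"
proof
  show "\<exists>K. \<forall>(a::real^'n^'m) (b::real^'k^'n). norm (a ** b) \<le> norm a * norm b * K"
    by (intro exI[of _ 1]) (simp add: norm_matrix_mult_le)
qed (simp_all add: matrix_add_rdistrib matrix_add_ldistrib matrix_scaleR_mult)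

lemma measurable_matrix_mult:
  fixes A :: "'x \<Rightarrow> real^'n^'m" and B :: "'x \<Rightarrow> real^'k^'n"
  assumes "A \<in> borel_measurable M" "B \<in> borel_measurable M"
  shows "(\<lambda>x. A x ** B x) \<in> borel_measurable M"
  by (rule borel_measurable_continuous_Pair[OF assms])
    (intro bounded_bilinear.continuous_on[OF bounded_bilinear_matrix_mult] continuous_intros)

lemma measurable_vec:
  fixes F :: "'x \<Rightarrow> 'b::euclidean_space^'n"
  assumes "\<And>i. (\<lambda>x. F x $ i) \<in> borel_measurable M"
  shows "F \<in> borel_measurable M"
  unfolding borel_measurable_euclidean_space[of F]
proof
  fix b :: "'b^'n" assume "b \<in> Basis"
  then obtain i u where b: "b = axis i u" by (auto simp: Basis_vec_def)
  have "(\<lambda>x. F x $ i \<bullet> u) \<in> borel_measurable M" using assms[of i] by measurable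
  then show "(\<lambda>x. F x \<bullet> b) \<in> borel_measurable M" by (simp add: b inner_axis)
qed

lemma measurable_vec_nth:
  fixes F :: "'x \<Rightarrow> 'b::euclidean_space^'n"
  assumes "F \<in> borel_measurable M" shows "(\<lambda>x. F x $ i) \<in> borel_measurable M"
  by (rule measurable_compose[OF assms]) (intro borel_measurable_continuous_onI continuous_intros)

lemma measurable_det:
  fixes F :: "'x \<Rightarrow> real^'n^'n"
  assumes "F \<in> borel_measurable M" shows "(\<lambda>x. det (F x)) \<in> borel_measurable M"
  unfolding det_def
  by (intro borel_measurable_sum borel_measurable_times borel_measurable_prod borel_measurable_const
      measurable_vec_nth assms)

text \<open>
  The inverse by Cramer's rule, an explicit rational expression in the entries.
\<close>

definition cramer_inv :: "real^'n^'n \<Rightarrow> real^'n^'n" where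
  "cramer_inv S = (\<chi> k s. det (\<chi> i j. if j = k then (axis s 1 :: real^'n) $ i else S $ i $ j) / det S)"

lemma cramer_inv: "det S \<noteq> 0 \<Longrightarrow> S ** cramer_inv S = mat 1"
proof -
  assume d: "det S \<noteq> 0"
  have "S *v column s (cramer_inv S) = axis s 1" for s
    unfolding cramer[OF d] by (simp add: column_def cramer_inv_def)
  then have "(S *v column s (cramer_inv S)) $ i = axis s 1 $ i" for s i by simp
  then show ?thesis
    by (auto simp: vec_eq_iff matrix_matrix_mult_def matrix_vector_mult_def column_def mat_def axis_def)
qed

lemma measurable_cramer_inv:
  fixes F :: "'x \<Rightarrow> real^'n^'n"
  assumes F: "F \<in> borel_measurable M" shows "(\<lambda>x. cramer_inv (F x)) \<in> borel_measurable M"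
proof (intro measurable_vec)
  fix k s :: 'n
  have "(\<lambda>x. (\<chi> i j. if j = k then (axis s 1 :: real^'n) $ i else F x $ i $ j) :: real^'n^'n) \<in>
      borel_measurable M"
  proof (intro measurable_vec)
    fix i j
    show "(\<lambda>x. (\<chi> i j. if j = k then (axis s 1 :: real^'n) $ i else F x $ i $ j) $ i $ j) \<in>
        borel_measurable M"
      by (cases "j = k") (simp_all add: measurable_vec_nth F)
  qed
  then show "(\<lambda>x. cramer_inv (F x) $ k $ s) \<in> borel_measurable M"
    unfolding cramer_inv_def vec_lambda_beta by (intro borel_measurable_divide measurable_det F)
qed

lemma orthogonal_projection_exists:
  assumes W: "subspace W"
  shows "\<exists>K::real^'n^'n. transpose K = K \<and> K ** K = K \<and> rng K = W"
proof -
  define S :: "'n set" where "S = std_index (dim W)"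
  define P :: "real^'n^'n" where "P = coord_proj S"
  define U where U: "U = frame W"
  have F: "is_frame S U W" using W is_frame_frame unfolding U S_def by metis
  have UU: "transpose U ** U = mat 1" "U ** transpose U = mat 1"
    using F by (auto simp: is_frame_def orthogonal_matrix_def)
  define K where "K = U ** P ** transpose U"
  have PP: "P ** P = P" by (simp add: P_def coord_proj_idem)
  have KU: "K ** (U ** P) = U ** P"
    using UU PP unfolding K_def by (metis matrix_mul_assoc matrix_mul_rid)
  have KK: "K ** K = K" using KU unfolding K_def by (metis matrix_mul_assoc)
  have Kt: "transpose K = K" by (simp add: K_def matrix_transpose_mul P_def transpose_coord_proj
      matrix_mul_assoc)
  have "rng K \<subseteq> W"
    using F unfolding K_def P_def is_frame_def
        by (auto simp: matrix_vector_mul_assoc [symmetric] simp del: matrix_vector_mul_assoc)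
  moreover have "W \<subseteq> rng K"
  proof
    fix w assume "w \<in> W"
    then obtain x where "w = (U ** P) *v x" using F by (auto simp: is_frame_def P_def)
    then have "w = K *v w" using KU by (simp add: matrix_vector_mul_assoc)
    then show "w \<in> rng K" by (metis rangeI)
  qed
  ultimately show ?thesis using KK Kt by blast
qed

text \<open>
  The orthogonal projection onto a subspace, recovered by polarization from the distance function
  \<open>\<delta>\<close> of the subspace, since \<open>v \<bullet> K v = \<parallel>v\<parallel>\<^sup>2 - \<delta>(v)\<^sup>2\<close>.
\<close>

definition polar_proj :: "(real^'n \<Rightarrow> real) \<Rightarrow> real^'n^'n" where
  "polar_proj \<delta> = (\<chi> r s. (norm (axis r 1 + axis s 1 :: real^'n) ^ 2 - \<delta> (axis r 1 + axis s 1) ^ 2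
      - norm (axis r 1 - axis s 1 :: real^'n) ^ 2 + \<delta> (axis r 1 - axis s 1) ^ 2) / 4)"

lemma polar_proj_infdist:
  fixes K :: "real^'n^'n"
  assumes K: "transpose K = K" "K ** K = K" and W: "rng K = W"
  shows "polar_proj (\<lambda>v. infdist v W) = K"
proof -
  have sym: "(K *v u) \<bullet> v = u \<bullet> (K *v v)" for u v using inner_transpose[of K u v] K by simp
  have KK: "K *v (K *v v) = K *v v" for v using K by (simp add: matrix_vector_mul_assoc)
  have inf: "infdist v W = norm (v - K *v v)" for v
  proof (rule antisym)
    show "infdist v W \<le> norm (v - K *v v)" using W infdist_le[of "K *v v" W v] by (auto simp: dist_norm)
    have ne: "W \<noteq> {}" using W by auto
    show "norm (v - K *v v) \<le> infdist v W"
      unfolding infdist_notempty[OF ne]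
    proof (rule cINF_greatest[OF ne])
      fix w assume "w \<in> W"
      then obtain x where w: "w = K *v x" using W by auto
      define u where "u = v - K *v v"
      have Ku: "K *v u = 0" by (simp add: u_def matrix_vector_mult_diff_distrib KK)
      have "u \<bullet> (K *v (v - x)) = 0" using sym[of u "v - x"] Ku by simp
      moreover have "v - w = u + K *v (v - x)" by (simp add: u_def w matrix_vector_mult_diff_distrib)
      ultimately have "norm (v - w) ^ 2 = norm u ^ 2 + norm (K *v (v - x)) ^ 2"
        by (simp add: power2_norm_eq_inner inner_add_left inner_add_right inner_commute)
      then have "norm u ^ 2 \<le> norm (v - w) ^ 2" by simp
      then have "norm u \<le> norm (v - w)" by (rule power2_le_imp_le) simp
      then show "norm (v - K *v v) \<le> dist v w" by (simp add: u_def dist_norm)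
    qed
  qed
  have q: "norm v ^ 2 - infdist v W ^ 2 = v \<bullet> (K *v v)" for v
  proof -
    have "norm (v - K *v v) ^ 2 = v \<bullet> v - 2 * (v \<bullet> (K *v v)) + (K *v v) \<bullet> (K *v v)"
      by (simp add: power2_norm_eq_inner inner_diff_left inner_diff_right inner_commute)
    moreover have "(K *v v) \<bullet> (K *v v) = v \<bullet> (K *v v)" using sym[of v "K *v v"] KK by simp
    ultimately show ?thesis by (simp add: inf power2_norm_eq_inner)
  qed
  have "polar_proj (\<lambda>v. infdist v W) $ r $ s = K $ r $ s" for r s
  proof -
    define e g :: "real^'n" where "e = axis r 1" and "g = axis s 1"
    have "4 * polar_proj (\<lambda>v. infdist v W) $ r $ s =
      (norm (e + g) ^ 2 - infdist (e + g) W ^ 2) - (norm (e - g) ^ 2 - infdist (e - g) W ^ 2)"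
      by (simp add: polar_proj_def e_def g_def)
    also have "\<dots> = (e + g) \<bullet> (K *v (e + g)) - (e - g) \<bullet> (K *v (e - g))" by (simp only: q)
    also have "\<dots> = 2 * (e \<bullet> (K *v g)) + 2 * (g \<bullet> (K *v e))"
      by (simp add: matrix_vector_right_distrib matrix_vector_mult_diff_distrib inner_add_left
          inner_add_right
          inner_diff_left inner_diff_right)
    also have "g \<bullet> (K *v e) = e \<bullet> (K *v g)" using sym[of g e] by (simp add: inner_commute)
    also have "e \<bullet> (K *v g) = K $ r $ s"
      by (simp add: e_def g_def matrix_vector_mult_basis inner_axis' column_def)
    finally show ?thesis by simp
  qed
  then show ?thesis by (simp add: vec_eq_iff)
qed

text \<open>
  The sum \<open>S\<close> of the orthogonal projections \<open>K\<^sub>j\<close> onto the summands is invertible. Hence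
  \<open>v = (\<Sum>j. K\<^sub>j (S\<^sup>-\<^sup>1 v))\<close>, and this is the decomposition of \<open>v\<close>. The oblique projections are
  thereby rational functions of the distance functions, which are measurable by definition.
\<close>

lemma split_proj_formula:
  fixes E :: "nat \<Rightarrow> (real^'n) set"
  assumes D: "direct_sum_decomposition l E" and i: "i \<in> {1..l}"
  defines "S \<equiv> (\<Sum>j=1..l. polar_proj (\<lambda>v. infdist v (E j)))"
  shows "split_proj l E i = polar_proj (\<lambda>v. infdist v (E i)) ** cramer_inv S"
proof -
  define K where "K j = polar_proj (\<lambda>v. infdist v (E j))" for j
  have K: "transpose (K j) = K j \<and> K j ** K j = K j \<and> rng (K j) = E j" if "j \<in> {1..l}" for j
  proof -
    have "subspace (E j)" using D that by (auto simp: direct_sum_decomposition_def)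
    then obtain k where k: "transpose k = k" "k ** k = k" "rng k = E j"
      using orthogonal_projection_exists by blast
    then have "K j = k" unfolding K_def by (rule polar_proj_infdist)
    then show ?thesis using k by simp
  qed
  have SK: "S = sum K {1..l}" by (simp add: S_def K_def)
  have "v = 0" if v: "S *v v = 0" for v
  proof -
    have pos: "(K j *v v) \<bullet> v = norm (K j *v v) ^ 2" if "j \<in> {1..l}" for j
      using inner_transpose[of "K j" "K j *v v" v] K[OF that]
      by (simp add: matrix_vector_mul_assoc power2_norm_eq_inner)
    have "0 = (S *v v) \<bullet> v" using v by simp
    also have "\<dots> = (\<Sum>j=1..l. norm (K j *v v) ^ 2)"
      unfolding SK matrix_sum_vector inner_sum_left using pos by (intro sum.cong) auto
    finally have "(\<Sum>j=1..l. norm (K j *v v) ^ 2) = 0" by simp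
    then have z: "K j *v v = 0" if "j \<in> {1..l}" for j
      using that by (subst (asm) sum_nonneg_eq_0_iff) auto
    obtain w where w: "\<forall>j\<in>{1..l}. w j \<in> E j" "v = (\<Sum>j=1..l. w j)" using direct_sum_decompose[OF D] by blast
    have "v \<bullet> w j = 0" if j: "j \<in> {1..l}" for j
    proof -
      have "w j \<in> rng (K j)" using w(1) K[OF j] j by auto
      then obtain u where "w j = K j *v u" by blast
      then have "v \<bullet> w j = (K j *v v) \<bullet> u" using inner_transpose[of "K j" v u] K[OF j] by simp
      then show ?thesis using z[OF j] by simp
    qed
    then have "v \<bullet> v = 0" using w(2) by (subst (2) w(2)) (simp add: inner_sum_right)
    then show "v = 0" by simp
  qed
  then have "invertible S" by (simp add: invertible_left_inverse matrix_left_invertible_ker)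
  then have "det S \<noteq> 0" by (simp add: invertible_det_nz)
  then have SN: "S ** cramer_inv S = mat 1" by (rule cramer_inv)
  show ?thesis unfolding matrix_eq
  proof
    fix v
    define u where "u = cramer_inv S *v v"
    have "v = S *v u" using SN by (simp add: u_def matrix_vector_mul_assoc)
    also have "\<dots> = (\<Sum>j=1..l. K j *v u)" by (simp add: SK matrix_sum_vector)
    finally have v: "v = (\<Sum>j=1..l. K j *v u)" .
    have "split_proj l E i *v (\<Sum>j=1..l. K j *v u) = K i *v u"
      by (rule split_proj_sum[OF D _ i]) (use K in blast)
    then have "split_proj l E i *v v = K i *v u" by (simp only: v [symmetric])
    then show "split_proj l E i *v v = (polar_proj (\<lambda>v. infdist v (E i)) ** cramer_inv S) *v v"
      by (simp add: K_def u_def matrix_vector_mul_assoc)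
  qed
qed

lemma splitting_spectrum_data: "oseledets_splitting f A \<mu> D \<Longrightarrow> spectrum_data D"
  unfolding oseledets_splitting_def spectrum_data_def by blast

lemma splitting_AE_regular:
  assumes "oseledets_splitting f A \<mu> D" shows "AE x in \<mu>. regular_at f A D x"
proof -
  note * = assms[unfolded oseledets_splitting_def, THEN conjunct2, THEN conjunct2, THEN conjunct2]
  show ?thesis using * by (rule eventually_mono) (unfold regular_at_def, blast)
qed

text \<open>
  The distance functions are only measurable for the completion of \<open>\<mu>\<close>. Finitely many of
  them determine the projections, so each may be replaced by a Borel function that agrees with it
  almost everywhere.
\<close>

lemma exists_borel_oproj:
  assumes \<mu>: "sets \<mu> = sets borel" and O: "oseledets_splitting f A \<mu> D"
  shows "\<exists>g. (\<forall>j\<in>{1..num D}. g j \<in> borel_measurable borel) \<and>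
     (AE x in \<mu>. regular_at f A D x \<and> (\<forall>j\<in>{1..num D}. g j x = oproj D x j))"
proof -
  have "\<exists>h. h \<in> borel_measurable \<mu> \<and> (AE x in \<mu>. infdist v (space_at D j x) = h x)"
      if "j \<in> {1..num D}" for j v
    using completion_ex_borel_measurable_real[of "\<lambda>x. infdist v (space_at D j x)" \<mu>] O that
    unfolding oseledets_splitting_def by blast
  then obtain h where h: "\<And>j v. j \<in> {1..num D} \<Longrightarrow> h j v \<in> borel_measurable \<mu>
      \<and> (AE x in \<mu>. infdist v (space_at D j x) = h j v x)"
    by metis
  define k where "k j x = polar_proj (\<lambda>v. h j v x)" for j x
  define g where "g j x = k j x ** cramer_inv (\<Sum>i=1..num D. k i x)" for j x
  have km: "k j \<in> borel_measurable borel" if "j \<in> {1..num D}" for j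
  proof (intro measurable_vec)
    fix r s :: 'b
    have [measurable]: "h j v \<in> borel_measurable borel" for v using h[OF that, of v] \<mu>
        by (metis measurable_cong_sets)
    show "(\<lambda>x. k j x $ r $ s) \<in> borel_measurable borel" unfolding k_def polar_proj_def by simp
  qed
  have gm: "g j \<in> borel_measurable borel" if "j \<in> {1..num D}" for j
    unfolding g_def using that
        by (intro measurable_matrix_mult measurable_cramer_inv borel_measurable_sum km) auto
  define V :: "(real^'b) set" where "V = (\<lambda>(r,s). axis r 1 + axis s 1) ` UNIV \<union> (\<lambda>(r,s). axis r 1 - axis
      s 1) ` UNIV"
  have "finite V" by (simp add: V_def)
  then have "AE x in \<mu>. \<forall>j\<in>{1..num D}. \<forall>v\<in>V. infdist v (space_at D j x) = h j v x"
    using h by (intro AE_finite_allI) auto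
  moreover have "AE x in \<mu>. regular_at f A D x" by (rule splitting_AE_regular[OF O])
  ultimately have "AE x in \<mu>. regular_at f A D x \<and> (\<forall>j\<in>{1..num D}. g j x = oproj D x j)"
  proof eventually_elim
    case (elim x)
    have kx: "k j x = polar_proj (\<lambda>v. infdist v (space_at D j x))" if j: "j \<in> {1..num D}" for j
    proof -
      have "infdist (axis r 1 + axis s 1) (space_at D j x) = h j (axis r 1 + axis s 1) x"
        "infdist (axis r 1 - axis s 1) (space_at D j x) = h j (axis r 1 - axis s 1) x" for r s
      proof -
        have "axis r 1 + axis s 1 \<in> V" "axis r 1 - axis s 1 \<in> V"
          unfolding V_def by (rule UnI1, rule image_eqI[of _ _ "(r, s)"], simp, simp)
            (rule UnI2, rule image_eqI[of _ _ "(r, s)"], simp, simp)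
        then show "infdist (axis r 1 + axis s 1) (space_at D j x) = h j (axis r 1 + axis s 1) x"
          "infdist (axis r 1 - axis s 1) (space_at D j x) = h j (axis r 1 - axis s 1) x"
          using elim(1) j by blast+
      qed
      then show ?thesis by (simp add: k_def polar_proj_def)
    qed
    have "g j x = oproj D x j" if j: "j \<in> {1..num D}" for j
    proof -
      have "(\<Sum>i=1..num D. k i x) = (\<Sum>i=1..num D. polar_proj (\<lambda>v. infdist v (space_at D i x)))"
        by (rule sum.cong) (auto simp: kx)
      then show ?thesis using split_proj_formula[of "num D" "\<lambda>i. space_at D i x" j] elim(2) j
        by (simp add: g_def kx oproj_def regular_at_def)
    qed
    then show ?case using elim(2) by blast
  qed
  then show ?thesis using gm by blast
qed

section \<open>Frequent visits and large good sets\<close>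

lemma measure_tendsto_0_of_AE_eventually:
  assumes "finite_measure \<mu>" and B: "\<And>n::nat. B n \<in> sets \<mu>"
    and ae: "AE x in \<mu>. eventually (\<lambda>n. x \<notin> B n) sequentially"
  shows "(\<lambda>n. measure \<mu> (B n)) \<longlonglongrightarrow> 0"
proof -
  interpret finite_measure \<mu> by fact
  have "(\<lambda>n. integral\<^sup>L \<mu> (indicator (B n) :: _ \<Rightarrow> real)) \<longlonglongrightarrow> integral\<^sup>L \<mu> (\<lambda>_. 0::real)"
  proof (rule integral_dominated_convergence[where w="\<lambda>_. 1"])
    show "AE x in \<mu>. (\<lambda>n. indicator (B n) x :: real) \<longlonglongrightarrow> 0"
      using ae
    proof eventually_elim
      case (elim x)
      then have "eventually (\<lambda>n. (indicator (B n) x :: real) = 0) sequentially"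
        by eventually_elim simp
      then show ?case by (rule tendsto_eventually)
    qed
    show "AE x in \<mu>. norm (indicator (B n) x :: real) \<le> 1" for n by (simp add: indicator_def)
  qed (use B in auto)
  then show ?thesis using B by simp
qed

text \<open>
  The half of the portmanteau theorem that concerns open sets: the indicator of \<open>U\<close> is the
  increasing limit of the continuous functions \<open>min 1 (j * infdist x (- U))\<close>.
\<close>

lemma orbit_visits_open:
  fixes f :: "'a::metric_space \<Rightarrow> 'a" and \<mu> :: "'a measure"
  assumes \<mu>: "prob_space \<mu>" "sets \<mu> = sets borel" and p: "\<And>k. periodic_point f (p k)"
    and ws: "weak_star_conv (\<lambda>k. orbit_measure f (p k)) \<mu>" and U: "open U" "c < measure \<mu> U"
  shows "eventually (\<lambda>k. c * real (period f (p k)) < real (card {i. i < period f (p k)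
      \<and> (f ^^ i) (p k) \<in> U})) sequentially"
proof -
  interpret prob_space \<mu> by fact
  have P: "period f (p k) > 0" for k using period_props[OF p] by blast
  show ?thesis
  proof (cases "U = UNIV")
    case True
    have "c < 1" using U(2) prob_le_1[of U] by linarith
    then show ?thesis using True P by (intro always_eventually) auto
  next
    case False
    define \<phi> :: "nat \<Rightarrow> 'a \<Rightarrow> real" where "\<phi> j x = min 1 (real j * infdist x (- U))" for j x
    have ne: "- U \<noteq> {}" using False by auto
    have cont: "continuous_on UNIV (\<phi> j)" for j
      unfolding \<phi>_def by (intro continuous_intros)
    have bounds: "0 \<le> \<phi> j x" "\<phi> j x \<le> indicator U x" for j x
    proof -
      show "0 \<le> \<phi> j x" by (simp add: \<phi>_def infdist_nonneg)
      show "\<phi> j x \<le> indicator U x" by (cases "x \<in> U") (auto simp: \<phi>_def)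
    qed
    have lim: "(\<lambda>j. \<phi> j x) \<longlonglongrightarrow> indicator U x" for x
    proof (cases "x \<in> U")
      case True
      then have "infdist x (- U) > 0"
        using U(1) ne infdist_nonneg[of x "- U"] in_closed_iff_infdist_zero[of "- U" x]
            by (auto simp: less_le closed_Compl)
      then obtain N :: nat where N: "1 < real N * infdist x (- U)" using reals_Archimedean3 by blast
      have "eventually (\<lambda>j. \<phi> j x = indicator U x) sequentially"
        using eventually_ge_at_top[of N]
      proof eventually_elim
        case (elim j)
        have "real N * infdist x (- U) \<le> real j * infdist x (- U)" using elim
            by (intro mult_right_mono infdist_nonneg) auto
        then show ?case using N True by (simp add: \<phi>_def)
      qed
      then show ?thesis by (rule tendsto_eventually)
    next
      case False
      then have "\<phi> j x = indicator U x" for j by (simp add: \<phi>_def)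
      then show ?thesis by simp
    qed
    have meas: "\<phi> j \<in> borel_measurable \<mu>" for j
      using borel_measurable_continuous_onI[OF cont[of j]] \<mu>(2) by (simp cong: measurable_cong_sets)
    have "(\<lambda>j. integral\<^sup>L \<mu> (\<phi> j)) \<longlonglongrightarrow> integral\<^sup>L \<mu> (indicator U :: _ \<Rightarrow> real)"
    proof (rule integral_dominated_convergence[where w="\<lambda>_. 1"])
      show "AE x in \<mu>. norm (\<phi> j x) \<le> 1" for j using bounds(1)[of j] by (simp add: \<phi>_def)
    qed (use lim meas U \<mu> in \<open>auto intro!: borel_measurable_indicator\<close>)
    also have "integral\<^sup>L \<mu> (indicator U :: _ \<Rightarrow> real) = measure \<mu> U" using U(1) \<mu>(2) by simp
    finally have "eventually (\<lambda>j. c < integral\<^sup>L \<mu> (\<phi> j)) sequentially" using U(2) by (rule order_tendstoD)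
    then obtain j where j: "c < integral\<^sup>L \<mu> (\<phi> j)" by (auto simp: eventually_sequentially)
    have "(\<lambda>k. integral\<^sup>L (orbit_measure f (p k)) (\<phi> j)) \<longlonglongrightarrow> integral\<^sup>L \<mu> (\<phi> j)"
      using ws cont unfolding weak_star_conv_def by blast
    then have "eventually (\<lambda>k. c < integral\<^sup>L (orbit_measure f (p k)) (\<phi> j)) sequentially"
      using j by (rule order_tendstoD)
    then show ?thesis
    proof eventually_elim
      case (elim k)
      have "c * real (period f (p k)) < (\<Sum>i<period f (p k). \<phi> j ((f ^^ i) (p k)))"
        using elim P[of k] by (simp add: integral_orbit_measure[OF cont] field_simps)
      also have "\<dots> \<le> (\<Sum>i<period f (p k). indicator U ((f ^^ i) (p k)))"
        by (intro sum_mono bounds)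
      also have "\<dots> = real (card {i. i < period f (p k) \<and> (f ^^ i) (p k) \<in> U})"
        by (simp add: indicator_def sum.If_cases) (intro arg_cong[where f=card], auto)
      finally show ?case .
    qed
  qed
qed

lemma continuous_funpow: "continuous_on UNIV f
    \<Longrightarrow> continuous_on UNIV (f ^^ n)" for f :: "'a::topological_space \<Rightarrow> 'a"
proof (induction n)
  case (Suc n)
  then have "continuous_on UNIV (f \<circ> (f ^^ n))"
    by (intro continuous_on_compose) (auto intro: continuous_on_subset)
  then show ?case by simp
qed (simp add: id_def)

lemma continuous_cocycle:
  fixes f :: "'a::topological_space \<Rightarrow> 'a" and A :: "'a \<Rightarrow> real^'d^'d"
  assumes f: "continuous_on UNIV f" and A: "continuous_on UNIV A"
  shows "continuous_on UNIV (cocycle f A n)"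
proof (induction n)
  case (Suc n)
  have "continuous_on UNIV (A \<circ> (f ^^ n))"
    using continuous_funpow[OF f, of n] A
        by (intro continuous_on_compose) (auto intro: continuous_on_subset)
  then have "continuous_on UNIV (\<lambda>x. (A \<circ> (f ^^ n)) x ** cocycle f A n x)"
    using Suc by (intro bounded_bilinear.continuous_on[OF bounded_bilinear_matrix_mult])
  moreover have "cocycle f A (Suc n) = (\<lambda>x. (A \<circ> (f ^^ n)) x ** cocycle f A n x)" by (rule ext) simp
  ultimately show ?case by metis
next
  case 0
  have "cocycle f A 0 = (\<lambda>_. mat 1)" by (rule ext) simp
  then show ?case by (simp add: continuous_on_const)
qed

lemma distr_funpow:
  fixes f :: "'a::topological_space \<Rightarrow> 'a"
  assumes inv: "invariant_prob f \<mu>" and f: "continuous_on UNIV f"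
  shows "distr \<mu> borel (f ^^ n) = \<mu>"
proof (induction n)
  case 0
  have "sets \<mu> = sets borel" using inv by (simp add: invariant_prob_def)
  then show ?case using distr_id2[of borel \<mu>] by (simp add: id_def)
next
  case (Suc n)
  have s: "sets \<mu> = sets borel" and d: "distr \<mu> borel f = \<mu>" using inv by (auto simp: invariant_prob_def)
  have m: "f ^^ n \<in> measurable borel borel" "f \<in> measurable \<mu> borel"
    using borel_measurable_continuous_onI[OF continuous_funpow[OF f, of n]]
        borel_measurable_continuous_onI[OF f] s
    by (auto cong: measurable_cong_sets)
  have "distr (distr \<mu> borel f) borel (f ^^ n) = distr \<mu> borel ((f ^^ n) \<circ> f)"
    by (rule distr_distr[OF m])
  then have "distr \<mu> borel ((f ^^ n) \<circ> f) = \<mu>" using Suc d by simp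
  then show ?case by (simp only: funpow_Suc_right)
qed

lemma measure_funpow_preimage:
  fixes f :: "'a::topological_space \<Rightarrow> 'a"
  assumes inv: "invariant_prob f \<mu>" and f: "continuous_on UNIV f" and B: "B \<in> sets borel"
  shows "(f ^^ n) -` B \<in> sets borel" "measure \<mu> ((f ^^ n) -` B) = measure \<mu> B"
proof -
  have s: "sets \<mu> = sets borel" using inv by (auto simp: invariant_prob_def)
  then have sp: "space \<mu> = UNIV" by (metis sets_eq_imp_space_eq space_borel)
  have m: "f ^^ n \<in> borel_measurable borel"
      by (rule borel_measurable_continuous_onI[OF continuous_funpow[OF f]])
  show "(f ^^ n) -` B \<in> sets borel" using measurable_sets[OF m B] by simp
  have "measure \<mu> B = measure (distr \<mu> borel (f ^^ n)) B" by (simp add: distr_funpow[OF inv f])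
  also have "\<dots> = measure \<mu> ((f ^^ n) -` B)"
    using m B s sp by (subst measure_distr) (auto cong: measurable_cong_sets)
  finally show "measure \<mu> ((f ^^ n) -` B) = measure \<mu> B" by simp
qed

lemma exists_regular_set:
  fixes f :: "'a::topological_space \<Rightarrow> 'a" and A :: "'a \<Rightarrow> real^'d^'d"
  assumes inv: "invariant_prob f \<mu>" and f: "continuous_on UNIV f" and O: "oseledets_splitting f A \<mu> D"
  shows "\<exists>g Reg. (\<forall>j\<in>{1..num D}. g j \<in> borel_measurable borel) \<and> Reg \<in> sets borel \<and> measure \<mu> Reg = 1 \<and>
    (\<forall>x\<in>Reg. \<forall>i. regular_at f A D ((f ^^ i) x) \<and> (\<forall>j\<in>{1..num D}. g j ((f ^^ i) x)
        = oproj D ((f ^^ i) x) j))"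
proof -
  have s: "sets \<mu> = sets borel" using inv by (auto simp: invariant_prob_def)
  then have sp: "space \<mu> = UNIV" by (metis sets_eq_imp_space_eq space_borel)
  interpret prob_space \<mu> using inv by (auto simp: invariant_prob_def)
  obtain g where g: "\<forall>j\<in>{1..num D}. g j \<in> borel_measurable borel"
    and ae: "AE x in \<mu>. regular_at f A D x \<and> (\<forall>j\<in>{1..num D}. g j x = oproj D x j)" (is "AE x in \<mu>. ?R x")
    using exists_borel_oproj[OF s O] by blast
  have "AE x in \<mu>. ?R ((f ^^ i) x)" for i
  proof -
    have m: "f ^^ i \<in> measurable \<mu> borel"
      using borel_measurable_continuous_onI[OF continuous_funpow[OF f]] s
          by (simp cong: measurable_cong_sets)
    have "AE x in distr \<mu> borel (f ^^ i). ?R x" unfolding distr_funpow[OF inv f] by (rule ae)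
    from AE_distrD[OF m this] show ?thesis .
  qed
  then have "AE x in \<mu>. \<forall>i. ?R ((f ^^ i) x)" by (simp add: AE_all_countable)
  then obtain N where N: "N \<in> null_sets \<mu>" "{x \<in> space \<mu>. \<not> (\<forall>i. ?R ((f ^^ i) x))} \<subseteq> N"
    by (auto simp: eventually_ae_filter)
  have "measure \<mu> (space \<mu> - N) = 1" using N(1) by (simp add: prob_compl measure_eq_0_null_sets null_setsD2)
  then show ?thesis using N g s sp
    by (intro exI[of _ g] exI[of _ "space \<mu> - N"]) (auto simp: null_sets_def)
qed

text \<open>
  The norms of the projections are finite at every point, so that some constant \<open>C\<close> bounds them
  outside a set of small measure; at the end of the segment the same bound holds by invariance of
  \<open>\<mu>\<close>. The rates are attained outside a small set once \<open>n\<close> is large.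
\<close>

lemma good_set_large:
  fixes f :: "'a::topological_space \<Rightarrow> 'a" and A :: "'a \<Rightarrow> real^'d^'d"
  assumes inv: "invariant_prob f \<mu>" and f: "continuous_on UNIV f" and A: "continuous_on UNIV A"
    and D: "spectrum_data D"
    and g: "\<And>j. j \<in> {1..num D} \<Longrightarrow> g j \<in> borel_measurable borel"
    and Reg: "Reg \<in> sets borel" "measure \<mu> Reg = 1"
      "\<And>x i. x \<in> Reg \<Longrightarrow> regular_at f A D ((f ^^ i) x) \<and> (\<forall>j\<in>{1..num D}. g j ((f ^^ i) x)
          = oproj D ((f ^^ i) x) j)"
    and \<kappa>: "\<kappa> > 0"
  shows "\<exists>C\<ge>1. \<forall>a. (\<forall>j\<in>{1..num D}. expo D j < ereal (a j)) \<longrightarrow>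
     eventually (\<lambda>n. \<exists>Y\<in>sets borel. Y \<subseteq> Reg \<and> Y \<subseteq> good_set f A D a C n \<and> measure \<mu> Y > 1 - \<kappa>) sequentially"
proof -
  have s: "sets \<mu> = sets borel" using inv by (auto simp: invariant_prob_def)
  interpret prob_space \<mu> using inv by (auto simp: invariant_prob_def)
  have sumg: "(\<lambda>x. sum (\<lambda>i. g i x) I) \<in> borel_measurable borel" if "I \<subseteq> {1..num D}" for I
    using that g by (intro borel_measurable_sum) auto
  have gsum: "sum (\<lambda>i. g i ((f ^^ n) x)) I = sum (oproj D ((f ^^ n) x)) I"
      if "x \<in> Reg" "I \<subseteq> {1..num D}" for x I n
    using Reg(3)[OF that(1)] that(2) by (intro sum.cong) auto
  define Bd where "Bd c = (\<Union>j\<in>{..num D}. {x. norm (mat 1 - (\<Sum>i\<in>{1..j}. g i x)) > c})" for c :: real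
  have Bdm: "Bd c \<in> sets borel" for c
  proof -
    have "{x. norm (mat 1 - (\<Sum>i\<in>{1..j}. g i x)) > c} \<in> sets borel" if "j \<le> num D" for j
    proof -
      have "{1..j} \<subseteq> {1..num D}" using that by auto
      then have [measurable]: "(\<lambda>x. \<Sum>i\<in>{1..j}. g i x) \<in> borel_measurable borel" by (rule sumg)
      show ?thesis by measurable
    qed
    then show ?thesis unfolding Bd_def by (intro sets.finite_UN) auto
  qed
  have "(\<lambda>n. measure \<mu> (Bd (real n))) \<longlonglongrightarrow> 0"
  proof (rule measure_tendsto_0_of_AE_eventually)
    show "AE x in \<mu>. eventually (\<lambda>n. x \<notin> Bd (real n)) sequentially"
    proof (rule AE_I2)
      fix x
      have "eventually (\<lambda>n. \<forall>j\<in>{..num D}. norm (mat 1 - (\<Sum>i\<in>{1..j}. g i x)) \<le> real n) sequentially"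
        by (intro eventually_ball_finite ballI) (auto intro: eventually_mono[OF eventually_ge_at_top[of
            "nat \<lceil>_\<rceil>"]] simp: nat_le_iff ceiling_le_iff)
      then show "eventually (\<lambda>n. x \<notin> Bd (real n)) sequentially"
        by eventually_elim (auto simp: Bd_def not_less)
    qed
  qed (use Bdm s in \<open>auto intro: finite_measure_axioms\<close>)
  then have "eventually (\<lambda>n. measure \<mu> (Bd (real n)) < \<kappa> / 4) sequentially"
    using \<kappa> by (intro order_tendstoD) auto
  then have "eventually (\<lambda>n. measure \<mu> (Bd (real n)) < \<kappa> / 4 \<and> n \<ge> 1) sequentially"
    using eventually_ge_at_top by (rule eventually_conj)
  then obtain c :: nat where c: "measure \<mu> (Bd (real c)) < \<kappa> / 4" "c \<ge> 1"
    by (auto simp: eventually_sequentially)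
  show ?thesis
  proof (intro exI[of _ "real c"] conjI allI impI)
    show "1 \<le> real c" using c by simp
    fix a :: "nat \<Rightarrow> real" assume a: "\<forall>j\<in>{1..num D}. expo D j < ereal (a j)"
    define Rt where "Rt n = (\<Union>j\<in>{1..num D}. {x. norm (cocycle f A n x ** (\<Sum>i\<in>{j..num D}. g i x)) > exp
        (real n * a j)})" for n
    have Rtm: "Rt n \<in> sets borel" for n
    proof -
      have "{x. norm (cocycle f A n x ** (\<Sum>i\<in>{j..num D}. g i x)) > exp (real n * a j)} \<in> sets borel"
          if "j \<in> {1..num D}" for j
      proof -
        have "{j..num D} \<subseteq> {1..num D}" using that by auto
        then have "(\<lambda>x. \<Sum>i\<in>{j..num D}. g i x) \<in> borel_measurable borel" by (rule sumg)
        then have [measurable]: "(\<lambda>x. cocycle f A n x ** (\<Sum>i\<in>{j..num D}. g i x)) \<in> borel_measurable borel"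
          by (rule measurable_matrix_mult[OF borel_measurable_continuous_onI[OF continuous_cocycle[OF f
              A]]])
        show ?thesis by measurable
      qed
      then show ?thesis unfolding Rt_def by (intro sets.finite_UN) auto
    qed
    have "(\<lambda>n. measure \<mu> (Rt n)) \<longlonglongrightarrow> 0"
    proof (rule measure_tendsto_0_of_AE_eventually)
      have "AE x in \<mu>. x \<in> Reg" using Reg s by (simp add: prob_eq_1)
      then show "AE x in \<mu>. eventually (\<lambda>n. x \<notin> Rt n) sequentially"
      proof eventually_elim
        case (elim x)
        have r: "regular_at f A D x" using Reg(3)[OF elim, of 0] by simp
        have "eventually (\<lambda>n. \<forall>j\<in>{1..num D}. norm (cocycle f A n x ** slow_proj D x j)
            \<le> exp (real n * a j)) sequentially"
          using a by (intro eventually_ball_finite ballI eventually_norm_slow_part[OF D r]) auto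
        then show ?case
        proof eventually_elim
          case (elim n)
          have "(\<Sum>i\<in>{j..num D}. g i x) = slow_proj D x j" if "j \<in> {1..num D}" for j
            using gsum[OF \<open>x \<in> Reg\<close>, of "{j..num D}" 0] that by simp
          then show ?case using elim by (auto simp: Rt_def not_less)
        qed
      qed
    qed (use Rtm s in \<open>auto intro: finite_measure_axioms\<close>)
    then have "eventually (\<lambda>n. measure \<mu> (Rt n) < \<kappa> / 4) sequentially"
      using \<kappa> by (intro order_tendstoD) auto
    then show "eventually (\<lambda>n. \<exists>Y\<in>sets borel. Y \<subseteq> Reg \<and> Y \<subseteq> good_set f A D a (real c) n
        \<and> measure \<mu> Y > 1 - \<kappa>) sequentially"
    proof eventually_elim
      case (elim n)
      define Bn where "Bn = (f ^^ n) -` Bd (real c)"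
      have Bn: "Bn \<in> sets borel" "measure \<mu> Bn = measure \<mu> (Bd (real c))"
        unfolding Bn_def using measure_funpow_preimage[OF inv f Bdm] by auto
      define Bad where "Bad = Bd (real c) \<union> Bn \<union> Rt n"
      have "measure \<mu> Bad \<le> measure \<mu> (Bd (real c)) + measure \<mu> Bn + measure \<mu> (Rt n)"
        unfolding Bad_def using Bdm Bn(1) Rtm s
        by (intro order_trans[OF measure_Un_le] add_mono) auto
      then have bad: "measure \<mu> Bad < \<kappa>" using c elim Bn \<kappa> by linarith
      have Badm: "Bad \<in> sets borel" using Bdm Bn Rtm by (auto simp: Bad_def)
      have "measure \<mu> (Reg - Bad) \<ge> measure \<mu> Reg - measure \<mu> Bad"
        using Reg Badm s measure_Un_le[of "Reg - Bad" \<mu> "Bad"] finite_measure_mono[of Reg "(Reg - Bad) \<union>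
            Bad"] by auto
      then have m: "measure \<mu> (Reg - Bad) > 1 - \<kappa>" using bad Reg(2) by linarith
      have "Reg - Bad \<subseteq> good_set f A D a (real c) n"
      proof
        fix y assume y: "y \<in> Reg - Bad"
        then have yR: "y \<in> Reg" by blast
        have "(\<Sum>i\<in>{j..num D}. g i y) = slow_proj D y j" if "j \<in> {1..num D}" for j
          using gsum[OF yR, of "{j..num D}" 0] that by simp
        then have 1: "\<forall>j\<in>{1..num D}. norm (cocycle f A n y ** slow_proj D y j) \<le> exp (real n * a j)"
          using y by (auto simp: Bad_def Rt_def not_less)
        have 2: "norm (mat 1 - fast_proj D y j) \<le> real c \<and> norm (mat 1 - fast_proj D ((f ^^ n) y) j)
            \<le> real c"
          if j: "j \<le> num D" for j
        proof -
          have "{1..j} \<subseteq> {1..num D}" using j by auto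
          then have "(\<Sum>i\<in>{1..j}. g i y) = fast_proj D y j"
            "(\<Sum>i\<in>{1..j}. g i ((f ^^ n) y)) = fast_proj D ((f ^^ n) y) j"
            using gsum[OF yR, of "{1..j}" 0] gsum[OF yR, of "{1..j}" n] by auto
          moreover have "norm (mat 1 - (\<Sum>i\<in>{1..j}. g i y)) \<le> real c" "norm (mat 1 - (\<Sum>i\<in>{1..j}. g i ((f
              ^^ n) y))) \<le> real c"
            using y j by (auto simp: Bad_def Bd_def Bn_def not_less)
          ultimately show ?thesis by simp
        qed
        show "y \<in> good_set f A D a (real c) n" using 1 2 Reg(3)[OF yR] by (auto simp: good_set_def)
      qed
      then show ?case using m Reg Badm by (intro bexI[of _ "Reg - Bad"]) auto
    qed
  qed
qed

section \<open>The approximation\<close>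

text \<open>
  Each of the two estimates of each cut excludes a proportion \<open>\<tau>\<close> of the orbit points. If the orbit
  comes close to \<open>Z\<close> more often than this, it does so at some \<open>f\<^sup>i(p)\<close> where the primal
  estimate holds for the block from \<open>i\<close> to \<open>i + n\<close>, and the dual one for the block that starts at
  \<open>i + n\<close>. Both concern the orbit point \<open>f\<^bsup>i+n\<^esup>(p)\<close> and the point \<open>f\<^sup>n(z)\<close>.
\<close>

lemma exists_good_orbit_point:
  fixes f :: "'a::metric_space \<Rightarrow> 'a" and A :: "'a \<Rightarrow> real^'d^'d"
  assumes p: "periodic_point f p" and D: "spectrum_data D" and cD: "csum D (num D) = CARD('d)"
    and D': "spectrum_data D'" and r': "\<And>i. regular_at f A D' ((f ^^ i) p)"
    and gap: "\<And>j. j \<in> {1..<num D} \<Longrightarrow> lyap D' (csum D j + 1) < lyap D' (csum D j)"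
    and fin: "\<And>j i. j \<in> {1..<num D} \<Longrightarrow> i \<in> {1..csum D j} \<Longrightarrow> lyap D' i \<noteq> -\<infinity>"
    and n: "n > 0" and M: "\<And>x. norm (cocycle f A n x) \<le> M ^ n" "M \<ge> 1" "fact CARD('d) * M ^ CARD('d)
        \<le> exp K"
    and Y: "Y \<subseteq> good_set f A D a C n"
    and \<theta>: "\<And>j. j \<in> {1..num D} \<Longrightarrow> \<theta> \<le> exp (real n * a j) \<and> C * \<theta> \<le> exp (real n * a j)" "0 \<le> \<theta>"
    and r: "\<And>y q. dist y q < r \<Longrightarrow> norm (cocycle f A n q - cocycle f A n y) \<le> \<theta>"
    and few: "real (card {i. i < period f p \<and> \<not> (\<exists>y\<in>Y. dist y ((f ^^ i) p) < r)}) \<le> \<kappa> * real (period f p)"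
    and s1: "\<And>j. j \<in> {1..<num D} \<Longrightarrow> (\<Sum>i=1..csum D j. a (idx D i)) + E \<le> K"
      "fact CARD('d) * 2 ^ CARD('d) \<le> exp (real n * E)" "0 \<le> E"
    and \<rho>: "\<rho> > 0" "\<And>j. j \<in> {1..<num D} \<Longrightarrow> (\<Sum>i=1..csum D j. a (idx D i)) + E
        - (\<Sum>i=1..csum D j. real_of_ereal (lyap D' i)) + \<kappa> * (K - ((\<Sum>i=1..csum D j. a (idx D i)) + E))
            \<le> \<tau> * \<rho>"
    and \<eta>: "\<And>j. j \<in> {1..<num D} \<Longrightarrow>
        fact CARD('d) * 2 ^ (CARD('d) + 1) * exp (real n * (a (Suc j) - a j + \<rho>)) \<le> \<eta>"
    and r2: "r2 \<le> r" "\<And>y q. dist y q < r2 \<Longrightarrow> dist ((f ^^ n) y) ((f ^^ n) q) < r"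
    and Z: "Z \<subseteq> Y" "\<And>z. z \<in> Z \<Longrightarrow> (f ^^ n) z \<in> Y"
    and many: "2 * real (num D) * \<tau> * real (period f p) < real (card {i. i < period f p
        \<and> (\<exists>z\<in>Z. dist z ((f ^^ i) p) < r2)})"
    and \<tau>: "\<tau> \<ge> 0"
  shows "\<exists>z\<in>Z. \<exists>q\<in>forward_orbit f p. \<forall>j\<in>{1..<num D}.
     (small_on \<eta> (mat 1 - fast_proj D ((f ^^ n) z) j) (rng (fast_proj D' q (cut_index D D' j)))) \<and>
     (small_on \<eta> (transpose (mat 1 - fast_proj D ((f ^^ n) z) j)) (rng (transpose (fast_proj D' q
         (cut_index D D' j)))))"
proof -
  define P where "P = period f p"
  have P: "P > 0" using period_props[OF p] by (simp add: P_def)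
  have cD': "csum D' (num D') = CARD('d)" using csum_num[OF r'[of 0]] .
  note cp = cut_index_props[OF D cD D' cD' gap]
  have finexp: "expo D' i \<noteq> -\<infinity>" if j: "j \<in> {1..<num D}" and i: "i \<in> {1..cut_index D D' j}" for j i
  proof -
    have c: "cut_index D D' j \<le> num D'" "csum D' (cut_index D D' j) = csum D j" using cp[of j] j by auto
    have "csum D' (i - 1) < csum D' i" using csum_strict[OF D', of "i - 1" i] i c by auto
    then have "idx D' (csum D' i) = i" using idx_eqI[of D' "i - 1" "csum D' i"] i by simp
    then have "expo D' i = lyap D' (csum D' i)" by (simp add: lyap_idx)
    moreover have "csum D' i \<in> {1..csum D j}"
      using csum_mono[of i "cut_index D D' j" D'] csum_strict[OF D', of 0 i] i c by auto
    ultimately show ?thesis using fin[OF j] by simp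
  qed
  define \<eta>' where "\<eta>' j = fact CARD('d) * 2 ^ (CARD('d) + 1) * exp (real n * (a (Suc j) - a j + \<rho>))" for j
  define near where "near i y \<longleftrightarrow> y \<in> Y \<and> dist y ((f ^^ i) p) < r" for i y
  define pr where "pr j q x \<longleftrightarrow> (small_on \<eta> (mat 1 - fast_proj D x j) (rng (fast_proj D' q (cut_index D D'
      j))))" for j q x
  define du where "du j q x \<longleftrightarrow> (small_on \<eta> (transpose (mat 1 - fast_proj D x j)) (rng (transpose
      (fast_proj D' q (cut_index D D' j)))))" for j q x
  have small: "real (card B) \<le> \<tau> * real P"
    if "j \<in> {1..<num D}" and B: "\<rho> * real (card B) \<le> real P * ((\<Sum>i=1..csum D j. a (idx D i)) + E
        - (\<Sum>i=1..csum D j. real_of_ereal (lyap D' i)) + \<kappa> * (K - ((\<Sum>i=1..csum D j. a (idx D i))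
            + E)))" for j and B :: "nat set"
  proof -
    have "\<rho> * real (card B) \<le> real P * (\<tau> * \<rho>)"
      using B mult_left_mono[OF \<rho>(2)[OF that(1)], of "real P"] by linarith
    then show ?thesis using \<rho>(1) by (simp add: mult_ac)
  qed
  have est: "(\<exists>B\<subseteq>{..<P}. real (card B) \<le> \<tau> * real P \<and> (\<forall>i<P. i \<notin> B \<longrightarrow> (\<forall>y. near i y
      \<longrightarrow> pr j ((f ^^ (i + n)) p) ((f ^^ n) y))))
     \<and> (\<exists>B\<subseteq>{..<P}. real (card B) \<le> \<tau> * real P \<and> (\<forall>i<P. i \<notin> B \<longrightarrow> (\<forall>y. near i y \<longrightarrow> du j ((f ^^ i) p) y)))"
    if j: "j \<in> {1..<num D}" for j
  proof -
    have c: "cut_index D D' j \<le> num D'" "csum D' (cut_index D D' j) = csum D j" using cp[of j] j by auto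
    have e: "x \<le> \<eta> * norm w" if "x \<le> \<eta>' j * norm w" for x and w :: "real^'d"
      using that \<eta>[OF j] mult_right_mono[of "\<eta>' j" \<eta> "norm w"] by (simp add: \<eta>'_def)
    have 1: "\<exists>B\<subseteq>{..<P}. real (card B) \<le> \<tau> * real P \<and> (\<forall>i<P. i \<notin> B \<longrightarrow> (\<forall>y. near i y
        \<longrightarrow> pr j ((f ^^ (i + n)) p) ((f ^^ n) y)))"
    proof -
      have est: "\<exists>B\<subseteq>{..<P}. \<rho> * real (card B) \<le> real P * ((\<Sum>i=1..csum D j. a (idx D i)) + E
        - (\<Sum>i=1..csum D j. real_of_ereal (lyap D' i)) + \<kappa> * (K - ((\<Sum>i=1..csum D j. a (idx D i)) + E))) \<and>
         (\<forall>i<P. i \<notin> B \<longrightarrow> (\<forall>y\<in>Y. dist y ((f ^^ i) p) < r \<longrightarrow> (small_on (\<eta>' j) (mat 1 - fast_proj D ((f ^^ n)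
             y) j) (rng (fast_proj D' ((f ^^ (i + n)) p) (cut_index D D' j))))))"
        unfolding P_def
      proof (rule cut_estimate(1)[OF p D cD D' _ j c(1) c(2) _ n _ M(2) M(3) Y _ \<theta>(2) _ few refl s1(2)
          s1(3) s1(1)[OF j] refl])
        show "regular_at f A D' ((f ^^ i) p)" for i by (rule r')
        show "expo D' i \<noteq> -\<infinity>" if "i \<in> {1..cut_index D D' j}" for i by (rule finexp[OF j that])
        show "norm (cocycle f A n x) \<le> M ^ n" for x by (rule M(1))
        show "\<theta> \<le> exp (real n * a j) \<and> C * \<theta> \<le> exp (real n * a j)" if "j \<in> {1..num D}" for j
            by (rule \<theta>(1)[OF that])
        show "norm (cocycle f A n q - cocycle f A n y) \<le> \<theta>" if "y \<in> Y" "dist y q < r" for y q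
            by (rule r[OF that(2)])
        show "\<eta>' j = fact CARD('d) * 2 ^ (CARD('d) + 1) * exp (real n * (a (Suc j) - a j + \<rho>))"
            by (simp add: \<eta>'_def)
      qed
      obtain B where B: "B \<subseteq> {..<P}" "\<rho> * real (card B) \<le> real P * ((\<Sum>i=1..csum D j. a (idx D i)) + E
        - (\<Sum>i=1..csum D j. real_of_ereal (lyap D' i)) + \<kappa> * (K - ((\<Sum>i=1..csum D j. a (idx D i)) + E)))"
        "\<And>i y w. i < P \<Longrightarrow> i \<notin> B \<Longrightarrow> y \<in> Y \<Longrightarrow> dist y ((f ^^ i) p) < r \<Longrightarrow> w \<in> rng (fast_proj D' ((f ^^ (i
            + n)) p) (cut_index D D' j)) \<Longrightarrow>
           norm ((mat 1 - fast_proj D ((f ^^ n) y) j) *v w) \<le> \<eta>' j * norm w"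
        using est by blast
      have "pr j ((f ^^ (i + n)) p) ((f ^^ n) y)" if "i < P" "i \<notin> B" "near i y" for i y
        unfolding pr_def using B(3)[OF that(1,2)] that(3) e unfolding near_def by blast
      then show ?thesis using small[OF j B(2)] B(1) by blast
    qed
    have 2: "\<exists>B\<subseteq>{..<P}. real (card B) \<le> \<tau> * real P \<and> (\<forall>i<P. i \<notin> B \<longrightarrow> (\<forall>y. near i y \<longrightarrow> du j ((f ^^ i) p) y))"
    proof -
      have est: "\<exists>B\<subseteq>{..<P}. \<rho> * real (card B) \<le> real P * ((\<Sum>i=1..csum D j. a (idx D i)) + E
        - (\<Sum>i=1..csum D j. real_of_ereal (lyap D' i)) + \<kappa> * (K - ((\<Sum>i=1..csum D j. a (idx D i)) + E))) \<and>
         (\<forall>i<P. i \<notin> B \<longrightarrow> (\<forall>y\<in>Y. dist y ((f ^^ i) p) < r \<longrightarrow> (small_on (\<eta>' j) (transpose (mat 1 - fast_proj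
             D y j)) (rng (transpose (fast_proj D' ((f ^^ i) p) (cut_index D D' j)))))))"
        unfolding P_def
      proof (rule cut_estimate(2)[OF p D cD D' _ j c(1) c(2) _ n _ M(2) M(3) Y _ \<theta>(2) _ few refl s1(2)
          s1(3) s1(1)[OF j] refl])
        show "regular_at f A D' ((f ^^ i) p)" for i by (rule r')
        show "expo D' i \<noteq> -\<infinity>" if "i \<in> {1..cut_index D D' j}" for i by (rule finexp[OF j that])
        show "norm (cocycle f A n x) \<le> M ^ n" for x by (rule M(1))
        show "\<theta> \<le> exp (real n * a j) \<and> C * \<theta> \<le> exp (real n * a j)" if "j \<in> {1..num D}" for j
            by (rule \<theta>(1)[OF that])
        show "norm (cocycle f A n q - cocycle f A n y) \<le> \<theta>" if "y \<in> Y" "dist y q < r" for y q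
            by (rule r[OF that(2)])
        show "\<eta>' j = fact CARD('d) * 2 ^ (CARD('d) + 1) * exp (real n * (a (Suc j) - a j + \<rho>))"
            by (simp add: \<eta>'_def)
      qed
      obtain B where B: "B \<subseteq> {..<P}" "\<rho> * real (card B) \<le> real P * ((\<Sum>i=1..csum D j. a (idx D i)) + E
        - (\<Sum>i=1..csum D j. real_of_ereal (lyap D' i)) + \<kappa> * (K - ((\<Sum>i=1..csum D j. a (idx D i)) + E)))"
        "\<And>i y w. i < P \<Longrightarrow> i \<notin> B \<Longrightarrow> y \<in> Y \<Longrightarrow> dist y ((f ^^ i) p) < r
            \<Longrightarrow> w \<in> rng (transpose (fast_proj D' ((f ^^ i) p) (cut_index D D' j))) \<Longrightarrow>
           norm (transpose (mat 1 - fast_proj D y j) *v w) \<le> \<eta>' j * norm w"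
        using est by blast
      have "du j ((f ^^ i) p) y" if "i < P" "i \<notin> B" "near i y" for i y
        unfolding du_def using B(3)[OF that(1,2)] that(3) e unfolding near_def by blast
      then show ?thesis using small[OF j B(2)] B(1) by blast
    qed
    show ?thesis using 1 2 by blast
  qed
  then obtain B B' where B: "\<And>j. j \<in> {1..<num D} \<Longrightarrow> B j \<subseteq> {..<P} \<and> real (card (B j)) \<le> \<tau> * real P \<and>
        (\<forall>i<P. i \<notin> B j \<longrightarrow> (\<forall>y. near i y \<longrightarrow> pr j ((f ^^ (i + n)) p) ((f ^^ n) y)))"
    and B': "\<And>j. j \<in> {1..<num D} \<Longrightarrow> B' j \<subseteq> {..<P} \<and> real (card (B' j)) \<le> \<tau> * real P \<and>
        (\<forall>i<P. i \<notin> B' j \<longrightarrow> (\<forall>y. near i y \<longrightarrow> du j ((f ^^ i) p) y))"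
    by metis
  \<comment> \<open>the dual estimate is needed \<open>n\<close> steps later; shifting the index preserves the count\<close>
  define sh where "sh i = (i + n) mod P" for i
  define B2 where "B2 j = {i. i < P \<and> sh i \<in> B' j}" for j
  have B2c: "real (card (B2 j)) \<le> \<tau> * real P" if j: "j \<in> {1..<num D}" for j
  proof -
    have "inj_on sh (B2 j)"
    proof (rule inj_onI)
      fix x y assume xy: "x \<in> B2 j" "y \<in> B2 j" "sh x = sh y"
      have key: "u = v" if "u \<le> v" "v < P" "sh u = sh v" for u v
      proof -
        have "P dvd (v + n) - (u + n)"
          using mod_eq_dvd_iff_nat[of "u + n" "v + n" P] that by (simp add: sh_def)
        then have "P dvd v - u" by simp
        then show ?thesis using that(1,2) nat_dvd_not_less[of "v - u" P] by fastforce
      qed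
      have "x < P" "y < P" using xy by (auto simp: B2_def)
      then show "x = y" using key[of x y] key[of y x] xy(3) by (metis nat_le_linear)
    qed
    moreover have "sh ` B2 j \<subseteq> B' j" by (auto simp: B2_def)
    moreover have "finite (B' j)" using B'[OF j] finite_subset by blast
    ultimately have "card (B2 j) \<le> card (B' j)" by (rule card_inj_on_le)
    then show ?thesis using B'[OF j] by linarith
  qed
  define Bad where "Bad = (\<Union>j\<in>{1..<num D}. B j \<union> B2 j)"
  have "Bad \<subseteq> {..<P}" unfolding Bad_def B2_def using B by blast
  then have finB: "finite Bad" by (rule finite_subset) simp
  have "real (card Bad) \<le> real (\<Sum>j\<in>{1..<num D}. card (B j \<union> B2 j))"
    unfolding Bad_def by (intro of_nat_mono card_UN_le) simp
  also have "\<dots> \<le> (\<Sum>j\<in>{1..<num D}. 2 * \<tau> * real P)"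
    unfolding of_nat_sum
  proof (rule sum_mono)
    fix j assume j: "j \<in> {1..<num D}"
    have "real (card (B j \<union> B2 j)) \<le> real (card (B j)) + real (card (B2 j))"
      by (metis card_Un_le of_nat_add of_nat_mono)
    then show "real (card (B j \<union> B2 j)) \<le> 2 * \<tau> * real P" using B[OF j] B2c[OF j] by linarith
  qed
  also have "\<dots> = real (num D - 1) * (2 * \<tau> * real P)" by simp
  also have "\<dots> \<le> real (num D) * (2 * \<tau> * real P)" using \<tau> by (intro mult_right_mono) auto
  also have "\<dots> < real (card {i. i < P \<and> (\<exists>z\<in>Z. dist z ((f ^^ i) p) < r2)})"
    using many by (simp add: P_def mult_ac)
  finally have "card Bad < card {i. i < P \<and> (\<exists>z\<in>Z. dist z ((f ^^ i) p) < r2)}" by simp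
  then have "\<not> {i. i < P \<and> (\<exists>z\<in>Z. dist z ((f ^^ i) p) < r2)} \<subseteq> Bad"
    using card_mono[OF finB, of "{i. i < P \<and> (\<exists>z\<in>Z. dist z ((f ^^ i) p) < r2)}"] by linarith
  then obtain i z where i: "i < P" "i \<notin> Bad" and z: "z \<in> Z" "dist z ((f ^^ i) p) < r2" by blast
  define q where "q = (f ^^ (i + n)) p"
  have qsh: "q = (f ^^ sh i) p" unfolding q_def sh_def P_def using funpow_orbit_mod[OF p] by simp
  have n1: "near i z" using z Z r2(1) by (auto simp: near_def)
  have "dist ((f ^^ n) z) ((f ^^ n) ((f ^^ i) p)) < r" by (rule r2(2)[OF z(2)])
  moreover have "(f ^^ n) ((f ^^ i) p) = q" unfolding q_def by (metis add.commute comp_apply funpow_add)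
  ultimately have n2: "near (sh i) ((f ^^ n) z)" using Z(2)[OF z(1)] by (simp add: near_def qsh)
  have shP: "sh i < P" using P by (simp add: sh_def)
  have "pr j q ((f ^^ n) z) \<and> du j q ((f ^^ n) z)" if j: "j \<in> {1..<num D}" for j
  proof
    have "i \<notin> B j" "i \<notin> B2 j" using i j by (auto simp: Bad_def)
    then show "pr j q ((f ^^ n) z)" using B[OF j] i(1) n1 by (simp add: q_def)
    have "sh i \<notin> B' j" using \<open>i \<notin> B2 j\<close> i by (simp add: B2_def)
    then show "du j q ((f ^^ n) z)" using B'[OF j] shP n2 by (simp add: qsh)
  qed
  then show ?thesis using z(1) unfolding pr_def du_def
    by (intro bexI[of _ z] bexI[of _ q]) (auto simp: forward_orbit_def q_def)
qed

lemma gap_exists: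
  assumes D: "spectrum_data D"
  shows "\<exists>\<rho>>0. \<forall>j\<in>{1..<num D}. expo D j = ereal (real_of_ereal (expo D j)) \<and>
      expo D (Suc j) < ereal (real_of_ereal (expo D j) - 4 * \<rho>)"
proof -
  have "\<exists>r>0. expo D j = ereal (real_of_ereal (expo D j)) \<and> expo D (Suc j)
      < ereal (real_of_ereal (expo D j) - 4 * r)"
    if j: "j \<in> {1..<num D}" for j
  proof -
    have lt: "expo D (Suc j) < expo D j" using expo_mono[OF D, of j "Suc j"] j by auto
    moreover have "expo D j < \<infinity>" using D j unfolding spectrum_data_def by auto
    ultimately have e: "expo D j = ereal (real_of_ereal (expo D j))" by (cases "expo D j") auto
    obtain z :: real where z: "expo D (Suc j) < ereal z" "ereal z < expo D j" using lt ereal_dense2 by blast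
    have "z < real_of_ereal (expo D j)" using z(2) e by (metis less_ereal.simps(1))
    define s where "s = (real_of_ereal (expo D j) - z) / 4"
    have "real_of_ereal (expo D j) - 4 * s = z" "s > 0"
      using \<open>z < real_of_ereal (expo D j)\<close> by (auto simp: s_def field_simps)
    then show ?thesis using e z(1) by (intro exI[of _ s]) simp
  qed
  then obtain r where r: "\<And>j. j \<in> {1..<num D} \<Longrightarrow> r j > 0 \<and> expo D j = ereal (real_of_ereal (expo D j)) \<and>
      expo D (Suc j) < ereal (real_of_ereal (expo D j) - 4 * r j)" by metis
  define \<rho> where "\<rho> = Min (insert 1 (r ` {1..<num D}))"
  have "\<rho> > 0" unfolding \<rho>_def using r by (subst Min_gr_iff) auto
  moreover have "\<rho> \<le> r j" if "j \<in> {1..<num D}" for j unfolding \<rho>_def using that by (intro Min_le) auto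
  then have "expo D (Suc j) < ereal (real_of_ereal (expo D j) - 4 * \<rho>)" if j: "j \<in> {1..<num D}" for j
  proof -
    have "ereal (real_of_ereal (expo D j) - 4 * r j) \<le> ereal (real_of_ereal (expo D j) - 4 * \<rho>)"
      using \<open>\<And>j. j \<in> {1..<num D} \<Longrightarrow> \<rho> \<le> r j\<close>[OF j] by simp
    then show ?thesis using r[OF j] by (meson less_le_trans)
  qed
  ultimately show ?thesis using r by blast
qed

text \<open>
  Real upper rates slightly above the exponents. If the last exponent is \<open>-\<infinity>\<close>, any real
  number well below the exponent before it will do; if it is the only exponent, there is no cut, and
  the value is arbitrary.
\<close>

definition rate_bound :: "('a, 'd::finite) oseledets_data \<Rightarrow> real \<Rightarrow> real \<Rightarrow> nat \<Rightarrow> real" where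
  "rate_bound D \<rho> e j = (if expo D j = -\<infinity> then real_of_ereal (expo D (j - 1)) - 3 * \<rho> else real_of_ereal
      (expo D j) + e)"

lemma rate_bound_props:
  assumes D: "spectrum_data D" and \<rho>: "\<And>j. j \<in> {1..<num D} \<Longrightarrow> expo D j = ereal (real_of_ereal (expo D j)) \<and>
      expo D (Suc j) < ereal (real_of_ereal (expo D j) - 4 * \<rho>)" and e: "0 < e" "e \<le> \<rho>"
  shows "j \<in> {1..num D} \<Longrightarrow> expo D j < ereal (rate_bound D \<rho> e j)"
    and "j \<in> {1..<num D} \<Longrightarrow> rate_bound D \<rho> e (Suc j) \<le> real_of_ereal (expo D j) - 3 * \<rho>"
    and "j \<in> {1..<num D} \<Longrightarrow> rate_bound D \<rho> e j = real_of_ereal (expo D j) + e"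
proof -
  have fin: "expo D j \<noteq> \<infinity>" if "j \<in> {1..num D}" for j using D that unfolding spectrum_data_def by auto
  show "expo D j < ereal (rate_bound D \<rho> e j)" if j: "j \<in> {1..num D}"
    using fin[OF j] e by (cases "expo D j") (auto simp: rate_bound_def)
  show "rate_bound D \<rho> e (Suc j) \<le> real_of_ereal (expo D j) - 3 * \<rho>" if j: "j \<in> {1..<num D}"
  proof -
    have "expo D (Suc j) \<noteq> \<infinity>" using fin[of "Suc j"] j by auto
    moreover have "expo D (Suc j) < ereal (real_of_ereal (expo D j) - 4 * \<rho>)" using \<rho>[OF j] by simp
    ultimately show ?thesis using e by (cases "expo D (Suc j)") (auto simp: rate_bound_def)
  qed
  show "rate_bound D \<rho> e j = real_of_ereal (expo D j) + e" if j: "j \<in> {1..<num D}"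
  proof -
    have "expo D j \<noteq> -\<infinity>" using \<rho>[OF j] by (metis MInfty_neq_ereal(1))
    then show ?thesis by (simp add: rate_bound_def)
  qed
qed

lemma norm_cocycle_bound:
  fixes f :: "'a::topological_space \<Rightarrow> 'a" and A :: "'a \<Rightarrow> real^'d^'d"
  assumes comp: "compact (UNIV :: 'a set)" and A: "continuous_on UNIV A"
  shows "\<exists>M\<ge>1. \<forall>n>0. \<forall>x. norm (cocycle f A n x) \<le> M ^ n"
proof -
  have "bounded (range A)" using compact_continuous_image[OF A comp] by (rule compact_imp_bounded)
  then obtain M0 where M0: "\<And>x. norm (A x) \<le> M0" by (auto simp: bounded_iff)
  define M1 where "M1 = max 1 M0"
  have M1: "norm (A x) \<le> M1" "M1 \<ge> 1" for x using M0[of x] by (auto simp: M1_def)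
  define d where "d = real CARD('d)"
  have d: "d \<ge> 1" by (simp add: d_def Suc_le_eq)
  have "norm (cocycle f A n x) \<le> (d * M1) ^ n" if n: "n > 0" for n x
  proof -
    have c: "cocycle f A n x = seqprod (\<lambda>i. A ((f ^^ i) x)) 0 n"
      using cocycle_eq_seqprod[of f A n 0 x] by simp
    have "norm (cocycle f A n x) \<le> (\<Sum>s\<in>UNIV. norm (column s (cocycle f A n x)))"
        by (rule norm_matrix_le_sum_columns)
    also have "\<dots> \<le> (\<Sum>s\<in>(UNIV::'d set). M1 ^ n)"
    proof (rule sum_mono)
      fix s
      have "column s (cocycle f A n x) = cocycle f A n x *v axis s 1"
          by (simp add: matrix_vector_mult_basis)
      also have "norm \<dots> \<le> M1 ^ n * norm (axis s (1::real))"
        unfolding c by (rule norm_seqprod_le) (rule M1)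
      finally show "norm (column s (cocycle f A n x)) \<le> M1 ^ n" by (simp add: norm_axis_1)
    qed
    also have "\<dots> = d * M1 ^ n" by (simp add: d_def)
    also have "\<dots> \<le> d ^ n * M1 ^ n" using d M1 n by (intro mult_right_mono self_le_power) auto
    finally show ?thesis by (simp add: power_mult_distrib)
  qed
  moreover have "d * M1 \<ge> 1" using mult_mono[of 1 d 1 M1] d M1 by simp
  ultimately show ?thesis by blast
qed

text \<open>
  Cover a large ball of matrices by finitely many small ones, sort the points by the balls that
  contain their projections, and discard the cells of measure 0.
\<close>

lemma exists_cells:
  fixes g :: "nat \<Rightarrow> 'a::topological_space \<Rightarrow> 'b::euclidean_space"
  assumes \<mu>: "prob_space \<mu>" "sets \<mu> = sets borel" and g: "\<And>j. j \<in> {1..l} \<Longrightarrow> g j \<in> borel_measurable borel"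
    and Reg: "Reg \<in> sets borel" "measure \<mu> Reg = 1" and \<zeta>: "\<zeta> > 0" and \<epsilon>: "\<epsilon> > 0"
  shows "\<exists>\<L>. finite \<L> \<and> (\<forall>L\<in>\<L>. L \<in> sets borel \<and> L \<subseteq> Reg \<and> measure \<mu> L > 0 \<and>
        (\<forall>x\<in>L. \<forall>y\<in>L. \<forall>j\<in>{1..l}. norm (g j x - g j y) \<le> 2 * \<zeta>)) \<and> measure \<mu> (\<Union>\<L>) > 1 - \<epsilon>"
proof -
  interpret prob_space \<mu> by fact
  define Big where "Big c = (\<Union>j\<in>{1..l}. {x. norm (g j x) > c})" for c
  have Bigm: "Big c \<in> sets borel" for c
  proof -
    have "{x. norm (g j x) > c} \<in> sets borel" if "j \<in> {1..l}" for j
    proof -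
      note [measurable] = g[OF that]
      show ?thesis by measurable
    qed
    then show ?thesis unfolding Big_def by (intro sets.finite_UN) auto
  qed
  have "(\<lambda>n. measure \<mu> (Big (real n))) \<longlonglongrightarrow> 0"
  proof (rule measure_tendsto_0_of_AE_eventually)
    show "AE x in \<mu>. eventually (\<lambda>n. x \<notin> Big (real n)) sequentially"
    proof (rule AE_I2)
      fix x
      have "eventually (\<lambda>n. \<forall>j\<in>{1..l}. norm (g j x) \<le> real n) sequentially"
        by (intro eventually_ball_finite ballI) (auto intro: eventually_mono[OF eventually_ge_at_top[of
            "nat \<lceil>_\<rceil>"]] simp: nat_le_iff ceiling_le_iff)
      then show "eventually (\<lambda>n. x \<notin> Big (real n)) sequentially"
        by eventually_elim (auto simp: Big_def not_less)
    qed
  qed (use Bigm \<mu> in \<open>auto intro: finite_measure_axioms\<close>)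
  then have "eventually (\<lambda>n. measure \<mu> (Big (real n)) < \<epsilon>) sequentially"
    using \<epsilon> by (rule order_tendstoD)
  then obtain c :: nat where c: "measure \<mu> (Big (real c)) < \<epsilon>" by (auto simp: eventually_sequentially)
  have "compact (cball (0::'b) (real c))" by simp
  then obtain Z where Z: "finite Z" "cball (0::'b) (real c) \<subseteq> (\<Union>z\<in>Z. ball z \<zeta>)"
    using \<zeta> unfolding compact_eq_totally_bounded by blast
  define cell where "cell h = {x \<in> Reg. \<forall>j\<in>{1..l}. g j x \<in> ball (h j) \<zeta>}" for h
  have cellm: "cell h \<in> sets borel" for h
  proof -
    have "g j -` ball (h j) \<zeta> \<in> sets borel" if "j \<in> {1..l}" for j
      using measurable_sets[OF g[OF that], of "ball (h j) \<zeta>"] by simp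
    then have "(\<Inter>j\<in>{1..l}. g j -` ball (h j) \<zeta>) \<in> sets borel" if "l \<ge> 1"
      using that by (intro sets.finite_INT) auto
    moreover have "cell h = Reg \<inter> (\<Inter>j\<in>{1..l}. g j -` ball (h j) \<zeta>)" by (auto simp: cell_def)
    ultimately show ?thesis using Reg(1) by (cases "l \<ge> 1") auto
  qed
  define H where "H = (\<Pi>\<^sub>E j\<in>{1..l}. Z)"
  have finH: "finite H" unfolding H_def using Z by (intro finite_PiE) auto
  define Hp where "Hp = {h \<in> H. measure \<mu> (cell h) > 0}"
  define Hz where "Hz = {h \<in> H. measure \<mu> (cell h) = 0}"
  have cover: "Reg - Big (real c) \<subseteq> (\<Union>h\<in>Hp. cell h) \<union> (\<Union>h\<in>Hz. cell h)"
  proof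
    fix x assume x: "x \<in> Reg - Big (real c)"
    have "\<exists>z\<in>Z. g j x \<in> ball z \<zeta>" if "j \<in> {1..l}" for j
    proof -
      have "g j x \<in> cball 0 (real c)" using x that by (auto simp: Big_def not_less)
      then show ?thesis using Z(2) by blast
    qed
    then obtain h0 where h0: "\<And>j. j \<in> {1..l} \<Longrightarrow> h0 j \<in> Z \<and> g j x \<in> ball (h0 j) \<zeta>" by metis
    have "restrict h0 {1..l} \<in> H" "x \<in> cell (restrict h0 {1..l})" using h0 x by (auto simp: H_def cell_def)
    moreover have "measure \<mu> (cell h) > 0 \<or> measure \<mu> (cell h) = 0" for h by (simp add: less_le)
    ultimately show "x \<in> (\<Union>h\<in>Hp. cell h) \<union> (\<Union>h\<in>Hz. cell h)" unfolding Hp_def Hz_def by blast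
  qed
  have fin: "finite Hp" "finite Hz" using finH by (auto simp: Hp_def Hz_def)
  have m: "(\<Union>h\<in>Hp. cell h) \<in> sets \<mu>" "(\<Union>h\<in>Hz. cell h) \<in> sets \<mu>"
    using fin cellm \<mu> by (auto intro!: sets.finite_UN)
  have "measure \<mu> (\<Union>h\<in>Hz. cell h) \<le> (\<Sum>h\<in>Hz. measure \<mu> (cell h))"
    using fin cellm \<mu> by (intro measure_UNION_le) auto
  then have z: "measure \<mu> (\<Union>h\<in>Hz. cell h) \<le> 0" by (simp add: Hz_def)
  have "1 \<le> measure \<mu> (Reg - Big (real c)) + measure \<mu> (Big (real c))"
    using Reg Bigm \<mu> measure_Un_le[of "Reg - Big (real c)" \<mu> "Big (real c)"]
      finite_measure_mono[of Reg "(Reg - Big (real c)) \<union> Big (real c)"] by auto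
  also have "measure \<mu> (Reg - Big (real c)) \<le> measure \<mu> ((\<Union>h\<in>Hp. cell h) \<union> (\<Union>h\<in>Hz. cell h))"
    using cover m by (intro finite_measure_mono) auto
  also have "\<dots> \<le> measure \<mu> (\<Union>h\<in>Hp. cell h) + measure \<mu> (\<Union>h\<in>Hz. cell h)"
    using m by (rule measure_Un_le)
  finally have "measure \<mu> (\<Union>h\<in>Hp. cell h) > 1 - \<epsilon>" using z c by linarith
  moreover have "norm (g j x - g j y) \<le> 2 * \<zeta>" if "x \<in> cell h" "y \<in> cell h" "j \<in> {1..l}" for x y h j
  proof -
    have "dist (h j) (g j x) < \<zeta>" "dist (h j) (g j y) < \<zeta>" using that by (auto simp: cell_def)
    then have "dist (g j x) (g j y) < 2 * \<zeta>" using dist_triangle3[of "g j x" "g j y" "h j"] by linarith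
    then show ?thesis by (simp add: dist_norm)
  qed
  ultimately show ?thesis
    using fin cellm by (intro exI[of _ "cell ` Hp"]) (auto simp: Hp_def cell_def)
qed

lemma le_csum:
  assumes "spectrum_data D" "i \<le> num D" shows "i \<le> csum D i"
  using assms(2)
proof (induction i)
  case (Suc i)
  then show ?case using csum_strict[OF assms(1), of i "Suc i"] by simp
qed simp

lemma sum_rate_bound:
  assumes D: "spectrum_data D" and j: "j < num D" 
    and a: "\<And>j. j \<in> {1..<num D} \<Longrightarrow> a j = real_of_ereal (expo D j) + e"
  shows "(\<Sum>i=1..csum D j. a (idx D i)) = (\<Sum>i=1..csum D j. real_of_ereal (lyap D i)) + real (csum D j) * e"
proof -
  have "(\<Sum>i=1..csum D j. a (idx D i)) = (\<Sum>i=1..csum D j. real_of_ereal (lyap D i) + e)"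
  proof (rule sum.cong)
    fix i assume "i \<in> {1..csum D j}"
    then have "idx D i \<in> {1..<num D}" using idx_props[of i D j] j by auto
    then show "a (idx D i) = real_of_ereal (lyap D i) + e" using a by (simp add: lyap_idx)
  qed simp
  then show ?thesis by (simp add: sum.distrib)
qed

text \<open>
  The tolerances \<open>e\<close> for the exponents and \<open>\<kappa>\<close> for the measure of the bad points are chosen so small
  that the \<open>2 l\<close> exceptional sets, each of proportion \<open>\<tau>\<close>, together have at most a quarter of the
  mass \<open>\<beta>\<close> of the lightest cell.
\<close>

lemma exists_small_constants:
  fixes \<beta> \<rho> d L l :: real
  assumes \<beta>: "\<beta> > 0" and \<rho>: "\<rho> > 0" and d1: "d \<ge> 1" and L0: "L \<ge> 0" and ld: "l \<le> d"
  obtains e \<kappa> \<tau> where "0 < e" "e \<le> \<rho>" "e \<le> 1" "0 < \<kappa>" "\<kappa> \<le> \<beta> / 8"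
    "(d + 2) * e + \<kappa> * L \<le> \<tau> * \<rho>" "\<tau> \<ge> 0" "2 * l * \<tau> \<le> \<beta> / 4"
proof -
  define c where "c = \<beta> * \<rho> / (16 * d)"
  define e where "e = min \<rho> (min 1 (c / (d + 2)))"
  define \<kappa> where "\<kappa> = min (\<beta> / 8) (c / (L + 1))"
  define \<tau> where "\<tau> = \<beta> / (8 * d)"
  have c0: "c > 0" using \<rho> \<beta> d1 by (simp add: c_def)
  have e: "0 < e" "e \<le> \<rho>" "e \<le> 1" "e \<le> c / (d + 2)"
    using \<rho> c0 d1 by (auto simp: e_def)
  have \<kappa>: "0 < \<kappa>" unfolding \<kappa>_def using \<beta> c0 L0 by simp
  have \<kappa>1: "\<kappa> \<le> \<beta> / 8" unfolding \<kappa>_def by (rule min.cobounded1)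
  have \<kappa>2: "\<kappa> \<le> c / (L + 1)" unfolding \<kappa>_def by (rule min.cobounded2)
  have "(d + 2) * e \<le> (d + 2) * (c / (d + 2))" using e d1 by (intro mult_left_mono) auto
  also have "\<dots> = c" using d1 by simp
  finally have 1: "(d + 2) * e \<le> c" .
  have "\<kappa> * L \<le> \<kappa> * (L + 1)" using \<kappa> by (intro mult_left_mono) auto
  also have "\<dots> \<le> (c / (L + 1)) * (L + 1)" using \<kappa>2 L0 by (intro mult_right_mono) auto
  also have "\<dots> = c" using L0 by simp
  finally have 2: "\<kappa> * L \<le> c" .
  have "\<tau> * \<rho> = c + c" using d1 by (simp add: \<tau>_def c_def field_simps)
  then have 3: "(d + 2) * e + \<kappa> * L \<le> \<tau> * \<rho>" using 1 2 by linarith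
  have t0: "\<tau> \<ge> 0" using \<beta> d1 by (simp add: \<tau>_def)
  have "2 * l * \<tau> \<le> 2 * d * \<tau>" using ld t0 by (intro mult_right_mono) auto
  then have "2 * l * \<tau> \<le> \<beta> / 4" using d1 by (simp add: \<tau>_def)
  then show thesis using that[of e \<kappa> \<tau>] e \<kappa> \<kappa>1 3 t0 by blast
qed

text \<open>
  The order of the choices is essential: first the cells and their least mass \<open>\<beta>\<close>, then the
  tolerances \<open>e\<close> and \<open>\<kappa>\<close>, then the bound \<open>C\<close>, the time \<open>n\<close>, the radii \<open>r\<close> and \<open>r2\<close>, and finally \<open>k\<close>.
  The good set \<open>G\<close> is the union of the cells, independently of \<open>k\<close>.
\<close>

lemma splitting_approximated_by_orbit:
  fixes f :: "'a::metric_space \<Rightarrow> 'a" and A :: "'a \<Rightarrow> real^'d^'d"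
  assumes comp: "compact (UNIV :: 'a set)" and f: "continuous_on UNIV f" and A: "continuous_on UNIV A"
    and inv: "invariant_prob f \<mu>" and O: "oseledets_splitting f A \<mu> D"
    and p: "\<And>k. periodic_point f (p k)" and O': "\<And>k. oseledets_splitting f A (orbit_measure f (p k)) (D' k)"
    and ws: "weak_star_conv (\<lambda>k. orbit_measure f (p k)) \<mu>"
    and ly: "\<And>j. j \<in> {1..CARD('d)} \<Longrightarrow> (\<lambda>k. lyap (D' k) j) \<longlonglongrightarrow> lyap D j"
    and \<epsilon>: "0 < \<epsilon>" "\<epsilon> \<le> 1"
  shows "eventually (\<lambda>k. \<exists>G\<in>sets \<mu>. measure \<mu> G > 1 - \<epsilon> \<and> (\<forall>x\<in>G. \<exists>q\<in>forward_orbit f (p k).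
     \<forall>j\<in>{1..num D}. subspace_angle (space_at D j x) (matched_space D (D' k) j q) < \<epsilon>)) sequentially"
proof -
  have s: "sets \<mu> = sets borel" using inv by (auto simp: invariant_prob_def)
  have pr: "prob_space \<mu>" using inv by (auto simp: invariant_prob_def)
  interpret prob_space \<mu> by (rule pr)
  have D: "spectrum_data D" by (rule splitting_spectrum_data[OF O])
  have D': "spectrum_data (D' k)" for k by (rule splitting_spectrum_data[OF O'])
  have r': "regular_at f A (D' k) ((f ^^ i) (p k))" for k i
    by (rule AE_orbit_measure[OF p splitting_AE_regular[OF O']])
  obtain g Reg where g: "\<And>j. j \<in> {1..num D} \<Longrightarrow> g j \<in> borel_measurable borel"
    and Reg: "Reg \<in> sets borel" "measure \<mu> Reg = 1"
      "\<And>x i. x \<in> Reg \<Longrightarrow> regular_at f A D ((f ^^ i) x) \<and> (\<forall>j\<in>{1..num D}. g j ((f ^^ i) x)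
          = oproj D ((f ^^ i) x) j)"
    using exists_regular_set[OF inv f O] by blast
  have reg0: "regular_at f A D x" "\<And>j. j \<in> {1..num D} \<Longrightarrow> g j x = oproj D x j" if "x \<in> Reg" for x
    using Reg(3)[OF that, of 0] by auto
  have "Reg \<noteq> {}" using Reg(2) by auto
  then obtain x0 where "x0 \<in> Reg" by blast
  then have cD: "csum D (num D) = CARD('d)" using csum_num[OF reg0(1)] by blast
  define d where "d = real CARD('d)"
  have d1: "d \<ge> 1" by (simp add: d_def Suc_le_eq)
  have l1: "num D \<ge> 1" using cD by (cases "num D") auto
  have ld: "real (num D) \<le> d" using le_csum[OF D, of "num D"] cD by (simp add: d_def)
  obtain \<rho> where \<rho>: "\<rho> > 0" "\<And>j. j \<in> {1..<num D} \<Longrightarrow> expo D j = ereal (real_of_ereal (expo D j)) \<and>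
      expo D (Suc j) < ereal (real_of_ereal (expo D j) - 4 * \<rho>)"
    using gap_exists[OF D] by blast
  obtain M where M: "M \<ge> 1" "\<And>n x. n > 0 \<Longrightarrow> norm (cocycle f A n x) \<le> M ^ n"
    using norm_cocycle_bound[OF comp A] by blast
  define S where "S = (\<Sum>i=1..CARD('d). \<bar>real_of_ereal (lyap D i)\<bar>)"
  define K where "K = \<bar>ln (fact CARD('d) * M ^ CARD('d))\<bar> + S + d + 1"
  have S0: "S \<ge> 0" unfolding S_def by (rule sum_nonneg) (rule abs_ge_zero)
  have SJ: "\<bar>\<Sum>i=1..csum D j. real_of_ereal (lyap D i)\<bar> \<le> S" if "j \<in> {1..<num D}" for j
  proof -
    have "csum D j \<le> CARD('d)" using csum_mono[of j "num D" D] that cD by auto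
    then have "(\<Sum>i=1..csum D j. \<bar>real_of_ereal (lyap D i)\<bar>) \<le> S"
      unfolding S_def by (intro sum_mono2 abs_ge_zero) auto
    then show ?thesis using sum_abs[of "\<lambda>i. real_of_ereal (lyap D i)" "{1..csum D j}"] by linarith
  qed
  have K: "fact CARD('d) * M ^ CARD('d) \<le> exp K"
  proof -
    have pos: "fact CARD('d) * M ^ CARD('d) > 0" using M(1) by simp
    have "ln (fact CARD('d) * M ^ CARD('d)) \<le> K"
      unfolding K_def using S0 d1 abs_ge_self[of "ln (fact CARD('d) * M ^ CARD('d))"] by linarith
    then have "exp (ln (fact CARD('d) * M ^ CARD('d))) \<le> exp K" by (simp only: exp_le_cancel_iff)
    then show ?thesis by (simp only: exp_ln[OF pos])
  qed
  \<comment> \<open>an error \<open>3 \<zeta>\<close> of the projections gives a distance of at most \<open>6 \<zeta>\<close> between the subspaces\<close>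
  define \<zeta> where "\<zeta> = min (1/12) (sin (\<epsilon> / 2) / 6)"
  have sin0: "sin (\<epsilon> / 2) > 0" using \<epsilon> pi_gt3 by (intro sin_gt_zero) auto
  have \<zeta>: "0 < \<zeta>" "\<zeta> \<le> 1/12" "6 * \<zeta> \<le> sin (\<epsilon> / 2)" using sin0 by (auto simp: \<zeta>_def)
  have "\<exists>\<L>. finite \<L> \<and> (\<forall>L\<in>\<L>. L \<in> sets borel \<and> L \<subseteq> Reg \<and> measure \<mu> L > 0 \<and>
        (\<forall>x\<in>L. \<forall>y\<in>L. \<forall>j\<in>{1..num D}. norm (g j x - g j y) \<le> 2 * \<zeta>)) \<and> measure \<mu> (\<Union>\<L>) > 1 - \<epsilon>"
    by (rule exists_cells[OF pr s _ Reg(1,2) \<zeta>(1) \<epsilon>(1)]) (rule g)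
  then obtain \<L> where LL: "finite \<L> \<and> (\<forall>L\<in>\<L>. L \<in> sets borel \<and> L \<subseteq> Reg \<and> measure \<mu> L > 0 \<and>
        (\<forall>x\<in>L. \<forall>y\<in>L. \<forall>j\<in>{1..num D}. norm (g j x - g j y) \<le> 2 * \<zeta>)) \<and> measure \<mu> (\<Union>\<L>) > 1 - \<epsilon>"
    by (rule exE)
  have L: "finite \<L>" "\<And>L. L \<in> \<L> \<Longrightarrow> L \<in> sets borel \<and> L \<subseteq> Reg \<and> measure \<mu> L > 0"
      "\<And>L x y j. L \<in> \<L> \<Longrightarrow> x \<in> L \<Longrightarrow> y \<in> L \<Longrightarrow> j \<in> {1..num D} \<Longrightarrow> norm (g j x - g j y) \<le> 2 * \<zeta>"
      "measure \<mu> (\<Union>\<L>) > 1 - \<epsilon>"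
    using LL by simp_all
  define \<beta> where "\<beta> = Min (insert 1 (measure \<mu> ` \<L>))"
  have \<beta>: "\<beta> > 0" "\<And>L. L \<in> \<L> \<Longrightarrow> \<beta> \<le> measure \<mu> L"
  proof -
    show "\<beta> > 0" unfolding \<beta>_def using L(1,2) by (subst Min_gr_iff) auto
    show "\<beta> \<le> measure \<mu> L" if "L \<in> \<L>" for L unfolding \<beta>_def using L(1) that by (intro Min_le) auto
  qed
  have K0: "K \<ge> 0" using S0 d1 by (simp add: K_def)
  obtain e \<kappa> \<tau> where e: "0 < e" "e \<le> \<rho>" "e \<le> 1" and \<kappa>: "0 < \<kappa>" "\<kappa> \<le> \<beta> / 8"
    and \<tau>: "(d + 2) * e + \<kappa> * (K + S) \<le> \<tau> * \<rho>" "\<tau> \<ge> 0" "2 * real (num D) * \<tau> \<le> \<beta> / 4"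
    by (rule exists_small_constants[OF \<beta>(1) \<rho>(1) d1 _ ld, of "K + S"]) (use K0 S0 in auto)
  \<comment> \<open>upper rates with gaps of more than \<open>3 \<rho>\<close> at the cuts\<close>
  define a where "a = rate_bound D \<rho> e"
  have rb: "j \<in> {1..num D} \<Longrightarrow> expo D j < ereal (a j)"
    "j \<in> {1..<num D} \<Longrightarrow> a (Suc j) \<le> real_of_ereal (expo D j) - 3 * \<rho>"
    "j \<in> {1..<num D} \<Longrightarrow> a j = real_of_ereal (expo D j) + e" for j
    unfolding a_def using rate_bound_props[of D \<rho> e j, OF D _ e(1,2)] \<rho>(2) by blast+
  have \<kappa>2: "\<kappa> / 2 > 0" using \<kappa> by simp
  have "\<exists>C\<ge>1. \<forall>a. (\<forall>j\<in>{1..num D}. expo D j < ereal (a j)) \<longrightarrow>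
     eventually (\<lambda>n. \<exists>Y\<in>sets borel. Y \<subseteq> Reg \<and> Y \<subseteq> good_set f A D a C n
         \<and> measure \<mu> Y > 1 - \<kappa> / 2) sequentially"
  proof (rule good_set_large[OF inv f A D _ Reg(1,2) _ \<kappa>2])
    show "g j \<in> borel_measurable borel" if "j \<in> {1..num D}" for j by (rule g[OF that])
    show "regular_at f A D ((f ^^ i) x) \<and> (\<forall>j\<in>{1..num D}. g j ((f ^^ i) x) = oproj D ((f ^^ i) x) j)"
      if "x \<in> Reg" for x i by (rule Reg(3)[OF that])
  qed
  then obtain C where CC: "1 \<le> C \<and> (\<forall>a. (\<forall>j\<in>{1..num D}. expo D j < ereal (a j)) \<longrightarrow>
     eventually (\<lambda>n. \<exists>Y\<in>sets borel. Y \<subseteq> Reg \<and> Y \<subseteq> good_set f A D a C n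
         \<and> measure \<mu> Y > 1 - \<kappa> / 2) sequentially)"
    by (rule exE)
  then have C: "C \<ge> 1" by (rule conjunct1)
  \<comment> \<open>\<open>d + C\<close> bounds the norms of the fast projections\<close>
  define \<eta> where "\<eta> = \<zeta> / (1 + 2 * (d + C))"
  have \<eta>: "\<eta> > 0" "\<eta> \<le> 1/2" "\<eta> + 2 * \<eta> * (d + C) \<le> \<zeta>"
  proof -
    have pos: "1 + 2 * (d + C) \<ge> 1" using d1 C by simp
    then show "\<eta> > 0" using \<zeta> by (simp add: \<eta>_def)
    have "\<eta> \<le> \<zeta>" unfolding \<eta>_def using pos \<zeta> by (simp add: divide_le_eq mult_le_cancel_left1)
    then show "\<eta> \<le> 1/2" using \<zeta> by linarith
    have "\<eta> * (1 + 2 * (d + C)) = \<zeta>" unfolding \<eta>_def using pos by simp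
    then show "\<eta> + 2 * \<eta> * (d + C) \<le> \<zeta>" by (simp add: algebra_simps)
  qed
  define c1 where "c1 = (fact CARD('d) * 2 ^ CARD('d) :: real)"
  have ev2: "eventually (\<lambda>n. c1 * exp (real n * 0) \<le> exp (real n * e)) sequentially"
    by (rule eventually_mult_exp_le) (rule e)
  have ev3: "eventually (\<lambda>n. (c1 * 2 / \<eta>) * exp (real n * (- 2 * \<rho>)) \<le> exp (real n * 0)) sequentially"
    by (rule eventually_mult_exp_le) (use \<rho> in auto)
  have Y0: "eventually (\<lambda>n. \<exists>Y\<in>sets borel. Y \<subseteq> Reg \<and> Y \<subseteq> good_set f A D a C n
      \<and> measure \<mu> Y > 1 - \<kappa> / 2) sequentially"
    using CC rb(1) by simp
  have "eventually (\<lambda>n. (\<exists>Y\<in>sets borel. Y \<subseteq> Reg \<and> Y \<subseteq> good_set f A D a C n \<and> measure \<mu> Y > 1 - \<kappa> / 2)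
      \<and> c1 \<le> exp (real n * e) \<and> (c1 * 2 / \<eta>) * exp (real n * (- 2 * \<rho>)) \<le> 1 \<and> n > 0) sequentially"
    using Y0 ev2 ev3 eventually_gt_at_top[of 0] by eventually_elim simp
  then obtain n where nn: "(\<exists>Y\<in>sets borel. Y \<subseteq> Reg \<and> Y \<subseteq> good_set f A D a C n \<and> measure \<mu> Y > 1 - \<kappa> / 2)
      \<and> c1 \<le> exp (real n * e) \<and> (c1 * 2 / \<eta>) * exp (real n * (- 2 * \<rho>)) \<le> 1 \<and> n > 0"
    using eventually_happens'[OF sequentially_bot] by blast
  then obtain Y where Y: "Y \<in> sets borel" "Y \<subseteq> Reg" "Y \<subseteq> good_set f A D a C n" "measure \<mu> Y > 1 - \<kappa> / 2"
    by (elim conjE bexE)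
  note n = nn[THEN conjunct2, THEN conjunct2, THEN conjunct2] nn[THEN conjunct2, THEN conjunct1]
    nn[THEN conjunct2, THEN conjunct2, THEN conjunct1]
  have rate: "fact CARD('d) * 2 ^ (CARD('d) + 1) * exp (real n * (a (Suc j) - a j + \<rho>)) \<le> \<eta>"
    if j: "j \<in> {1..<num D}" for j
  proof -
    have "a (Suc j) - a j + \<rho> \<le> - 2 * \<rho>" using rb(2,3)[OF j] e by linarith
    then have "real n * (a (Suc j) - a j + \<rho>) \<le> real n * (- 2 * \<rho>)" by (rule mult_left_mono) simp
    then have "exp (real n * (a (Suc j) - a j + \<rho>)) \<le> exp (real n * (- 2 * \<rho>))"
        by (simp only: exp_le_cancel_iff)
    then have "c1 * 2 * exp (real n * (a (Suc j) - a j + \<rho>)) \<le> c1 * 2 * exp (real n * (- 2 * \<rho>))"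
      by (rule mult_left_mono) (simp add: c1_def)
    also have "\<dots> = \<eta> * ((c1 * 2 / \<eta>) * exp (real n * (- 2 * \<rho>)))" using \<eta>(1) by simp
    also have "\<dots> \<le> \<eta> * 1" using n(3) \<eta>(1) by (intro mult_left_mono) auto
    finally show ?thesis by (simp add: c1_def mult_ac)
  qed
  \<comment> \<open>the admissible error of \<open>A\<^sup>n\<close> between a good point and a nearby orbit point\<close>
  define \<theta> where "\<theta> = Min ((\<lambda>j. exp (real n * a j)) ` {1..num D}) / C"
  have \<theta>: "\<theta> > 0" "\<And>j. j \<in> {1..num D} \<Longrightarrow> \<theta> \<le> exp (real n * a j) \<and> C * \<theta> \<le> exp (real n * a j)"
  proof -
    have ne: "(\<lambda>j. exp (real n * a j)) ` {1..num D} \<noteq> {}" using l1 by auto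
    have m0: "Min ((\<lambda>j. exp (real n * a j)) ` {1..num D}) > 0" using ne by (subst Min_gr_iff) auto
    then show t0: "\<theta> > 0" using C by (simp add: \<theta>_def)
    fix j assume j: "j \<in> {1..num D}"
    have "C * \<theta> = Min ((\<lambda>j. exp (real n * a j)) ` {1..num D})" using C by (simp add: \<theta>_def)
    also have "\<dots> \<le> exp (real n * a j)" using j by (intro Min_le) auto
    finally have c: "C * \<theta> \<le> exp (real n * a j)" .
    have "1 * \<theta> \<le> C * \<theta>" using C t0 by (intro mult_right_mono) auto
    then show "\<theta> \<le> exp (real n * a j) \<and> C * \<theta> \<le> exp (real n * a j)" using c by linarith
  qed
  have uc1: "uniformly_continuous_on UNIV (cocycle f A n)"
    by (rule compact_uniformly_continuous[OF continuous_cocycle[OF f A] comp])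
  have uc2: "uniformly_continuous_on UNIV (f ^^ n)"
    by (rule compact_uniformly_continuous[OF continuous_funpow[OF f] comp])
  obtain r where r: "r > 0" "\<And>y q. dist y q < r \<Longrightarrow> norm (cocycle f A n q - cocycle f A n y) \<le> \<theta>"
  proof -
    from uc1[unfolded uniformly_continuous_on_def, THEN spec, THEN mp, OF \<theta>(1)]
    obtain r where "r > 0 \<and> (\<forall>y\<in>UNIV. \<forall>q\<in>UNIV. dist q y < r \<longrightarrow> dist (cocycle f A n q) (cocycle f A n y) < \<theta>)"
      by (rule exE)
    then show thesis using that[of r] by (auto simp: dist_commute dist_norm less_imp_le)
  qed
  obtain r2 where r2: "r2 > 0" "r2 \<le> r" "\<And>y q. dist y q < r2 \<Longrightarrow> dist ((f ^^ n) y) ((f ^^ n) q) < r"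
  proof -
    from uc2[unfolded uniformly_continuous_on_def, THEN spec, THEN mp, OF r(1)]
    obtain r0 where "r0 > 0 \<and> (\<forall>y\<in>UNIV. \<forall>q\<in>UNIV. dist q y < r0 \<longrightarrow> dist ((f ^^ n) q) ((f ^^ n) y) < r)"
      by (rule exE)
    then have r0: "r0 > 0" "\<And>y q. dist y q < r0 \<Longrightarrow> dist ((f ^^ n) y) ((f ^^ n) q) < r" by auto
    show thesis by (rule that[of "min r r0"]) (use r0 r(1) in auto)
  qed
  \<comment> \<open>good points that enter the cell at time \<open>n\<close> and are good again there\<close>
  define Z where "Z L = Y \<inter> (f ^^ n) -` (L \<inter> Y)" for L
  have Zm: "measure \<mu> (Z L) > \<beta> / 2" "Z L \<in> sets borel" if Lin: "L \<in> \<L>" for L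
  proof -
    have LY: "L \<inter> Y \<in> sets borel" using L(2)[OF Lin] Y(1) by auto
    note mf = measure_funpow_preimage[OF inv f LY, of n]
    show Zs: "Z L \<in> sets borel" unfolding Z_def using Y(1) mf by auto
    have add: "measure \<mu> (B \<inter> Y) \<ge> measure \<mu> B - \<kappa> / 2" if "B \<in> sets borel" for B
    proof -
      have "measure \<mu> B + measure \<mu> Y = measure \<mu> (B \<union> Y) + measure \<mu> (B \<inter> Y)"
        using that Y(1) s measure_Un3[of B \<mu> Y] by (auto simp: fmeasurable_eq_sets)
      then show ?thesis using prob_le_1[of "B \<union> Y"] Y(4) by linarith
    qed
    have "measure \<mu> (Z L) \<ge> measure \<mu> ((f ^^ n) -` (L \<inter> Y)) - \<kappa> / 2"
      using add[OF mf(1)] by (simp add: Z_def Int_commute)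
    also have "measure \<mu> ((f ^^ n) -` (L \<inter> Y)) = measure \<mu> (L \<inter> Y)" by (rule mf)
    finally have "measure \<mu> (Z L) \<ge> measure \<mu> L - \<kappa>" using add[of L] L(2)[OF Lin] by linarith
    then show "measure \<mu> (Z L) > \<beta> / 2" using \<beta>(2)[OF Lin] \<kappa> \<beta>(1) by linarith
  qed
  define U where "U B \<delta> = (\<Union>y\<in>B. ball y \<delta>)" for B :: "'a set" and \<delta> :: real
  have Uo: "open (U B \<delta>)" for B \<delta> unfolding U_def by auto
  have Um: "measure \<mu> B \<le> measure \<mu> (U B \<delta>)" if "B \<in> sets borel" "\<delta> > 0" for B \<delta>
    using that Uo s by (intro finite_measure_mono) (auto simp: U_def)
  have memU: "x \<in> U B \<delta> \<longleftrightarrow> (\<exists>z\<in>B. dist z x < \<delta>)" for x B \<delta> by (auto simp: U_def)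
  have E1: "eventually (\<lambda>k. (1 - \<kappa>) * real (period f (p k)) < real (card {i. i < period f (p k)
      \<and> (f ^^ i) (p k) \<in> U Y r})) sequentially"
    using Um[OF Y(1) r(1)] Y(4) \<kappa>(1) by (intro orbit_visits_open[OF pr s p ws Uo]) linarith
  have E2: "eventually (\<lambda>k. \<forall>L\<in>\<L>. (\<beta> / 2) * real (period f (p k)) < real (card {i. i < period f (p k)
      \<and> (f ^^ i) (p k) \<in> U (Z L) r2})) sequentially"
  proof (rule eventually_ball_finite[OF L(1)], rule ballI)
    fix L assume Lin: "L \<in> \<L>"
    have "\<beta> / 2 < measure \<mu> (U (Z L) r2)" using Um[OF Zm(2)[OF Lin] r2(1)] Zm(1)[OF Lin] by linarith
    then show "eventually (\<lambda>k. (\<beta> / 2) * real (period f (p k)) < real (card {i. i < period f (p k)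
        \<and> (f ^^ i) (p k) \<in> U (Z L) r2})) sequentially"
      by (rule orbit_visits_open[OF pr s p ws Uo])
  qed
  have cj: "csum D j \<in> {1..CARD('d)}" "csum D j + 1 \<in> {1..CARD('d)}" "lyap D (csum D j)
      = expo D j" "lyap D (csum D j + 1) = expo D (Suc j)"
    if j: "j \<in> {1..<num D}" for j
  proof -
    have 1: "csum D (j - 1) < csum D j" "csum D j < csum D (Suc j)"
        using csum_strict[OF D, of "j - 1" j] csum_strict[OF D, of j "Suc j"] j by auto
    have 2: "csum D (Suc j) \<le> CARD('d)" using csum_mono[of "Suc j" "num D" D] j cD by auto
    show "csum D j \<in> {1..CARD('d)}" "csum D j + 1 \<in> {1..CARD('d)}" using 1 2 by auto
    show "lyap D (csum D j) = expo D j" using idx_eqI[of D "j - 1" "csum D j"] 1 j by (simp add: lyap_idx)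
    show "lyap D (csum D j + 1) = expo D (Suc j)" using idx_eqI[of D j "csum D j + 1"] 1
        by (simp add: lyap_idx)
  qed
  have E3: "eventually (\<lambda>k. \<forall>j\<in>{1..<num D}. lyap (D' k) (csum D j + 1)
      < lyap (D' k) (csum D j)) sequentially"
  proof (rule eventually_ball_finite, simp, rule ballI)
    fix j assume j: "j \<in> {1..<num D}"
    have "expo D (Suc j) < expo D j" using expo_mono[OF D, of j "Suc j"] j by auto
    then obtain t where t: "expo D (Suc j) < t" "t < expo D j" using dense by blast
    have "eventually (\<lambda>k. lyap (D' k) (csum D j + 1) < t) sequentially"
      using ly[OF cj(2)[OF j]] t(1) unfolding cj(4)[OF j] by (rule order_tendstoD)
    moreover have "eventually (\<lambda>k. t < lyap (D' k) (csum D j)) sequentially"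
      using ly[OF cj(1)[OF j]] t(2) unfolding cj(3)[OF j] by (rule order_tendstoD)
    ultimately show "eventually (\<lambda>k. lyap (D' k) (csum D j + 1) < lyap (D' k) (csum D j)) sequentially"
      by eventually_elim (rule less_trans)
  qed
  have lyfin: "lyap D i = ereal (real_of_ereal (lyap D i)) \<and> i \<in> {1..CARD('d)}"
      if "j \<in> {1..<num D}" "i \<in> {1..csum D j}" for i j
  proof -
    have "idx D i \<in> {1..<num D}" using idx_props[of i D j] that by auto
    then show ?thesis using \<rho>(2) cj(1)[OF that(1)] that(2) by (simp add: lyap_idx)
  qed
  have E4: "eventually (\<lambda>k. \<forall>j\<in>{1..<num D}. \<forall>i\<in>{1..csum D j}. lyap (D' k) i \<noteq> -\<infinity>) sequentially"
  proof (intro eventually_ball_finite ballI; simp?)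
    fix j i assume ji: "Suc 0 \<le> j \<and> j < num D" "Suc 0 \<le> i \<and> i \<le> csum D j"
    then have li: "lyap D i = ereal (real_of_ereal (lyap D i))" "i \<in> {1..CARD('d)}" using lyfin[of j i]
        by auto
    have "-\<infinity> < lyap D i" by (subst li(1)) simp
    with ly[OF li(2)] have "eventually (\<lambda>k. -\<infinity> < lyap (D' k) i) sequentially" by (rule order_tendstoD)
    then show "eventually (\<lambda>k. lyap (D' k) i \<noteq> -\<infinity>) sequentially" by eventually_elim auto
  qed
  have E5: "eventually (\<lambda>k. \<forall>j\<in>{1..<num D}. (\<Sum>i=1..csum D j. real_of_ereal (lyap D i)) - e
      < (\<Sum>i=1..csum D j. real_of_ereal (lyap (D' k) i))) sequentially"
  proof (rule eventually_ball_finite, simp, rule ballI)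
    fix j assume j: "j \<in> {1..<num D}"
    have "(\<lambda>k. \<Sum>i=1..csum D j. real_of_ereal (lyap (D' k) i)) \<longlonglongrightarrow> (\<Sum>i=1..csum D j. real_of_ereal (lyap D i))"
    proof (rule tendsto_sum)
      fix i assume i: "i \<in> {1..csum D j}"
      show "(\<lambda>k. real_of_ereal (lyap (D' k) i)) \<longlonglongrightarrow> real_of_ereal (lyap D i)"
        using ly[of i] lyfin[OF j i] by (intro lim_real_of_ereal) auto
    qed
    then show "eventually (\<lambda>k. (\<Sum>i=1..csum D j. real_of_ereal (lyap D i)) - e
      < (\<Sum>i=1..csum D j. real_of_ereal (lyap (D' k) i))) sequentially"
      using e(1) by (intro order_tendstoD) auto
  qed
  show ?thesis
    using E1 E2 E3 E4 E5
  proof eventually_elim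
    case (elim k)
    define P where "P = period f (p k)"
    \<comment> \<open>most of the orbit shadows the good set\<close>
    have few: "real (card {i. i < P \<and> \<not> (\<exists>y\<in>Y. dist y ((f ^^ i) (p k)) < r)}) \<le> \<kappa> * real P"
    proof -
      have "card {i. i < P \<and> (f ^^ i) (p k) \<in> U Y r} + card {i. i < P \<and> \<not> (\<exists>y\<in>Y. dist y ((f ^^ i) (p k))
          < r)}
          = card ({i. i < P \<and> (f ^^ i) (p k) \<in> U Y r} \<union> {i. i < P \<and> \<not> (\<exists>y\<in>Y. dist y ((f ^^ i) (p k)) < r)})"
        by (intro card_Un_disjoint [symmetric]) (auto simp: memU)
      also have "{i. i < P \<and> (f ^^ i) (p k) \<in> U Y r} \<union> {i. i < P \<and> \<not> (\<exists>y\<in>Y. dist y ((f ^^ i) (p k))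
          < r)} = {..<P}"
        by (auto simp: memU)
      finally have ce: "card {i. i < P \<and> (f ^^ i) (p k) \<in> U Y r} + card {i. i < P
          \<and> \<not> (\<exists>y\<in>Y. dist y ((f ^^ i) (p k)) < r)} = card {..<P}" .
      have "real (card {i. i < P \<and> (f ^^ i) (p k) \<in> U Y r}) + real (card {i. i < P
          \<and> \<not> (\<exists>y\<in>Y. dist y ((f ^^ i) (p k)) < r)}) = real P"
        using arg_cong[OF ce, of real] by (simp only: of_nat_add card_lessThan)
      moreover have "(1 - \<kappa>) * real P = real P - \<kappa> * real P" by (simp add: algebra_simps)
      ultimately show ?thesis using elim(1) unfolding P_def [symmetric] by linarith
    qed
    have main: "\<exists>z\<in>Z L. \<exists>q\<in>forward_orbit f (p k). \<forall>j\<in>{1..<num D}.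
       (small_on \<eta> (mat 1 - fast_proj D ((f ^^ n) z) j) (rng (fast_proj (D' k) q (cut_index D (D' k) j)))) \<and>
       (small_on \<eta> (transpose (mat 1 - fast_proj D ((f ^^ n) z) j)) (rng (transpose (fast_proj (D' k) q
           (cut_index D (D' k) j)))))" if Lin: "L \<in> \<L>" for L
    proof (rule exists_good_orbit_point[where E=e and ?r2.0=r2 and \<tau>=\<tau> and \<rho>=\<rho> and \<eta>=\<eta> and Z="Z L" and
        a=a and \<theta>=\<theta>,
          OF p D cD D' r' _ _ n(1) _ M(1) K Y(3) _ _ _ few[unfolded P_def]])
      show "lyap (D' k) (csum D j + 1) < lyap (D' k) (csum D j)" if "j \<in> {1..<num D}" for j
          using elim(3) that by blast
      show "lyap (D' k) i \<noteq> -\<infinity>" if "j \<in> {1..<num D}" "i \<in> {1..csum D j}" for j i using elim(4) that by blast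
      show "norm (cocycle f A n x) \<le> M ^ n" for x by (rule M(2)[OF n(1)])
      show "0 \<le> \<theta>" using \<theta>(1) by simp
      show "\<theta> \<le> exp (real n * a j) \<and> C * \<theta> \<le> exp (real n * a j)" if "j \<in> {1..num D}" for j
          by (rule \<theta>(2)[OF that])
      show "norm (cocycle f A n q - cocycle f A n y) \<le> \<theta>" if "dist y q < r" for y q by (rule r(2)[OF that])
      have bnd: "(\<Sum>i=1..csum D j. a (idx D i)) + e \<le> K \<and> (\<Sum>i=1..csum D j. a (idx D i)) + e
        - (\<Sum>i=1..csum D j. real_of_ereal (lyap (D' k) i)) + \<kappa> * (K - ((\<Sum>i=1..csum D j. a (idx D i))
            + e)) \<le> \<tau> * \<rho>"
        if j: "j \<in> {1..<num D}" for j
      proof -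
        define \<sigma> where "\<sigma> = (\<Sum>i=1..csum D j. real_of_ereal (lyap D i))"
        have sm: "(\<Sum>i=1..csum D j. a (idx D i)) = \<sigma> + real (csum D j) * e"
          unfolding \<sigma>_def using j by (intro sum_rate_bound[OF D]) (auto intro: rb(3))
        have \<sigma>: "\<bar>\<sigma>\<bar> \<le> S" unfolding \<sigma>_def by (rule SJ[OF j])
        have "real (csum D j) \<le> d" using cj(1)[OF j] by (simp add: d_def)
        then have ce: "0 \<le> real (csum D j) * e" "real (csum D j) * e \<le> d * e" "d * e \<le> d"
          using e d1 by (auto intro: mult_right_mono simp: mult_left_le)
        have 1: "(\<Sum>i=1..csum D j. a (idx D i)) + e \<le> K" unfolding sm K_def using \<sigma> ce e by linarith
        have "\<sigma> - e < (\<Sum>i=1..csum D j. real_of_ereal (lyap (D' k) i))" using elim(5) j by (auto simp: \<sigma>_def)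
        then have 2: "(\<Sum>i=1..csum D j. a (idx D i)) + e - (\<Sum>i=1..csum D j. real_of_ereal (lyap (D' k)
            i)) \<le> (d + 2) * e"
          unfolding sm using ce by (simp add: algebra_simps)
        have "K - ((\<Sum>i=1..csum D j. a (idx D i)) + e) \<le> K + S" unfolding sm using \<sigma> ce e by linarith
        then have "\<kappa> * (K - ((\<Sum>i=1..csum D j. a (idx D i)) + e)) \<le> \<kappa> * (K + S)" using \<kappa>(1)
            by (intro mult_left_mono) auto
        then show ?thesis using 1 2 \<tau>(1) by linarith
      qed
      show "(\<Sum>i=1..csum D j. a (idx D i)) + e \<le> K" if "j \<in> {1..<num D}" for j using bnd[OF that] by blast
      show "(\<Sum>i=1..csum D j. a (idx D i)) + e - (\<Sum>i=1..csum D j. real_of_ereal (lyap (D' k) i))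
         + \<kappa> * (K - ((\<Sum>i=1..csum D j. a (idx D i)) + e)) \<le> \<tau> * \<rho>" if "j \<in> {1..<num D}" for j
             using bnd[OF that] by blast
      show "fact CARD('d) * 2 ^ CARD('d) \<le> exp (real n * e)" using n(2) by (simp add: c1_def)
      show "0 \<le> e" "0 < \<rho>" "0 \<le> \<tau>" using e \<rho> \<tau> by auto
      show "fact CARD('d) * 2 ^ (CARD('d) + 1) * exp (real n * (a (Suc j) - a j + \<rho>)) \<le> \<eta>"
          if "j \<in> {1..<num D}" for j by (rule rate[OF that])
      show "r2 \<le> r" by (rule r2)
      show "dist ((f ^^ n) y) ((f ^^ n) q) < r" if "dist y q < r2" for y q by (rule r2(3)[OF that])
      show "Z L \<subseteq> Y" by (auto simp: Z_def)
      show "(f ^^ n) z \<in> Y" if "z \<in> Z L" for z using that by (auto simp: Z_def)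
      have "2 * real (num D) * \<tau> * real (period f (p k)) \<le> (\<beta> / 4) * real (period f (p k))"
        using \<tau>(3) by (intro mult_right_mono) auto
      also have "\<dots> \<le> (\<beta> / 2) * real (period f (p k))" using \<beta>(1) by (intro mult_right_mono) auto
      also have "\<dots> < real (card {i. i < period f (p k) \<and> (f ^^ i) (p k) \<in> U (Z L) r2})"
          using elim(2) Lin by blast
      finally show "2 * real (num D) * \<tau> * real (period f (p k)) < real (card {i. i < period f (p k)
          \<and> (\<exists>z\<in>Z L. dist z ((f ^^ i) (p k)) < r2)})"
        by (simp add: memU)
    qed
    show ?case
    proof (intro bexI[of _ "\<Union>\<L>"] conjI ballI)
      show "\<Union>\<L> \<in> sets \<mu>" using L(1,2) s by (auto intro!: sets.finite_Union)
      show "measure \<mu> (\<Union>\<L>) > 1 - \<epsilon>" by (rule L(4))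
      fix x assume "x \<in> \<Union>\<L>"
      then obtain L where Lin: "L \<in> \<L>" "x \<in> L" by blast
      obtain z q where z: "z \<in> Z L" and q: "q \<in> forward_orbit f (p k)"
        and pd: "\<And>j. j \<in> {1..<num D} \<Longrightarrow>
       (small_on \<eta> (mat 1 - fast_proj D ((f ^^ n) z) j) (rng (fast_proj (D' k) q (cut_index D (D' k) j)))) \<and>
       (small_on \<eta> (transpose (mat 1 - fast_proj D ((f ^^ n) z) j)) (rng (transpose (fast_proj (D' k) q
           (cut_index D (D' k) j)))))"
        using main[OF Lin(1)] by blast
      define x' where "x' = (f ^^ n) z"
      have x'L: "x' \<in> L" "x' \<in> Y" using z by (auto simp: Z_def x'_def)
      have xR: "x \<in> Reg" "x' \<in> Reg" using L(2)[OF Lin(1)] Lin(2) x'L by auto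
      obtain i where qi: "q = (f ^^ i) (p k)" using q by (auto simp: forward_orbit_def)
      show "\<exists>q\<in>forward_orbit f (p k). \<forall>j\<in>{1..num D}. subspace_angle (space_at D j x) (matched_space D
          (D' k) j q) < \<epsilon>"
      proof (intro bexI[of _ q] ballI)
        fix j assume j: "j \<in> {1..num D}"
        have "0 \<le> subspace_dist (space_at D j x) (matched_space D (D' k) j q) \<and>
          subspace_dist (space_at D j x) (matched_space D (D' k) j q) \<le> 3 * \<zeta> / (1 - 3 * \<zeta>)"
        proof (rule matched_space_close[OF D D' reg0(1)[OF xR(1)] reg0(1)[OF xR(2)] _ _ _ _ _ _
            less_imp_le[OF \<eta>(1)] \<eta>(2,3) _ _ j])
          show "regular_at f A (D' k) q" unfolding qi by (rule r')
          show "lyap (D' k) (csum D j + 1) < lyap (D' k) (csum D j)" if "j \<in> {1..<num D}" for j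
              using elim(3) that by blast
          show "norm ((mat 1 - fast_proj D x' j) *v w) \<le> \<eta> * norm w"
            if "j \<in> {1..<num D}" "w \<in> rng (fast_proj (D' k) q (cut_index D (D' k) j))" for j w
            using pd[OF that(1)] that(2) unfolding x'_def by blast
          show "norm (transpose (mat 1 - fast_proj D x' j) *v w) \<le> \<eta> * norm w"
            if "j \<in> {1..<num D}" "w \<in> rng (transpose (fast_proj (D' k) q (cut_index D (D' k) j)))" for j w
            using pd[OF that(1)] that(2) unfolding x'_def by blast
          show "norm (fast_proj D x' j) \<le> d + C" if "j \<le> num D" for j
          proof -
            have "norm (mat 1 - fast_proj D x' j) \<le> C"
              using x'L(2) Y(3) that by (auto simp: good_set_def)
            moreover have "norm (mat 1 :: real^'d^'d) \<le> (\<Sum>s\<in>(UNIV::'d set). norm (column s (mat 1 ::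
                real^'d^'d)))"
              by (rule norm_matrix_le_sum_columns)
            moreover have "column s (mat 1 :: real^'d^'d) = axis s 1" for s
              using matrix_vector_mult_basis[of "mat 1 :: real^'d^'d" s] by simp
            moreover have "norm (fast_proj D x' j) \<le> norm (mat 1 :: real^'d^'d)
                + norm (mat 1 - fast_proj D x' j)"
              using norm_triangle_ineq4[of "mat 1 :: real^'d^'d" "mat 1 - fast_proj D x' j"] by simp
            ultimately show ?thesis by (simp add: norm_axis_1 d_def)
          qed
          show "norm (oproj D x j - oproj D x' j) \<le> 2 * \<zeta>" if "j \<in> {1..num D}" for j
            using L(3)[OF Lin x'L(1) that] reg0(2)[OF xR(1) that] reg0(2)[OF xR(2) that] by simp
          show "0 \<le> \<zeta>" "3 * \<zeta> < 1" using \<zeta> by auto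
        qed
        moreover have "3 * \<zeta> / (1 - 3 * \<zeta>) \<le> sin (\<epsilon> / 2)"
        proof -
          have "3 * \<zeta> \<le> (6 * \<zeta>) * (1 - 3 * \<zeta>)"
          proof -
            have "(6 * \<zeta>) * (1/2) \<le> (6 * \<zeta>) * (1 - 3 * \<zeta>)" using \<zeta> by (intro mult_left_mono) auto
            then show ?thesis by simp
          qed
          then have "3 * \<zeta> / (1 - 3 * \<zeta>) \<le> 6 * \<zeta>" using \<zeta> by (simp add: pos_divide_le_eq)
          then show ?thesis using \<zeta>(3) by linarith
        qed
        ultimately have "subspace_angle (space_at D j x) (matched_space D (D' k) j q)
            \<le> arcsin (sin (\<epsilon> / 2))"
          unfolding subspace_angle_def by (intro arcsin_le_arcsin) auto
        also have "arcsin (sin (\<epsilon> / 2)) = \<epsilon> / 2" using \<epsilon> pi_gt3 by (intro arcsin_sin) auto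
        finally show "subspace_angle (space_at D j x) (matched_space D (D' k) j q) < \<epsilon>" using \<epsilon>(1)
            by linarith
      qed (rule q)
    qed
  qed
qed

theorem theorem2p1:
  fixes f :: "'a::metric_space \<Rightarrow> 'a"
    and A :: "'a \<Rightarrow> real^'d^'d"
    and \<mu> :: "'a measure"
  assumes "compact (UNIV :: 'a set)"
    and "\<exists>g. homeomorphism UNIV UNIV f g"
    and "ergodic_prob f \<mu>"
    and "continuous_on UNIV A"
    and "periodic_approx_exponents f A \<mu>"
  shows "periodic_approx_splitting f A \<mu>"
proof -
  have f: "continuous_on UNIV f" using assms(2) by (auto simp: homeomorphism_def)
  have inv: "invariant_prob f \<mu>" using assms(3) by (simp add: ergodic_prob_def)
  interpret prob_space \<mu> using inv by (simp add: invariant_prob_def)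
  obtain D0 p D' where O0: "oseledets_splitting f A \<mu> D0"
    and pp: "\<And>k. periodic_point f (p k)" "\<And>k. oseledets_splitting f A (orbit_measure f (p k)) (D' k)"
    and ws: "weak_star_conv (\<lambda>k. orbit_measure f (p k)) \<mu>"
    and ly0: "\<And>j. j \<in> {1..CARD('d)} \<Longrightarrow> (\<lambda>k. lyap (D' k) j) \<longlonglongrightarrow> lyap D0 j"
    using assms(5) unfolding periodic_approx_exponents_def by blast
  show ?thesis
    unfolding periodic_approx_splitting_def
  proof (intro conjI allI impI)
    show "\<exists>D. oseledets_splitting f A \<mu> D" using O0 by blast
    fix D assume O: "oseledets_splitting f A \<mu> D"
    have "AE x in \<mu>. regular_at f A D0 x \<and> regular_at f A D x"
      using splitting_AE_regular[OF O0] splitting_AE_regular[OF O] by (rule eventually_conj)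
    then obtain x where x: "regular_at f A D0 x" "regular_at f A D x"
      using eventually_happens' ae_filter_bot
          by (metis (mono_tags, lifting) ae_filter_eq_bot_iff emeasure_space_1 zero_neq_one)
    have ly: "(\<lambda>k. lyap (D' k) j) \<longlonglongrightarrow> lyap D j" if "j \<in> {1..CARD('d)}" for j
      using ly0[OF that] lyap_unique[OF splitting_spectrum_data[OF O0] x(1) splitting_spectrum_data[OF
          O] x(2) that] by simp
    define R where "R \<epsilon> k G \<longleftrightarrow> G \<in> sets \<mu> \<and> measure \<mu> G > 1 - \<epsilon> \<and> (\<forall>x\<in>G. \<exists>q\<in>forward_orbit f (p k).
     \<forall>j\<in>{1..num D}. subspace_angle (space_at D j x) (matched_space D (D' k) j q) < \<epsilon>)" for \<epsilon> k G
    have ev: "eventually (\<lambda>k. \<exists>G. R \<epsilon> k G) sequentially" if "0 < \<epsilon>" "\<epsilon> \<le> 1" for \<epsilon>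
    proof -
      have "eventually (\<lambda>k. \<exists>G\<in>sets \<mu>. measure \<mu> G > 1 - \<epsilon> \<and> (\<forall>x\<in>G. \<exists>q\<in>forward_orbit f (p k).
     \<forall>j\<in>{1..num D}. subspace_angle (space_at D j x) (matched_space D (D' k) j q) < \<epsilon>)) sequentially"
        by (rule splitting_approximated_by_orbit[OF assms(1) f assms(4) inv O pp ws _ that]) (rule ly)
      then show ?thesis by eventually_elim (auto simp: R_def)
    qed
    \<comment> \<open>a subsequence along which the tolerance \<open>1/k\<close> is reached\<close>
    have "\<exists>k'\<ge>k. \<exists>G. R (1 / real k) k' G" if "k \<ge> 1" for k :: nat
    proof -
      have "eventually (\<lambda>k'. (\<exists>G. R (1 / real k) k' G) \<and> k' \<ge> k) sequentially"
        using that by (intro eventually_conj ev eventually_ge_at_top) auto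
      then show ?thesis by (auto simp: eventually_sequentially)
    qed
    then obtain \<phi> G where \<phi>G: "\<And>k::nat. k \<ge> 1 \<Longrightarrow> \<phi> k \<ge> k \<and> R (1 / real k) (\<phi> k) (G k)" by metis
    have lim: "filterlim \<phi> at_top sequentially"
    proof (rule filterlim_at_top_mono[OF filterlim_ident])
      show "eventually (\<lambda>k. k \<le> \<phi> k) sequentially"
        using eventually_ge_at_top[of 1] by eventually_elim (use \<phi>G in blast)
    qed
    have ws': "weak_star_conv (\<lambda>k. orbit_measure f (p (\<phi> k))) \<mu>"
      using ws unfolding weak_star_conv_def by (auto intro: filterlim_compose[OF _ lim])
    show "\<exists>p D' G. (\<forall>k. periodic_point f (p k) \<and> oseledets_splitting f A (orbit_measure f (p k)) (D' k)) \<and>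
          weak_star_conv (\<lambda>k. orbit_measure f (p k)) \<mu> \<and>
          (\<forall>k\<ge>1. G k \<in> sets \<mu> \<and> measure \<mu> (G k) > 1 - 1 / real k \<and>
             (\<forall>x\<in>G k. \<exists>q\<in>forward_orbit f (p k). \<forall>j\<in>{1..num D}.
                subspace_angle (space_at D j x) (matched_space D (D' k) j q) < 1 / real k))"
    proof (intro exI conjI allI impI)
      show "periodic_point f (p (\<phi> k))" "oseledets_splitting f A (orbit_measure f (p (\<phi> k))) (D' (\<phi> k))"
          for k
        by (rule pp)+
      show "weak_star_conv (\<lambda>k. orbit_measure f (p (\<phi> k))) \<mu>" by (rule ws')
      fix k :: nat assume "1 \<le> k"
      then have "R (1 / real k) (\<phi> k) (G k)" using \<phi>G by blast
      then show "G k \<in> sets \<mu>" "measure \<mu> (G k) > 1 - 1 / real k"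
        "\<forall>x\<in>G k. \<exists>q\<in>forward_orbit f (p (\<phi> k)). \<forall>j\<in>{1..num D}.
                subspace_angle (space_at D j x) (matched_space D (D' (\<phi> k)) j q) < 1 / real k"
        by (auto simp: R_def)
    qed
  qed
qed

end
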